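(* Let $E_i=\mathbb C/(\mathbb Z+i\mathbb Z)$, $X=E_i\times E_i$ with the flat Kähler metric, $\Omega=dz_1\wedge dz_2$, $\tau(z_1,z_2)=(\overline z_1,\overline z_2)$ and $\widehat G=\langle\tau\rangle\cong C_2$. Let $\mathcal B=H^*_{\mathrm{Ori}}(X,\widehat G)$ be the associated surface orientifold algebra. The invariant ambient algebra $H^*(X;\mathbb R)^\tau$ is $$R_0=\Lambda_{\mathbb R}(x_1,x_2)\otimes\mathbb R[P]/(P^2),\qquad|x_1|=|x_2|=1,\quad|P|=2,$$ and the full algebra has the vector-space decomposition $$\mathcal B=R_0\oplus\bigoplus_{\varepsilon\in\{0,1\}^2}\Lambda_{\mathbb R}(x_1,x_2)\,e_\varepsilon,\qquad|e_\varepsilon|=1.$$ Besides the relations in $R_0$, its presentation is $$e_\varepsilon x_k=x_ke_\varepsilon,\qquad Pe_\varepsilon=e_\varepsilon P=0,\qquad e_\varepsilon e_{\varepsilon'}=\delta_{\varepsilon,\varepsilon'}P.$$ Its shifted Poincaré polynomial and dimension are $P_{\mathcal B}(t)=1+6t+10t^2+6t^3+t^4$ and $\dim_{\mathbb R}\mathcal B=24$. The trace $\operatorname{Tr}(q)=1$ defines a nondegenerate Frobenius pairing.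
   Context: The fixed locus $X^\tau$ is the disjoint union of the four tori $L_\varepsilon=\{y_1=\varepsilon_1/2,\ y_2=\varepsilon_2/2\}$, $\varepsilon=(\varepsilon_1,\varepsilon_2)\in\{0,1\}^2$, where $z_k=x_k+iy_k$. Each is oriented by $dx_1\wedge dx_2=\operatorname{Re}\Omega|_{L_\varepsilon}$; $X$ has its complex orientation. $x_k,y_k$ also denote the integral degree-one cohomology classes of $dx_k,dy_k$; $q=x_1y_1x_2y_2$ (so $\int_Xq=1$) and $P=-y_1y_2$. The algebra $\mathcal B$: in shifted degree $k$, $\mathcal B^k=H^k(X;\mathbb R)^\tau\oplus\bigoplus_\varepsilon H^{k-1}(L_\varepsilon;\mathbb R)$, which is the $\tau$-invariant part of the group-labelled space $H^k(X)\oplus H^{k-1}(X^\tau)$. With inclusions $i_\varepsilon:L_\varepsilon\to X$, the product is: $a\star b=a\smile b$ for ambient classes; $a\star\eta=i_\varepsilon^*a\wedge\eta$ and $\eta\star a=\eta\wedge i_\varepsilon^*a$ for $\eta\in H^*(L_\varepsilon)$; $\eta\star\xi=(i_\varepsilon)_*(\eta\wedge\xi)$ (oriented Gysin map) for $\eta,\xi\in H^*(L_\varepsilon)$; and $\eta\star\xi=0$ for classes on different components. $e_\varepsilon$ is the shifted copy of the unit $1\in H^0(L_\varepsilon)$. The trace is $\operatorname{Tr}(\alpha)=\int_X\alpha$ on the ambient summand and zero on the reflection summands, and the pairing is $\langle\alpha,\beta\rangle=\operatorname{Tr}(\alpha\star\beta)$. *)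

theory Defs
  imports "HOL-Analysis.Analysis" "HOL-Library.Poly_Mapping"
    "HOL-Computational_Algebra.Polynomial_FPS"
begin

section \<open>De Rham cohomology of a torus\<close>

text \<open>
  A torus is \<open>V / \<Gamma>\<close> for a Euclidean space \<open>V\<close> and a lattice \<open>\<Gamma> = period_lattice\<close>. The
  lattices are \<open>\<int>\<close> in \<open>\<real>\<close>, \<open>\<int> + i\<int>\<close> in \<open>\<complex>\<close>, and products thereof. So the type
  \<open>complex \<times> complex\<close> carries the surface \<open>X = E\<^sub>i \<times> E\<^sub>i\<close>, and \<open>real \<times> real\<close> the torus
  \<open>(\<real>/\<int>)\<^sup>2\<close>. Differential forms on \<open>V / \<Gamma>\<close> are the \<open>\<Gamma>\<close>-invariant forms on \<open>V\<close>, since \<open>\<Gamma>\<close> acts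
  freely and properly discontinuously by translations.
\<close>

class periodic_space = euclidean_space +
  fixes period_lattice :: "'a set"

instantiation real :: periodic_space
begin
definition period_lattice_real :: "real set" where "period_lattice_real = \<int>"
instance ..
end

instantiation complex :: periodic_space
begin
definition period_lattice_complex :: "complex set" where
  "period_lattice_complex = {z. Re z \<in> \<int> \<and> Im z \<in> \<int>}"
instance ..
end

instantiation prod :: (periodic_space, periodic_space) periodic_space
begin
definition period_lattice_prod :: "('a \<times> 'b) set" where
  "period_lattice_prod = period_lattice \<times> period_lattice"
instance ..
end

primrec Ck :: "nat \<Rightarrow> ('a::real_normed_vector \<Rightarrow> real) \<Rightarrow> bool" where
  "Ck 0 f \<longleftrightarrow> continuous_on UNIV f"
| "Ck (Suc k) f \<longleftrightarrow> (\<forall>x. f differentiable (at x)) \<and> (\<forall>v. Ck k (\<lambda>x. frechet_derivative f (at x) v))"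

definition smooth :: "('a::real_normed_vector \<Rightarrow> real) \<Rightarrow> bool" where
  "smooth f \<longleftrightarrow> (\<forall>k. Ck k f)"

text \<open>
  A possibly inhomogeneous differential form \<open>\<omega>\<close> is a function of a point and a list of tangent
  vectors; the restriction of \<open>\<omega> x\<close> to lists of length \<open>k\<close> is the degree \<open>k\<close> component of \<open>\<omega>\<close> at
  \<open>x\<close>. Alternation makes the components of degree above the dimension vanish.
\<close>

type_synonym 'a form = "'a \<Rightarrow> 'a list \<Rightarrow> real"

definition alternating :: "('a::real_vector list \<Rightarrow> real) \<Rightarrow> bool" where
  "alternating \<phi> \<longleftrightarrow>
     (\<forall>us ws. linear (\<lambda>v. \<phi> (us @ v # ws))) \<and> (\<forall>vs. \<not> distinct vs \<longrightarrow> \<phi> vs = 0)"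

definition forms :: "'a::periodic_space form set" where
  "forms = {\<omega>. (\<forall>x. alternating (\<omega> x)) \<and> (\<forall>vs. smooth (\<lambda>x. \<omega> x vs)) \<and>
               (\<forall>x. \<forall>l\<in>period_lattice. \<omega> (x + l) = \<omega> x)}"

definition homogeneous :: "int \<Rightarrow> 'a form \<Rightarrow> bool" where
  "homogeneous k \<omega> \<longleftrightarrow> (\<forall>x vs. int (length vs) \<noteq> k \<longrightarrow> \<omega> x vs = 0)"

text \<open>
  \<open>(d\<omega>)(v\<^sub>0, \<dots>, v\<^sub>k) = \<Sum>\<^sub>i (-1)\<^sup>i \<partial>\<^sub>v\<^sub>i \<omega>(v\<^sub>0, \<dots>, v\<^sub>i omitted, \<dots>, v\<^sub>k)\<close> for constant vector fields \<open>v\<^sub>i\<close>.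
\<close>

definition ext_d :: "'a::real_normed_vector form \<Rightarrow> 'a form" where
  "ext_d \<omega> = (\<lambda>x vs. \<Sum>i<length vs.
      (-1) ^ i * frechet_derivative (\<lambda>y. \<omega> y (nths vs (- {i}))) (at x) (vs ! i))"

text \<open>
  The wedge product is the sum over all shuffles: \<open>I\<close> is the set of positions of the vectors that
  are fed to \<open>\<alpha>\<close>, and the exponent counts the inversions of the shuffle. In this normalization
  \<open>(dx \<and> dy)(\<partial>\<^sub>x, \<partial>\<^sub>y) = 1\<close>.
\<close>

definition wedge :: "'a form \<Rightarrow> 'a form \<Rightarrow> 'a form" where
  "wedge \<alpha> \<beta> = (\<lambda>x vs. \<Sum>I\<in>Pow {..<length vs}.
      (-1) ^ card {(i, j). i \<in> I \<and> j \<in> {..<length vs} - I \<and> j < i}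
        * \<alpha> x (nths vs I) * \<beta> x (nths vs (- I)))"

definition pullback ::
    "('a::real_normed_vector \<Rightarrow> 'b::real_normed_vector) \<Rightarrow> 'b form \<Rightarrow> 'a form" where
  "pullback f \<omega> = (\<lambda>x vs. \<omega> (f x) (map (frechet_derivative f (at x)) vs))"

definition fun_form :: "('a \<Rightarrow> real) \<Rightarrow> 'a form" where
  "fun_form f = (\<lambda>x vs. if vs = [] then f x else 0)"

definition closed_forms :: "'a::periodic_space form set" where
  "closed_forms = {\<omega> \<in> forms. \<forall>x vs. ext_d \<omega> x vs = 0}"

definition cohomologous :: "'a::periodic_space form \<Rightarrow> 'a form \<Rightarrow> bool" where
  "cohomologous \<alpha> \<beta> \<longleftrightarrow> \<alpha> \<in> closed_forms \<and> \<beta> \<in> closed_forms \<and>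
     (\<exists>\<gamma>\<in>forms. \<forall>x vs. \<alpha> x vs - \<beta> x vs = ext_d \<gamma> x vs)"

lemma Ck_const: "Ck k (\<lambda>x. c)"
  by (induction k arbitrary: c) simp_all

lemma Ck_lin: "Ck k f \<Longrightarrow> Ck k g \<Longrightarrow> Ck k (\<lambda>x. a * f x + b * g x)"
proof (induction k arbitrary: f g)
  case 0
  then show ?case by (auto intro!: continuous_intros)
next
  case (Suc k)
  have D: "((\<lambda>x. a * f x + b * g x) has_derivative
      (\<lambda>v. a * frechet_derivative f (at x) v + b * frechet_derivative g (at x) v)) (at x)" for x
    using Suc.prems unfolding Ck.simps frechet_derivative_works
    by (intro has_derivative_add has_derivative_mult_right) auto
  then have "frechet_derivative (\<lambda>x. a * f x + b * g x) (at x) =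
      (\<lambda>v. a * frechet_derivative f (at x) v + b * frechet_derivative g (at x) v)" for x
    using frechet_derivative_at by metis
  with D Suc show ?case by (auto simp: differentiable_def)
qed

lemma smooth_lin: "smooth f \<Longrightarrow> smooth g \<Longrightarrow> smooth (\<lambda>x. a * f x + b * g x)"
  by (simp add: smooth_def Ck_lin)

lemma smooth_differentiable: "smooth f \<Longrightarrow> f differentiable (at x)"
  unfolding smooth_def by (metis Ck.simps(2))

lemma alternating_lin:
  "alternating \<phi> \<Longrightarrow> alternating \<psi> \<Longrightarrow> alternating (\<lambda>vs. a * \<phi> vs + b * \<psi> vs)"
  unfolding alternating_def linear_iff by (auto simp: algebra_simps)

lemma forms_lin:
  "\<alpha> \<in> forms \<Longrightarrow> \<beta> \<in> forms \<Longrightarrow> (\<lambda>x vs. a * \<alpha> x vs + b * \<beta> x vs) \<in> forms"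
  by (auto simp: forms_def intro: alternating_lin smooth_lin)

lemma zero_forms: "(\<lambda>x vs. 0) \<in> forms"
  by (simp add: forms_def alternating_def smooth_def Ck_const linear_zero)

lemma ext_d_zero: "ext_d (\<lambda>x vs. 0) = (\<lambda>x vs. 0)"
  by (simp add: ext_d_def)

lemma ext_d_lin:
  assumes "\<alpha> \<in> forms" "\<beta> \<in> forms"
  shows "ext_d (\<lambda>x vs. a * \<alpha> x vs + b * \<beta> x vs) x vs = a * ext_d \<alpha> x vs + b * ext_d \<beta> x vs"
proof -
  have "frechet_derivative (\<lambda>y. a * \<alpha> y us + b * \<beta> y us) (at x) =
      (\<lambda>v. a * frechet_derivative (\<lambda>y. \<alpha> y us) (at x) v
         + b * frechet_derivative (\<lambda>y. \<beta> y us) (at x) v)" for us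
  proof -
    have "(\<lambda>y. \<alpha> y us) differentiable (at x)" "(\<lambda>y. \<beta> y us) differentiable (at x)"
      using assms by (auto simp: forms_def intro: smooth_differentiable)
    then have "((\<lambda>y. a * \<alpha> y us + b * \<beta> y us) has_derivative
      (\<lambda>v. a * frechet_derivative (\<lambda>y. \<alpha> y us) (at x) v
         + b * frechet_derivative (\<lambda>y. \<beta> y us) (at x) v)) (at x)"
      unfolding frechet_derivative_works by (intro has_derivative_add has_derivative_mult_right)
    then show ?thesis using frechet_derivative_at by metis
  qed
  then show ?thesis
    by (simp add: ext_d_def sum_distrib_left algebra_simps flip: sum.distrib)
qed

lemma closed_forms_lin:
  "\<alpha> \<in> closed_forms \<Longrightarrow> \<beta> \<in> closed_forms \<Longrightarrow> (\<lambda>x vs. a * \<alpha> x vs + b * \<beta> x vs) \<in> closed_forms"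
  by (auto simp: closed_forms_def ext_d_lin intro: forms_lin)

lemma zero_closed_forms: "(\<lambda>x vs. 0) \<in> closed_forms"
  by (simp add: closed_forms_def zero_forms ext_d_zero)

lemma cohomologous_refl: "\<alpha> \<in> closed_forms \<Longrightarrow> cohomologous \<alpha> \<alpha>"
  unfolding cohomologous_def using zero_forms
  by (auto intro!: bexI[of _ "\<lambda>x vs. 0"] simp: ext_d_zero)

lemma cohomologous_lin:
  assumes "cohomologous \<alpha> \<alpha>'" "cohomologous \<beta> \<beta>'"
  shows "cohomologous (\<lambda>x vs. a * \<alpha> x vs + b * \<beta> x vs) (\<lambda>x vs. a * \<alpha>' x vs + b * \<beta>' x vs)"
proof -
  obtain \<gamma> \<delta> where g: "\<gamma> \<in> forms" "\<And>x vs. \<alpha> x vs - \<alpha>' x vs = ext_d \<gamma> x vs"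
    and d: "\<delta> \<in> forms" "\<And>x vs. \<beta> x vs - \<beta>' x vs = ext_d \<delta> x vs"
    using assms unfolding cohomologous_def by blast
  have "(a * \<alpha> x vs + b * \<beta> x vs) - (a * \<alpha>' x vs + b * \<beta>' x vs)
      = ext_d (\<lambda>x vs. a * \<gamma> x vs + b * \<delta> x vs) x vs" for x vs
    unfolding ext_d_lin[OF g(1) d(1)] g(2)[symmetric] d(2)[symmetric] by (simp add: algebra_simps)
  with assms forms_lin[OF g(1) d(1)] show ?thesis
    unfolding cohomologous_def by (auto intro: closed_forms_lin)
qed

lemma cohomologous_sym:
  assumes "cohomologous \<alpha> \<beta>"
  shows "cohomologous \<beta> \<alpha>"
proof -
  have c: "\<alpha> \<in> closed_forms" "\<beta> \<in> closed_forms"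
    using assms by (simp_all add: cohomologous_def)
  from assms obtain \<gamma> where g: "\<gamma> \<in> forms" "\<And>x vs. \<alpha> x vs - \<beta> x vs = ext_d \<gamma> x vs"
    unfolding cohomologous_def by blast
  have "\<beta> x vs - \<alpha> x vs = ext_d (\<lambda>x vs. (-1) * \<gamma> x vs + 0 * \<gamma> x vs) x vs" for x vs
    unfolding ext_d_lin[OF g(1) g(1)] g(2)[symmetric] by simp
  with forms_lin[OF g(1) g(1)] c show ?thesis
    unfolding cohomologous_def by blast
qed

lemma cohomologous_trans:
  assumes "cohomologous \<alpha> \<beta>" "cohomologous \<beta> \<delta>"
  shows "cohomologous \<alpha> \<delta>"
proof -
  from assms obtain g h where g: "g \<in> forms" "\<And>x vs. \<alpha> x vs - \<beta> x vs = ext_d g x vs"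
    and h: "h \<in> forms" "\<And>x vs. \<beta> x vs - \<delta> x vs = ext_d h x vs"
    unfolding cohomologous_def by blast
  have "\<alpha> x vs - \<delta> x vs = ext_d (\<lambda>x vs. 1 * g x vs + 1 * h x vs) x vs" for x vs
    unfolding ext_d_lin[OF g(1) h(1)] g(2)[symmetric] h(2)[symmetric] by simp
  with forms_lin[OF g(1) h(1)] assms show ?thesis
    unfolding cohomologous_def by blast
qed

lemma part_equivp_cohomologous: "part_equivp cohomologous"
proof (rule part_equivpI)
  show "\<exists>\<alpha>. cohomologous \<alpha> \<alpha>" using cohomologous_refl zero_closed_forms by blast
  show "symp cohomologous" by (rule sympI) (rule cohomologous_sym)
  show "transp cohomologous" by (rule transpI) (rule cohomologous_trans)
qed

text \<open>
  The total cohomology \<open>H\<^sup>*(V / \<Gamma>; \<real>)\<close> as the type of closed forms modulo exact forms. As \<open>d\<close> is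
  homogeneous, it is the direct sum of the subspaces \<open>coh_deg k\<close> below.
\<close>

quotient_type (overloaded) 'a coh = "'a::periodic_space form" / partial: cohomologous
  by (rule part_equivp_cohomologous)

instantiation coh :: (periodic_space) real_vector
begin

lift_definition zero_coh :: "'a coh" is "\<lambda>x vs. 0"
  by (rule cohomologous_refl[OF zero_closed_forms])

lift_definition plus_coh :: "'a coh \<Rightarrow> 'a coh \<Rightarrow> 'a coh" is "\<lambda>\<alpha> \<beta> x vs. \<alpha> x vs + \<beta> x vs"
  using cohomologous_lin[where a = 1 and b = 1] by simp

lift_definition minus_coh :: "'a coh \<Rightarrow> 'a coh \<Rightarrow> 'a coh" is "\<lambda>\<alpha> \<beta> x vs. \<alpha> x vs - \<beta> x vs"
  using cohomologous_lin[where a = 1 and b = "-1"] by simp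

lift_definition uminus_coh :: "'a coh \<Rightarrow> 'a coh" is "\<lambda>\<alpha> x vs. - \<alpha> x vs"
  subgoal for \<alpha> \<beta> using cohomologous_lin[of \<alpha> \<beta> \<alpha> \<beta> "-1" 0] by simp
  done

lift_definition scaleR_coh :: "real \<Rightarrow> 'a coh \<Rightarrow> 'a coh" is "\<lambda>r \<alpha> x vs. r * \<alpha> x vs"
  subgoal for r \<alpha> \<beta> using cohomologous_lin[of \<alpha> \<beta> \<alpha> \<beta> r 0] by simp
  done

instance
proof
  fix a b c :: "'a coh" and r s :: real
  have [intro]: "cohomologous \<alpha> \<beta>" if "\<alpha> = \<beta>" "\<alpha> \<in> closed_forms" for \<alpha> \<beta> :: "'a form"
    using that cohomologous_refl by simp
  note cl = closed_forms_lin[where a = 1 and b = 1, simplified]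
    closed_forms_lin[where a = 1 and b = "-1", simplified]
  have cs: "(\<lambda>x vs. r * \<alpha> x vs) \<in> closed_forms" if "\<alpha> \<in> closed_forms" for r and \<alpha> :: "'a form"
    using closed_forms_lin[OF that that, of r 0] by simp
  have C: "\<alpha> \<in> closed_forms" if "cohomologous \<alpha> \<alpha>" for \<alpha> :: "'a form"
    using that by (simp add: cohomologous_def)
  show "a + b + c = a + (b + c)" by transfer (auto simp: algebra_simps dest!: C intro!: cl cs)
  show "a + b = b + a" by transfer (auto simp: algebra_simps dest!: C intro!: cl cs)
  show "0 + a = a" by transfer (auto dest!: C)
  show "- a + a = 0" by transfer (auto intro: zero_closed_forms)
  show "a - b = a + - b" by transfer (auto dest!: C intro!: cl cs)
  show "r *\<^sub>R (a + b) = r *\<^sub>R a + r *\<^sub>R b"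
    by transfer (auto simp: algebra_simps dest!: C intro!: cl cs)
  show "(r + s) *\<^sub>R a = r *\<^sub>R a + s *\<^sub>R a"
    by transfer (auto simp: algebra_simps dest!: C intro!: cl cs)
  show "r *\<^sub>R s *\<^sub>R a = (r * s) *\<^sub>R a" by transfer (auto simp: mult.assoc dest!: C intro!: cs)
  show "1 *\<^sub>R a = a" by transfer (auto dest!: C)
qed

end

definition coh_deg :: "int \<Rightarrow> 'a::periodic_space coh set" where
  "coh_deg k = {abs_coh \<omega> | \<omega>. \<omega> \<in> closed_forms \<and> homogeneous k \<omega>}"

text \<open>
  The operations below are computed on representatives chosen by \<^const>\<open>rep_coh\<close>. For closed
  forms and smooth maps of tori the results do not depend on the choice.
\<close>

definition cup :: "'a::periodic_space coh \<Rightarrow> 'a coh \<Rightarrow> 'a coh" (infixl "\<smile>" 70) where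
  "a \<smile> b = abs_coh (wedge (rep_coh a) (rep_coh b))"

definition coh_one :: "'a::periodic_space coh" where
  "coh_one = abs_coh (fun_form (\<lambda>x. 1))"

definition coh_pull :: "('a::periodic_space \<Rightarrow> 'b::periodic_space) \<Rightarrow> 'b coh \<Rightarrow> 'a coh" where
  "coh_pull f a = abs_coh (pullback f (rep_coh a))"


section \<open>The abelian surface, its real structure and the fixed tori\<close>

type_synonym X = "complex \<times> complex"
type_synonym L = "real \<times> real"

definition tau :: "X \<Rightarrow> X" where
  "tau = (\<lambda>(z1, z2). (cnj z1, cnj z2))"

text \<open>
  \<open>\<epsilon> \<in> {0,1}\<^sup>2\<close> is a pair of truth values. The torus \<open>L\<^sub>\<epsilon>\<close> is the image in \<open>X\<close> of \<open>incl \<epsilon>\<close>, through which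
  it is identified with \<open>(\<real>/\<int>)\<^sup>2\<close> with coordinates \<open>(x\<^sub>1, x\<^sub>2)\<close>.
\<close>

definition incl :: "bool \<times> bool \<Rightarrow> L \<Rightarrow> X" where
  "incl \<epsilon> = (\<lambda>(s, t). (Complex s (of_bool (fst \<epsilon>) / 2), Complex t (of_bool (snd \<epsilon>) / 2)))"

lemma half_integer_iff: "- (2 * y) \<in> \<int> \<longleftrightarrow> (\<exists>!b. y - of_bool b / 2 \<in> \<int>)" for y :: real
proof
  assume "- (2 * y) \<in> \<int>"
  then have "2 * y \<in> \<int>" by (metis Ints_minus minus_minus)
  then obtain n where n: "2 * y = of_int n" by (auto elim: Ints_cases)
  have *: "y - of_bool b / 2 \<in> \<int> \<longleftrightarrow> (b \<longleftrightarrow> odd n)" for b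
  proof
    assume "y - of_bool b / 2 \<in> \<int>"
    then obtain m where "y - of_bool b / 2 = of_int m" by (auto elim: Ints_cases)
    with n have "(of_int n :: real) = of_int (2 * m + of_bool b)" by (simp add: field_simps)
    then have "n = 2 * m + of_bool b" by linarith
    then show "b \<longleftrightarrow> odd n" by simp
  next
    assume b: "b \<longleftrightarrow> odd n"
    then have "n = 2 * (n div 2) + of_bool b" by (cases b) (auto elim: oddE)
    then have "(of_int n :: real) = 2 * of_int (n div 2) + of_bool b"
      by (metis of_int_add of_int_mult of_int_numeral of_int_of_bool)
    with n have "y - of_bool b / 2 = of_int (n div 2)" by (simp add: field_simps)
    then show "y - of_bool b / 2 \<in> \<int>" by simp
  qed
  then show "\<exists>!b. y - of_bool b / 2 \<in> \<int>" by auto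
next
  assume "\<exists>!b. y - of_bool b / 2 \<in> \<int>"
  then obtain b where "y - of_bool b / 2 \<in> \<int>" by blast
  then obtain m where "y - of_bool b / 2 = of_int m" by (auto elim: Ints_cases)
  then have "- (2 * y) = of_int (- 2 * m - of_bool b)" by (cases b) auto
  then show "- (2 * y) \<in> \<int>" by (metis Ints_of_int)
qed

lemma Ex1_prod: "(\<exists>!\<epsilon>. A (fst \<epsilon>) \<and> B (snd \<epsilon>)) \<longleftrightarrow> (\<exists>!c. A c) \<and> (\<exists>!d. B d)"
  (is "?l \<longleftrightarrow> ?r")
proof
  assume ?r
  then obtain c d where c: "A c" "\<forall>c'. A c' \<longrightarrow> c' = c" and d: "B d" "\<forall>d'. B d' \<longrightarrow> d' = d"
    unfolding Ex1_def by (elim conjE exE)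
  show ?l
  proof (rule ex1I[of _ "(c, d)"])
    show "A (fst (c, d)) \<and> B (snd (c, d))" using c(1) d(1) by simp
  next
    fix \<delta> assume "A (fst \<delta>) \<and> B (snd \<delta>)"
    then have "fst \<delta> = c" "snd \<delta> = d" using c(2) d(2) by (simp_all only:)
    then show "\<delta> = (c, d)" by (simp add: prod_eq_iff)
  qed
next
  assume ?l
  then obtain \<epsilon> where \<epsilon>: "A (fst \<epsilon>)" "B (snd \<epsilon>)"
    and u: "\<forall>\<delta>. A (fst \<delta>) \<and> B (snd \<delta>) \<longrightarrow> \<delta> = \<epsilon>"
    unfolding Ex1_def by (elim conjE exE)
  show ?r
  proof
    show "\<exists>!c. A c"
    proof (rule ex1I[of A "fst \<epsilon>", OF \<epsilon>(1)])
      fix c assume "A c"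
      with \<epsilon>(2) have "(c, snd \<epsilon>) = \<epsilon>" using u[rule_format, of "(c, snd \<epsilon>)"] by simp
      from arg_cong[OF this, of fst] show "c = fst \<epsilon>" by simp
    qed
    show "\<exists>!d. B d"
    proof (rule ex1I[of B "snd \<epsilon>", OF \<epsilon>(2)])
      fix d assume "B d"
      with \<epsilon>(1) have "(fst \<epsilon>, d) = \<epsilon>" using u[rule_format, of "(fst \<epsilon>, d)"] by simp
      from arg_cong[OF this, of snd] show "d = snd \<epsilon>" by simp
    qed
  qed
qed

text \<open>The fixed locus of \<open>\<tau>\<close> on \<open>X\<close> is the disjoint union of the \<open>L\<^sub>\<epsilon>\<close>.\<close>

lemma fixed_locus:
  fixes z :: X
  shows "tau z - z \<in> period_lattice \<longleftrightarrow> (\<exists>!\<epsilon>. \<exists>p. z - incl \<epsilon> p \<in> period_lattice)"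
proof -
  obtain u v where z: "z = (u, v)" by (cases z)
  have r: "\<exists>s. t - s \<in> \<int>" for t :: real by (rule exI[of _ t]) simp
  have 1: "(\<exists>p. z - incl \<epsilon> p \<in> period_lattice) \<longleftrightarrow>
      Im u - of_bool (fst \<epsilon>) / 2 \<in> \<int> \<and> Im v - of_bool (snd \<epsilon>) / 2 \<in> \<int>" for \<epsilon>
    by (auto simp: z incl_def period_lattice_prod_def period_lattice_complex_def r)
  have 2: "tau z - z \<in> period_lattice \<longleftrightarrow> - (2 * Im u) \<in> \<int> \<and> - (2 * Im v) \<in> \<int>"
    by (simp add: z tau_def period_lattice_prod_def period_lattice_complex_def)
  show ?thesis
    unfolding 1 2 half_integer_iff
    by (rule Ex1_prod[of "\<lambda>b. Im u - of_bool b / 2 \<in> \<int>" "\<lambda>b. Im v - of_bool b / 2 \<in> \<int>", symmetric])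
qed

text \<open>The frame \<open>\<partial>\<^sub>x\<^sub>1, \<partial>\<^sub>x\<^sub>2\<close> of \<open>L\<^sub>\<epsilon>\<close> is positive for the orientation \<open>Re \<Omega>|\<close>, where \<open>\<Omega> = dz\<^sub>1 \<and> dz\<^sub>2\<close>.\<close>

lemma Re_Omega_restrict:
  fixes p :: L
  defines "Re_Omega \<equiv> (\<lambda>(z::X) vs. case vs of [v, w] \<Rightarrow> Re (fst v * snd w - fst w * snd v) | _ \<Rightarrow> 0)"
  shows "pullback (incl \<epsilon>) Re_Omega p [(1, 0), (0, 1)] = 1"
proof -
  have "((\<lambda>w. (of_real (fst w) + \<i> * of_real (of_bool (fst \<epsilon>) / 2),
               of_real (snd w) + \<i> * of_real (of_bool (snd \<epsilon>) / 2)))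
      has_derivative (\<lambda>w. (of_real (fst w), of_real (snd w)) :: X)) (at p)"
    by (intro has_derivative_Pair has_derivative_add_const has_derivative_of_real
        has_derivative_fst has_derivative_snd has_derivative_ident)
  then have "(incl \<epsilon> has_derivative (\<lambda>w. (of_real (fst w), of_real (snd w)))) (at p)"
    unfolding incl_def split_beta Complex_eq .
  then have "frechet_derivative (incl \<epsilon>) (at p) = (\<lambda>w. (of_real (fst w), of_real (snd w)))"
    by (rule frechet_derivative_at[symmetric])
  then show ?thesis by (simp add: pullback_def Re_Omega_def)
qed

text \<open>
  Integration over the unit cube, a fundamental domain, of the coefficient with respect to the
  oriented frames \<open>\<partial>\<^sub>x\<^sub>1, \<partial>\<^sub>y\<^sub>1, \<partial>\<^sub>x\<^sub>2, \<partial>\<^sub>y\<^sub>2\<close> of \<open>X\<close> (complex orientation) and \<open>\<partial>\<^sub>x\<^sub>1, \<partial>\<^sub>x\<^sub>2\<close> of \<open>L\<^sub>\<epsilon>\<close>.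
\<close>

definition integral_X :: "X coh \<Rightarrow> real" where
  "integral_X a = integral (cbox (0, 0) (Complex 1 1, Complex 1 1))
     (\<lambda>z. rep_coh a z [(1, 0), (\<i>, 0), (0, 1), (0, \<i>)])"

definition integral_L :: "L coh \<Rightarrow> real" where
  "integral_L \<eta> = integral (cbox (0, 0) (1, 1)) (\<lambda>p. rep_coh \<eta> p [(1, 0), (0, 1)])"

text \<open>
  The oriented Gysin map, characterized by the projection formula, i.e. as the Poincare dual of
  the restriction map. As the codimension is even, writing both factors in the opposite order
  gives the same map.
\<close>

definition gysin :: "bool \<times> bool \<Rightarrow> L coh \<Rightarrow> X coh" where
  "gysin \<epsilon> \<eta> = (THE c. \<forall>a. integral_X (a \<smile> c) = integral_L (coh_pull (incl \<epsilon>) a \<smile> \<eta>))"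

text \<open>The coordinate functions are not periodic, but their differentials are.\<close>

definition x1 :: "X coh" where "x1 = abs_coh (ext_d (fun_form (\<lambda>z. Re (fst z))))"
definition y1 :: "X coh" where "y1 = abs_coh (ext_d (fun_form (\<lambda>z. Im (fst z))))"
definition x2 :: "X coh" where "x2 = abs_coh (ext_d (fun_form (\<lambda>z. Re (snd z))))"
definition y2 :: "X coh" where "y2 = abs_coh (ext_d (fun_form (\<lambda>z. Im (snd z))))"

definition q_cl :: "X coh" where "q_cl = x1 \<smile> y1 \<smile> x2 \<smile> y2"
definition P_cl :: "X coh" where "P_cl = - (y1 \<smile> y2)"

definition inv_coh :: "X coh set" where
  "inv_coh = {a. coh_pull tau a = a}"


section \<open>The surface orientifold algebra\<close>

type_synonym orient = "X coh \<times> (L coh ^ (bool \<times> bool))"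

definition orient_alg :: "orient set" ("\<B>") where
  "\<B> = {(a, \<eta>). a \<in> inv_coh}"

definition orient_deg :: "nat \<Rightarrow> orient set" where
  "orient_deg k = {(a, \<eta>). a \<in> inv_coh \<inter> coh_deg (int k) \<and> (\<forall>\<epsilon>. \<eta> $ \<epsilon> \<in> coh_deg (int k - 1))}"

definition star :: "orient \<Rightarrow> orient \<Rightarrow> orient" (infixl "\<star>" 70) where
  "\<alpha> \<star> \<beta> = (case (\<alpha>, \<beta>) of ((a, \<eta>), (b, \<xi>)) \<Rightarrow>
     (a \<smile> b + (\<Sum>\<epsilon>\<in>UNIV. gysin \<epsilon> (\<eta> $ \<epsilon> \<smile> \<xi> $ \<epsilon>)),
      \<chi> \<epsilon>. coh_pull (incl \<epsilon>) a \<smile> \<xi> $ \<epsilon> + \<eta> $ \<epsilon> \<smile> coh_pull (incl \<epsilon>) b))"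

definition amb :: "X coh \<Rightarrow> orient" where "amb a = (a, 0)"

definition e_cl :: "bool \<times> bool \<Rightarrow> orient" where "e_cl \<epsilon> = (0, axis \<epsilon> coh_one)"

definition Tr :: "orient \<Rightarrow> real" where "Tr \<alpha> = integral_X (fst \<alpha>)"

definition pairing :: "orient \<Rightarrow> orient \<Rightarrow> real" where "pairing \<alpha> \<beta> = Tr (\<alpha> \<star> \<beta>)"


section \<open>Graded algebras, presentations and Frobenius pairings\<close>

definition bilinear_on :: "'b::real_vector set \<Rightarrow> ('b \<Rightarrow> 'b \<Rightarrow> 'c::real_vector) \<Rightarrow> bool" where
  "bilinear_on B f \<longleftrightarrow> (\<forall>a\<in>B. \<forall>b\<in>B. \<forall>c\<in>B. \<forall>r.
     f (a + b) c = f a c + f b c \<and> f c (a + b) = f c a + f c b \<and>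
     f (r *\<^sub>R a) c = r *\<^sub>R f a c \<and> f c (r *\<^sub>R a) = r *\<^sub>R f c a)"

definition unital_algebra ::
    "'b::real_vector set \<Rightarrow> ('b \<Rightarrow> 'b \<Rightarrow> 'b) \<Rightarrow> 'b \<Rightarrow> bool" where
  "unital_algebra B m u \<longleftrightarrow> subspace B \<and> bilinear_on B m \<and> u \<in> B \<and>
     (\<forall>a\<in>B. m u a = a \<and> m a u = a) \<and>
     (\<forall>a\<in>B. \<forall>b\<in>B. m a b \<in> B \<and> (\<forall>c\<in>B. m (m a b) c = m a (m b c)))"

definition graded_algebra ::
    "'b::real_vector set \<Rightarrow> (nat \<Rightarrow> 'b set) \<Rightarrow> ('b \<Rightarrow> 'b \<Rightarrow> 'b) \<Rightarrow> 'b \<Rightarrow> bool" where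
  "graded_algebra B D m u \<longleftrightarrow> unital_algebra B m u \<and>
     (\<forall>k. subspace (D k) \<and> D k \<subseteq> B) \<and>
     (\<forall>b\<in>B. \<exists>!c. (\<forall>k. c k \<in> D k) \<and> finite {k. c k \<noteq> 0} \<and> b = (\<Sum>k | c k \<noteq> 0. c k)) \<and>
     u \<in> D 0 \<and> (\<forall>j k. \<forall>a\<in>D j. \<forall>b\<in>D k. m a b \<in> D (j + k))"

text \<open>
  The free associative unital real algebra on a set \<open>'g\<close> of generators is the monoid algebra of the
  free monoid of words in \<open>'g\<close>, written additively as \<^theory>\<open>HOL-Library.Poly_Mapping\<close> demands.
\<close>

datatype 'g mono = Mono (letters: "'g list")

instantiation mono :: (type) monoid_add
begin
definition "0 = Mono []"
definition "a + b = Mono (letters a @ letters b)"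
instance by standard (simp_all add: zero_mono_def plus_mono_def)
end

type_synonym 'g free_alg = "'g mono \<Rightarrow>\<^sub>0 real"

definition gen :: "'g \<Rightarrow> 'g free_alg" where "gen g = Poly_Mapping.single (Mono [g]) 1"

definition scalar :: "real \<Rightarrow> 'g free_alg" where "scalar r = Poly_Mapping.single 0 r"

definition free_eval ::
    "('b \<Rightarrow> 'b \<Rightarrow> 'b) \<Rightarrow> 'b \<Rightarrow> ('g \<Rightarrow> 'b) \<Rightarrow> 'g free_alg \<Rightarrow> 'b::real_vector" where
  "free_eval m u \<phi> p = (\<Sum>w\<in>Poly_Mapping.keys p.
     Poly_Mapping.lookup p w *\<^sub>R foldr (\<lambda>g. m (\<phi> g)) (letters w) u)"

inductive_set two_sided_ideal :: "'r::ring_1 set \<Rightarrow> 'r set" for S where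
  zero: "0 \<in> two_sided_ideal S"
| add: "a \<in> two_sided_ideal S \<Longrightarrow> b \<in> two_sided_ideal S \<Longrightarrow> a + b \<in> two_sided_ideal S"
| mult: "s \<in> S \<Longrightarrow> a * s * b \<in> two_sided_ideal S"

text \<open>The algebra \<open>B\<close> is presented by the generators \<open>\<phi> g\<close> subject to the relations \<open>S\<close>.\<close>

definition presented_algebra ::
    "'b::real_vector set \<Rightarrow> ('b \<Rightarrow> 'b \<Rightarrow> 'b) \<Rightarrow> 'b \<Rightarrow> ('g \<Rightarrow> 'b) \<Rightarrow> 'g free_alg set \<Rightarrow> bool" where
  "presented_algebra B m u \<phi> S \<longleftrightarrow> unital_algebra B m u \<and>
     range (free_eval m u \<phi>) = B \<and> {p. free_eval m u \<phi> p = 0} = two_sided_ideal S"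

definition frobenius_pairing ::
    "'b::real_vector set \<Rightarrow> ('b \<Rightarrow> 'b \<Rightarrow> 'b) \<Rightarrow> ('b \<Rightarrow> 'b \<Rightarrow> real) \<Rightarrow> bool" where
  "frobenius_pairing B m f \<longleftrightarrow> bilinear_on B f \<and>
     (\<forall>a\<in>B. \<forall>b\<in>B. \<forall>c\<in>B. f (m a b) c = f a (m b c))"

definition nondegenerate_on :: "'b::real_vector set \<Rightarrow> ('b \<Rightarrow> 'b \<Rightarrow> real) \<Rightarrow> bool" where
  "nondegenerate_on B f \<longleftrightarrow>
     (\<forall>a\<in>B. (\<forall>b\<in>B. f a b = 0) \<longrightarrow> a = 0) \<and> (\<forall>b\<in>B. (\<forall>a\<in>B. f a b = 0) \<longrightarrow> b = 0)"

definition poincare_series :: "(nat \<Rightarrow> 'b::real_vector set) \<Rightarrow> int fps" where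
  "poincare_series D = Abs_fps (\<lambda>k. int (dim (D k)))"


section \<open>Generators and relations\<close>

datatype ext_gen = X1 | X2
datatype r0_gen = Ext ext_gen | PP
datatype b_gen = R0 r0_gen | E "bool \<times> bool"

text \<open>
  The exterior algebra is the tensor algebra of the span of the generators modulo all squares
  \<open>v \<otimes> v\<close>. The tensor product of two presented algebras is presented by the union of the
  presentations together with the commutators of the generators of the two factors (there are no
  Koszul signs since \<open>P\<close> has even degree).
\<close>

definition exterior_rels :: "(ext_gen \<Rightarrow> 'g free_alg) \<Rightarrow> 'g free_alg set" where
  "exterior_rels X = {v * v | v a b. v = scalar a * X X1 + scalar b * X X2}"

definition r0_rels :: "(r0_gen \<Rightarrow> 'g free_alg) \<Rightarrow> 'g free_alg set" where
  "r0_rels X = exterior_rels (\<lambda>k. X (Ext k)) \<union> {X PP * X PP}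
     \<union> {X (Ext k) * X PP - X PP * X (Ext k) | k. True}"

definition b_rels :: "(b_gen \<Rightarrow> 'g free_alg) \<Rightarrow> 'g free_alg set" where
  "b_rels X = r0_rels (\<lambda>g. X (R0 g))
     \<union> {X (E \<epsilon>) * X (R0 (Ext k)) - X (R0 (Ext k)) * X (E \<epsilon>) | \<epsilon> k. True}
     \<union> {X (R0 PP) * X (E \<epsilon>) | \<epsilon>. True} \<union> {X (E \<epsilon>) * X (R0 PP) | \<epsilon>. True}
     \<union> {X (E \<epsilon>) * X (E \<epsilon>') - (if \<epsilon> = \<epsilon>' then X (R0 PP) else 0) | \<epsilon> \<epsilon>'. True}"

primrec ext_class :: "ext_gen \<Rightarrow> X coh" where
  "ext_class X1 = x1"
| "ext_class X2 = x2"

primrec r0_class :: "r0_gen \<Rightarrow> X coh" where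
  "r0_class (Ext k) = ext_class k"
| "r0_class PP = P_cl"

primrec b_class :: "b_gen \<Rightarrow> orient" where
  "b_class (R0 g) = amb (r0_class g)"
| "b_class (E \<epsilon>) = e_cl \<epsilon>"

text \<open>The subalgebra of \<open>\<B>\<close> generated by \<open>x\<^sub>1\<close> and \<open>x\<^sub>2\<close>.\<close>

definition Lambda_x :: "orient set" where
  "Lambda_x = range (free_eval (\<star>) (amb coh_one) (\<lambda>k. amb (ext_class k)))"

end

theory Submission
  imports Defs
begin

text \<open>
  Averaging a closed form over the flow of a lattice direction \<open>u\<close> changes it by an exact form, because
  \<open>\<L>\<^sub>u = d \<iota>\<^sub>u\<close> on closed forms. Doing this for a lattice basis shows that every class on a torus has a
  unique constant (harmonic) representative, which is computed by integrating over the unit cube. Hence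
  the cohomology algebra is the algebra of alternating functions with the shuffle product.

  On \<open>X\<close>, the projection \<open>proj\<close> to the real parts satisfies \<open>proj \<circ> incl \<epsilon> = id\<close>, so every \<open>incl \<epsilon>\<close>
  induces the same left inverse \<open>res\<close> of \<open>lift = proj\<^sup>*\<close>. Poincare duality gives
  \<open>gysin \<epsilon> \<eta> = lift \<eta> \<smile> P\<close>, the invariant classes are exactly \<open>lift \<eta> + lift \<xi> \<smile> P\<close>, and
  \<open>a \<smile> P = lift (res a) \<smile> P\<close>. Together with \<open>res P = 0\<close> this reduces the algebra to six copies of the
  four-dimensional algebra \<open>H\<^sup>*(L)\<close>. For the presentations, the relations rewrite every word to a multiple
  of a normal word, and the values of the normal words form a basis.
\<close>

section \<open>The shuffle product of multilinear functions\<close>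

text \<open>Classes are cosets of exact forms, and \<open>cup\<close> and \<open>coh_pull\<close>
  work on unspecified representatives, so nothing can be computed before each class has a canonical
  one. The mean over the unit cube provides it: it is defined for every representative, vanishes on
  exact forms and fixes constant forms. From there on a class is a function on lists, and an
  identity between classes is settled by its values on the sublists of a frame. The sign in
  \<open>P = -y1 y2\<close> comes from the orientation: \<open>x1 x2 y1 y2 = -x1 y1 x2 y2\<close>,
  so it is \<open>-y1 y2\<close> whose integral along the fibres is 1. The four tori are translates
  of each other, hence share one Poincare dual, namely P; this is why the square of
  \<open>e_cl \<epsilon>\<close> does not depend on \<epsilon>. The Poincare polynomial is
  \<open>(1 + t)^2 (1 + 4 t + t^2)\<close>: a monomial in \<open>x1\<close>, \<open>x2\<close> times
  one of 1, P and the four reflection units.\<close>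

definition contract :: "'a \<Rightarrow> ('a list \<Rightarrow> real) \<Rightarrow> 'a list \<Rightarrow> real" where
  "contract v \<phi> = (\<lambda>vs. \<phi> (v # vs))"

text \<open>The grading involution. It keeps track of the Koszul sign that arises when a contraction
  or a differential passes the left factor, and so makes sense for inhomogeneous forms.\<close>

definition twist :: "('a list \<Rightarrow> real) \<Rightarrow> 'a list \<Rightarrow> real" where
  "twist \<phi> = (\<lambda>vs. (-1) ^ length vs * \<phi> vs)"

text \<open>
  The recursion says that contraction with \<open>v\<close> is an antiderivation of the wedge product; it turns
  the identities of the exterior calculus into inductions on the list of arguments.
\<close>

primrec shuffle_on :: "'a list \<Rightarrow> ('a list \<Rightarrow> real) \<Rightarrow> ('a list \<Rightarrow> real) \<Rightarrow> real" where
  "shuffle_on [] \<phi> \<psi> = \<phi> [] * \<psi> []"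
| "shuffle_on (v # vs) \<phi> \<psi> =
     shuffle_on vs (contract v \<phi>) \<psi> + shuffle_on vs (twist \<phi>) (contract v \<psi>)"

definition shuffle :: "('a list \<Rightarrow> real) \<Rightarrow> ('a list \<Rightarrow> real) \<Rightarrow> 'a list \<Rightarrow> real" where
  "shuffle \<phi> \<psi> = (\<lambda>vs. shuffle_on vs \<phi> \<psi>)"

lemma shuffle_Nil: "shuffle \<phi> \<psi> [] = \<phi> [] * \<psi> []"
  by (simp add: shuffle_def)

lemma shuffle_Cons:
  "shuffle \<phi> \<psi> (v # vs) = shuffle (contract v \<phi>) \<psi> vs + shuffle (twist \<phi>) (contract v \<psi>) vs"
  by (simp add: shuffle_def)

lemma contract_shuffle:
  "contract v (shuffle \<phi> \<psi>) =
     (\<lambda>vs. shuffle (contract v \<phi>) \<psi> vs + shuffle (twist \<phi>) (contract v \<psi>) vs)"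
  by (simp add: contract_def shuffle_Cons[unfolded contract_def])

lemma twist_twist [simp]: "twist (twist \<phi>) = \<phi>"
  by (simp add: twist_def flip: mult.assoc power_add)

lemma contract_twist: "contract v (twist \<phi>) = (\<lambda>vs. - twist (contract v \<phi>) vs)"
  by (simp add: contract_def twist_def)

lemma contract_lin: "contract v (\<lambda>vs. a * \<phi> vs + b * \<psi> vs)
    = (\<lambda>vs. a * contract v \<phi> vs + b * contract v \<psi> vs)"
  by (simp add: contract_def)

lemma twist_lin: "twist (\<lambda>vs. a * \<phi> vs + b * \<psi> vs) = (\<lambda>vs. a * twist \<phi> vs + b * twist \<psi> vs)"
  by (simp add: twist_def algebra_simps)

lemma shuffle_lin_left:
  "shuffle (\<lambda>vs. a * \<phi> vs + b * \<phi>' vs) \<psi> vs = a * shuffle \<phi> \<psi> vs + b * shuffle \<phi>' \<psi> vs"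
  by (induction vs arbitrary: \<phi> \<phi>' \<psi>)
    (simp_all add: shuffle_Nil shuffle_Cons contract_lin twist_lin algebra_simps)

lemma shuffle_lin_right:
  "shuffle \<phi> (\<lambda>vs. a * \<psi> vs + b * \<psi>' vs) vs = a * shuffle \<phi> \<psi> vs + b * shuffle \<phi> \<psi>' vs"
  by (induction vs arbitrary: \<phi> \<psi> \<psi>')
    (simp_all add: shuffle_Nil shuffle_Cons contract_lin twist_lin algebra_simps)

lemma shuffle_add_left:
  "shuffle (\<lambda>vs. \<phi> vs + \<phi>' vs) \<psi> = (\<lambda>vs. shuffle \<phi> \<psi> vs + shuffle \<phi>' \<psi> vs)"
  using shuffle_lin_left[of 1 \<phi> 1 \<phi>'] by auto

lemma shuffle_add_right:
  "shuffle \<phi> (\<lambda>vs. \<psi> vs + \<psi>' vs) = (\<lambda>vs. shuffle \<phi> \<psi> vs + shuffle \<phi> \<psi>' vs)"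
  using shuffle_lin_right[of \<phi> 1 \<psi> 1 \<psi>'] by auto

lemma shuffle_diff_left:
  "shuffle (\<lambda>vs. \<phi> vs - \<phi>' vs) \<psi> = (\<lambda>vs. shuffle \<phi> \<psi> vs - shuffle \<phi>' \<psi> vs)"
  using shuffle_lin_left[of 1 \<phi> "-1" \<phi>'] by auto

lemma shuffle_diff_right:
  "shuffle \<phi> (\<lambda>vs. \<psi> vs - \<psi>' vs) = (\<lambda>vs. shuffle \<phi> \<psi> vs - shuffle \<phi> \<psi>' vs)"
  using shuffle_lin_right[of \<phi> 1 \<psi> "-1" \<psi>'] by auto

lemma shuffle_scale_left: "shuffle (\<lambda>vs. a * \<phi> vs) \<psi> = (\<lambda>vs. a * shuffle \<phi> \<psi> vs)"
  using shuffle_lin_left[of a \<phi> 0 \<phi>] by auto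

lemma shuffle_scale_right: "shuffle \<phi> (\<lambda>vs. a * \<psi> vs) = (\<lambda>vs. a * shuffle \<phi> \<psi> vs)"
  using shuffle_lin_right[of \<phi> a \<psi> 0 \<psi>] by auto

lemma shuffle_minus_left: "shuffle (\<lambda>vs. - \<phi> vs) \<psi> = (\<lambda>vs. - shuffle \<phi> \<psi> vs)"
  using shuffle_scale_left[of "-1"] by simp

lemma shuffle_minus_right: "shuffle \<phi> (\<lambda>vs. - \<psi> vs) = (\<lambda>vs. - shuffle \<phi> \<psi> vs)"
  using shuffle_scale_right[of _ "-1"] by simp

lemma shuffle_zero_left: "shuffle (\<lambda>vs. 0) \<psi> = (\<lambda>vs. 0)"
  using shuffle_scale_left[of 0] by simp

lemma shuffle_zero_right: "shuffle \<phi> (\<lambda>vs. 0) = (\<lambda>vs. 0)"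
  using shuffle_scale_right[of _ 0] by simp

text \<open>Lengths add up under shuffling, so the grading involution is an algebra automorphism.
  \<open>shuffle_assoc\<close> needs this: the recursion for a product in the left slot applies
  \<open>twist\<close> to that product.\<close>

lemma twist_shuffle: "twist (shuffle \<phi> \<psi>) = shuffle (twist \<phi>) (twist \<psi>)"
proof
  show "twist (shuffle \<phi> \<psi>) vs = shuffle (twist \<phi>) (twist \<psi>) vs" for vs
  proof (induction vs arbitrary: \<phi> \<psi>)
    case Nil
    then show ?case by (simp add: twist_def shuffle_Nil)
  next
    case (Cons v vs)
    \<comment> \<open>Removing the first vector changes the parity of the length, hence the
      sign.\<close>
    have "twist (shuffle \<phi> \<psi>) (v # vs) = - twist (contract v (shuffle \<phi> \<psi>)) vs"
      by (simp add: twist_def contract_def)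
    also have "\<dots> = - (twist (shuffle (contract v \<phi>) \<psi>) vs + twist (shuffle (twist \<phi>) (contract v \<psi>)) vs)"
      by (simp add: contract_shuffle twist_def algebra_simps)
    also have "\<dots> = shuffle (twist \<phi>) (twist \<psi>) (v # vs)"
      by (simp add: Cons.IH shuffle_Cons contract_twist shuffle_minus_left shuffle_minus_right)
    finally show ?case .
  qed
qed

text \<open>Contraction with the first vector turns either side into the same three terms, one for
  each factor that can receive the vector, and the induction hypothesis applies to each of
  them.\<close>

lemma shuffle_assoc: "shuffle (shuffle \<phi> \<psi>) \<eta> = shuffle \<phi> (shuffle \<psi> \<eta>)"
proof
  show "shuffle (shuffle \<phi> \<psi>) \<eta> vs = shuffle \<phi> (shuffle \<psi> \<eta>) vs" for vs
    by (induction vs arbitrary: \<phi> \<psi> \<eta>)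
      (simp_all add: shuffle_Nil shuffle_Cons contract_shuffle twist_shuffle
        shuffle_add_left shuffle_add_right)
qed

definition unit_form :: "'a list \<Rightarrow> real" where
  "unit_form vs = (if vs = [] then 1 else 0)"

lemma contract_unit_form: "contract v unit_form = (\<lambda>vs. 0)"
  by (simp add: contract_def unit_form_def)

lemma twist_unit_form: "twist unit_form = unit_form"
  by (auto simp: twist_def unit_form_def)

lemma shuffle_unit_left: "shuffle unit_form \<phi> = \<phi>"
proof
  show "shuffle unit_form \<phi> vs = \<phi> vs" for vs
    by (induction vs arbitrary: \<phi>)
      (simp_all add: shuffle_Nil shuffle_Cons contract_unit_form twist_unit_form shuffle_zero_left,
       simp_all add: contract_def unit_form_def)
qed

lemma shuffle_unit_right: "shuffle \<phi> unit_form = \<phi>"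
proof
  show "shuffle \<phi> unit_form vs = \<phi> vs" for vs
    by (induction vs arbitrary: \<phi>)
      (simp_all add: shuffle_Nil shuffle_Cons contract_unit_form twist_unit_form shuffle_zero_right,
       simp_all add: contract_def unit_form_def)
qed

lemma shuffle_map:
  "shuffle (\<lambda>us. \<phi> (map f us)) (\<lambda>us. \<psi> (map f us)) vs = shuffle \<phi> \<psi> (map f vs)"
proof (induction vs arbitrary: \<phi> \<psi>)
  case (Cons v vs)
  show ?case
    using Cons.IH[of "contract (f v) \<phi>" \<psi>] Cons.IH[of "twist \<phi>" "contract (f v) \<psi>"]
    by (simp add: shuffle_Cons contract_def twist_def)
qed (simp add: shuffle_Nil)

text \<open>Degrees are integers because the induction lowers \<open>j\<close> or \<open>k\<close>
  by one and may pass below 0, where homogeneity just means being zero.\<close>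

lemma shuffle_homogeneous:
  assumes "\<And>us. int (length us) \<noteq> j \<Longrightarrow> \<phi> us = 0" "\<And>us. int (length us) \<noteq> k \<Longrightarrow> \<psi> us = 0"
    "int (length vs) \<noteq> j + k"
  shows "shuffle \<phi> \<psi> vs = 0"
  using assms
proof (induction vs arbitrary: \<phi> \<psi> j k)
  case (Cons v vs)
  have "shuffle (contract v \<phi>) \<psi> vs = 0"
    by (rule Cons.IH[of "j - 1" _ k]) (use Cons.prems in \<open>auto simp: contract_def\<close>)
  moreover have "shuffle (twist \<phi>) (contract v \<psi>) vs = 0"
    by (rule Cons.IH[of j _ "k - 1"]) (use Cons.prems in \<open>auto simp: contract_def twist_def\<close>)
  ultimately show ?case by (simp add: shuffle_Cons)
next
  case Nil
  have "j \<noteq> 0 \<or> k \<noteq> 0" using Nil(3) by auto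
  then show ?case using Nil(1,2)[of "[]"] by (auto simp: shuffle_Nil)
qed

text \<open>Splitting the shuffles according to whether the first vector goes to the left factor.\<close>

lemma Pow_lessThan_Suc:
  "Pow {..<Suc n} = image Suc ` Pow {..<n} \<union> (\<lambda>J. insert 0 (Suc ` J)) ` Pow {..<n}"
proof -
  have "Pow (Suc ` {..<n}) = image Suc ` Pow {..<n}"
    by (rule image_Pow_surj[symmetric]) simp
  then show ?thesis
    by (simp add: lessThan_Suc_eq_insert_0 Pow_insert image_image)
qed

text \<open>The bridge from the definition by sets of positions to the recursion: a set of positions
  either contains 0 or not, and the two halves of the sum are the two summands of
  \<open>shuffle_Cons\<close>.\<close>

lemma wedge_eq_shuffle: "wedge \<alpha> \<beta> x vs = shuffle (\<alpha> x) (\<beta> x) vs"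
proof (induction vs arbitrary: \<alpha> \<beta>)
  case Nil
  then show ?case by (simp add: wedge_def shuffle_Nil)
next
  case (Cons v vs)
  define n where "n = length vs"
  define inv where "inv m I = {(i, j). i \<in> I \<and> j \<in> {..<m} - I \<and> j < i}" for m :: nat and I
  define t where "t I = (-1) ^ card (inv (Suc n) I)
        * \<alpha> x (nths (v # vs) I) * \<beta> x (nths (v # vs) (- I))" for I
  have inj: "inj_on (image Suc) (Pow {..<n})" "inj_on (\<lambda>J. insert 0 (Suc ` J)) (Pow {..<n})"
    by (auto simp: inj_on_def inj_image_eq_iff insert_ident)
  have "wedge \<alpha> \<beta> x (v # vs) = (\<Sum>I\<in>Pow {..<Suc n}. t I)"
    by (simp add: wedge_def t_def inv_def n_def)
  also have "\<dots> = (\<Sum>J\<in>Pow {..<n}. t (Suc ` J)) + (\<Sum>J\<in>Pow {..<n}. t (insert 0 (Suc ` J)))"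
    unfolding Pow_lessThan_Suc
    by (subst sum.union_disjoint) (auto simp: sum.reindex[OF inj(1)] sum.reindex[OF inj(2)])
  also have "(\<Sum>J\<in>Pow {..<n}. t (insert 0 (Suc ` J))) = wedge (\<lambda>x. contract v (\<alpha> x)) \<beta> x vs"
  proof -
    have "t (insert 0 (Suc ` J)) = (-1) ^ card (inv n J)
        * contract v (\<alpha> x) (nths vs J) * \<beta> x (nths vs (- J))" for J
    proof -
      \<comment> \<open>If the first vector goes to the left factor, position 0 takes part in no
        inversion.\<close>
      have "inv (Suc n) (insert 0 (Suc ` J)) = map_prod Suc Suc ` inv n J"
      proof (rule set_eqI)
        fix p show "p \<in> inv (Suc n) (insert 0 (Suc ` J)) \<longleftrightarrow> p \<in> map_prod Suc Suc ` inv n J"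
          by (cases p; cases "fst p"; cases "snd p") (auto simp: inv_def image_iff)
      qed
      moreover have "inj (map_prod Suc Suc)" by (simp add: prod.inj_map)
      ultimately have "card (inv (Suc n) (insert 0 (Suc ` J))) = card (inv n J)"
        by (simp add: card_image inj_on_subset)
      moreover have "{j. Suc j \<in> insert 0 (Suc ` J)} = J" "{j. Suc j \<in> - insert 0 (Suc ` J)} = - J"
        by auto
      ultimately show ?thesis
        by (simp add: t_def nths_Cons contract_def)
    qed
    then show ?thesis by (simp add: wedge_def inv_def n_def)
  qed
  also have "(\<Sum>J\<in>Pow {..<n}. t (Suc ` J))
      = wedge (\<lambda>x. twist (\<alpha> x)) (\<lambda>x. contract v (\<beta> x)) x vs"
  proof -
    have "t (Suc ` J) = (-1) ^ card (inv n J)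
        * twist (\<alpha> x) (nths vs J) * contract v (\<beta> x) (nths vs (- J))" if J: "J \<subseteq> {..<n}" for J
    proof -
      have fin: "finite J" using J finite_subset by blast
      have "finite (inv n J)"
        by (rule finite_subset[of _ "J \<times> {..<n}"]) (use fin in \<open>auto simp: inv_def\<close>)
      \<comment> \<open>If the first vector goes to the right factor, it forms an inversion with
        every position in \<open>Suc\<close> of \<open>J\<close>. These \<open>card J\<close> extra
        inversions are the sign in \<open>twist\<close>.\<close>
      moreover have "inv (Suc n) (Suc ` J) = map_prod Suc Suc ` inv n J \<union> (\<lambda>i. (i, 0)) ` Suc ` J"
      proof (rule set_eqI)
        fix p show "p \<in> inv (Suc n) (Suc ` J)
            \<longleftrightarrow> p \<in> map_prod Suc Suc ` inv n J \<union> (\<lambda>i. (i, 0)) ` Suc ` J"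
          by (cases p; cases "fst p"; cases "snd p") (auto simp: inv_def image_iff)
      qed
      moreover have "inj (map_prod Suc Suc)" by (simp add: prod.inj_map)
      moreover have "card (map_prod Suc Suc ` inv n J \<union> (\<lambda>i. (i, 0)) ` Suc ` J)
          = card (map_prod Suc Suc ` inv n J) + card ((\<lambda>i. (i, 0 :: nat)) ` Suc ` J)"
        using fin \<open>finite (inv n J)\<close> by (intro card_Un_disjoint) auto
      moreover have "card ((\<lambda>i. (i, 0 :: nat)) ` Suc ` J) = card J"
        unfolding image_image by (intro card_image) (auto simp: inj_on_def)
      ultimately have "card (inv (Suc n) (Suc ` J)) = card (inv n J) + card J"
        by (simp add: card_image inj_on_subset)
      moreover have "length (nths vs J) = card J"
        using J by (auto simp: length_nths n_def intro: arg_cong[where f = card])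
      moreover have "{j. Suc j \<in> Suc ` J} = J" "{j. Suc j \<in> - Suc ` J} = - J"
        by auto
      ultimately show ?thesis
        by (simp add: t_def nths_Cons contract_def twist_def power_add)
    qed
    then show ?thesis by (simp add: wedge_def inv_def n_def)
  qed
  finally show ?case by (simp add: Cons.IH shuffle_Cons)
qed

section \<open>Alternating functions\<close>

lemma alternating_linear: "alternating \<phi> \<Longrightarrow> linear (\<lambda>v. \<phi> (us @ v # ws))"
  by (simp add: alternating_def)

lemma alternating_not_distinct: "alternating \<phi> \<Longrightarrow> \<not> distinct vs \<Longrightarrow> \<phi> vs = 0"
  by (simp add: alternating_def)

lemma swap_adjacent:
  assumes lin: "\<And>us ws. linear (\<lambda>v. \<phi> (us @ v # ws))"
    and adj: "\<And>us v ws. \<phi> (us @ v # v # ws) = (0::real)"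
  shows "\<phi> (us @ v # w # ws) = - \<phi> (us @ w # v # ws)"
proof -
  have a: "\<phi> (us @ (v + w) # y # ws) = \<phi> (us @ v # y # ws) + \<phi> (us @ w # y # ws)" for y
    using linear_add[OF lin[of us "y # ws"]] by simp
  have b: "\<phi> (us @ y # (v + w) # ws) = \<phi> (us @ y # v # ws) + \<phi> (us @ y # w # ws)" for y
    using linear_add[OF lin[of "us @ [y]" ws]] by simp
  have "0 = \<phi> (us @ (v + w) # (v + w) # ws)" by (simp add: adj)
  also have "\<dots> = \<phi> (us @ v # w # ws) + \<phi> (us @ w # v # ws)"
    unfolding a b by (simp add: adj)
  finally show ?thesis by simp
qed

text \<open>Two equal arguments can be brought next to each other by adjacent swaps, each of which
  only changes the sign.\<close>

lemma alternatingI: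
  assumes lin: "\<And>us ws. linear (\<lambda>v. \<phi> (us @ v # ws))"
    and adj: "\<And>us v ws. \<phi> (us @ v # v # ws) = (0::real)"
  shows "alternating \<phi>"
  unfolding alternating_def
proof (intro conjI allI impI lin)
  fix vs :: "'a list" assume "\<not> distinct vs"
  then obtain us v ms ws where vs: "vs = us @ [v] @ ms @ [v] @ ws"
    using not_distinct_decomp by blast
  have "\<phi> (us @ v # ms @ v # ws) = 0" for us
  proof (induction ms arbitrary: us)
    case (Cons m ms)
    show ?case
      using swap_adjacent[of \<phi>, OF lin adj, of us v m "ms @ v # ws"] Cons.IH[of "us @ [m]"] by simp
  qed (simp add: adj)
  then show "\<phi> vs = 0" by (simp add: vs)
qed

lemma alternating_swap:
  assumes "alternating \<phi>"
  shows "\<phi> (us @ v # w # ws) = - \<phi> (us @ w # v # ws)"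
  using assms by (intro swap_adjacent) (auto simp: alternating_def)

lemma alternating_contract: "alternating \<phi> \<Longrightarrow> alternating (contract v \<phi>)"
  unfolding alternating_def contract_def
  by (auto simp flip: append_Cons)

lemma alternating_twist: "alternating \<phi> \<Longrightarrow> alternating (twist \<phi>)"
  by (auto simp: alternating_def twist_def linear_iff algebra_simps)

lemma shuffle_linear:
  assumes "alternating \<phi>" "alternating \<psi>"
  shows "linear (\<lambda>v. shuffle \<phi> \<psi> (us @ v # ws))"
  using assms
proof (induction us arbitrary: \<phi> \<psi>)
  case Nil
  have c: "contract (a + b) \<phi> = (\<lambda>vs. contract a \<phi> vs + contract b \<phi> vs)"
    "contract (r *\<^sub>R a) \<phi> = (\<lambda>vs. r * contract a \<phi> vs)" if "alternating \<phi>" for a b r and \<phi> :: "'a list \<Rightarrow> real"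
    using linear_add[OF alternating_linear[OF that, of "[]"]]
      linear_scale[OF alternating_linear[OF that, of "[]"]] by (simp_all add: contract_def)
  show ?case
    using Nil by (intro linearI)
      (simp_all add: shuffle_Cons c shuffle_add_left shuffle_add_right shuffle_scale_left
        shuffle_scale_right algebra_simps)
next
  case (Cons u us)
  then show ?case
    by (auto simp: shuffle_Cons intro!: linear_compose_add Cons.IH alternating_contract alternating_twist)
qed

lemma alternating_shuffle:
  assumes "alternating \<phi>" "alternating \<psi>"
  shows "alternating (shuffle \<phi> \<psi>)"
proof (rule alternatingI)
  show "linear (\<lambda>v. shuffle \<phi> \<psi> (us @ v # ws))" for us ws
    using assms by (rule shuffle_linear)
  show "shuffle \<phi> \<psi> (us @ v # v # ws) = 0" for us v ws
    using assms
  proof (induction us arbitrary: \<phi> \<psi>)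
    case Nil
    have "contract v (contract v \<phi>) = (\<lambda>vs. 0)" if "alternating \<phi>" for \<phi> :: "'a list \<Rightarrow> real"
      using alternating_not_distinct[OF that] by (simp add: contract_def)
    with Nil show ?case
      by (simp add: shuffle_Cons contract_twist shuffle_zero_left shuffle_zero_right shuffle_minus_left)
  qed (simp add: shuffle_Cons alternating_contract alternating_twist)
qed

lemma alternating_unit_form: "alternating unit_form"
  by (auto simp: alternating_def unit_form_def linear_zero)

lemma alternating_map:
  assumes "alternating \<phi>" "linear f"
  shows "alternating (\<lambda>vs. \<phi> (map f vs))"
  using linear_compose[OF assms(2) alternating_linear[OF assms(1)], unfolded o_def]
    alternating_not_distinct[OF assms(1)]
  unfolding alternating_def by (auto simp: distinct_map)

lemma alternating_restrict:
  assumes "alternating \<phi>"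
  shows "alternating (\<lambda>vs. if int (length vs) = k then \<phi> vs else 0)"
proof -
  have "linear (\<lambda>v. if int (length (us @ v # ws)) = k then \<phi> (us @ v # ws) else 0)" for us ws
    using assms by (cases "int (length us) + int (length ws) + 1 = k")
      (auto simp: alternating_def linear_zero algebra_simps)
  with assms show ?thesis by (auto simp: alternating_def)
qed

text \<open>A permutation of the arguments changes at most the sign. Only vanishing is transported,
  so that sign is never computed; the prefix \<open>us\<close> holds the arguments already in
  place.\<close>

lemma alternating_mset_eq:
  assumes "alternating \<phi>" "mset xs = mset ys" "\<phi> (us @ xs) = 0"
  shows "\<phi> (us @ ys) = 0"
  using assms(2,3)
proof (induction xs arbitrary: us ys)
  case (Cons x xs)
  then have "x \<in> set ys" by (metis list.set_intros(1) set_mset_mset)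
  then obtain as bs where ys: "ys = as @ x # bs" by (meson split_list)
  have move: "\<phi> (us @ as @ x # bs) = 0" if "\<phi> (us @ x # as @ bs) = 0" for us
    using that
  proof (induction as arbitrary: us)
    case (Cons a as)
    then show ?case
      using alternating_swap[OF assms(1), of us x a "as @ bs"] Cons.IH[of "us @ [a]"] by simp
  qed simp
  have "\<phi> (us @ x # as @ bs) = 0"
    using Cons.IH[of "as @ bs" "us @ [x]"] Cons.prems by (simp add: ys)
  then have "\<phi> (us @ as @ x # bs) = 0" by (rule move)
  then show ?case by (simp add: ys)
qed simp

text \<open>This makes equality of cohomology classes a finite check: 16 values for a frame of X, 4
  for a frame of L.\<close>

lemma alternating_eqI:
  fixes \<phi> \<psi> :: "'a::real_vector list \<Rightarrow> real"
  assumes "alternating \<phi>" "alternating \<psi>" "span (set bs) = UNIV" "distinct bs"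
    and eq: "\<And>us. us \<in> set (subseqs bs) \<Longrightarrow> \<phi> us = \<psi> us"
  shows "\<phi> = \<psi>"
proof
  define \<delta> where "\<delta> = (\<lambda>vs. 1 * \<phi> vs + (-1) * \<psi> vs)"
  have alt: "alternating \<delta>" unfolding \<delta>_def using assms(1,2) by (rule alternating_lin)
  have basis: "\<delta> us = 0" if "set us \<subseteq> set bs" for us
  proof (cases "distinct us")
    case True
    obtain ws where ws: "ws \<in> set (subseqs bs)" "set ws = set us"
      using subset_subseqs[of "set us" bs] \<open>set us \<subseteq> set bs\<close> by auto
    then have "mset us = mset ws"
      using True subseqs_distinctD[OF ws(1) assms(4)] set_eq_iff_mset_eq_distinct by blast
    then show ?thesis
      using alternating_mset_eq[OF alt, of ws us "[]"] eq[OF ws(1)] by (simp add: \<delta>_def)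
  qed (rule alternating_not_distinct[OF alt])
  \<comment> \<open>Arguments are expanded one at a time from the left: \<open>us\<close> consists
    of basis vectors, \<open>vs\<close> is still arbitrary.\<close>
  have "\<delta> (us @ vs) = 0" if "set us \<subseteq> set bs" for us vs
    using that
  proof (induction vs arbitrary: us)
    case (Cons v vs)
    have "v \<in> span (set bs)" using assms(3) by simp
    then show ?case
    proof (induction rule: span_induct_alt)
      case base
      show ?case using linear_0[OF alternating_linear[OF alt]] by simp
    next
      case (step c x y)
      have "\<delta> (us @ (c *\<^sub>R x + y) # vs) = c * \<delta> (us @ x # vs) + \<delta> (us @ y # vs)"
        using linear_add[OF alternating_linear[OF alt]] linear_scale[OF alternating_linear[OF alt]]
        by simp
      moreover have "\<delta> (us @ x # vs) = 0"
        using Cons.IH[of "us @ [x]"] Cons.prems step(1) by simp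
      ultimately show ?case using step by simp
    qed
  qed (simp add: basis)
  from this[of "[]"] show "\<phi> vs = \<psi> vs" for vs by (simp add: \<delta>_def)
qed

section \<open>Smooth functions\<close>

abbreviation deriv_along :: "'a::real_normed_vector \<Rightarrow> ('a \<Rightarrow> real) \<Rightarrow> 'a \<Rightarrow> real" where
  "deriv_along v f \<equiv> (\<lambda>x. frechet_derivative f (at x) v)"

lemma Ck_continuous: "Ck k f \<Longrightarrow> continuous_on UNIV f"
  by (cases k) (auto simp: differentiable_imp_continuous_on differentiable_on_def)

lemma Ck_SucD: "Ck (Suc k) f \<Longrightarrow> Ck k f"
proof (induction k arbitrary: f)
  case 0
  then show ?case using Ck_continuous Ck.simps(1) by blast
qed auto

lemma Ck_mult: "Ck k f \<Longrightarrow> Ck k g \<Longrightarrow> Ck k (\<lambda>x. f x * g x)"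
proof (induction k arbitrary: f g)
  case 0
  then show ?case by (auto intro!: continuous_intros)
next
  case (Suc k)
  have D: "((\<lambda>x. f x * g x) has_derivative
      (\<lambda>v. f x * frechet_derivative g (at x) v + frechet_derivative f (at x) v * g x)) (at x)" for x
    using Suc.prems unfolding Ck.simps frechet_derivative_works
    by (intro has_derivative_mult) auto
  have "Ck k (\<lambda>x. 1 * (f x * frechet_derivative g (at x) v) + 1 * (frechet_derivative f (at x) v * g x))" for v
    by (rule Ck_lin; rule Suc.IH) (use Suc.prems Ck_SucD in auto)
  then show ?case
    using D frechet_derivative_at[OF D, symmetric] by (auto simp: differentiable_def)
qed

lemma Ck_affine:
  fixes f :: "'b::real_normed_vector \<Rightarrow> real" and A :: "'a::real_normed_vector \<Rightarrow> 'b"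
  assumes "bounded_linear A"
  shows "Ck k f \<Longrightarrow> Ck k (\<lambda>x. f (A x + c))"
proof (induction k arbitrary: f)
  case 0
  then show ?case
    using linear_continuous_on[OF assms]
    by (auto intro!: continuous_on_compose2[of UNIV f] continuous_intros)
next
  case (Suc k)
  have "((\<lambda>x. A x + c) has_derivative A) (at x)" for x
    using bounded_linear_imp_has_derivative[OF assms] by (rule has_derivative_add_const)
  then have D: "((\<lambda>x. f (A x + c)) has_derivative (\<lambda>v. frechet_derivative f (at (A x + c)) (A v))) (at x)" for x
    by (rule has_derivative_compose) (use Suc.prems in \<open>simp add: frechet_derivative_works[symmetric]\<close>)
  show ?case
    using D frechet_derivative_at[OF D, symmetric] Suc.prems Suc.IH[of "deriv_along (A v) f" for v]
    by (auto simp: differentiable_def)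
qed

lemma smooth_const: "smooth (\<lambda>x. c)"
  by (simp add: smooth_def Ck_const)

lemma smooth_add: "smooth f \<Longrightarrow> smooth g \<Longrightarrow> smooth (\<lambda>x. f x + g x)"
  using smooth_lin[of f g 1 1] by simp

lemma smooth_cmult: "smooth f \<Longrightarrow> smooth (\<lambda>x. c * f x)"
  using smooth_lin[of f f c 0] by simp

lemma smooth_mult: "smooth f \<Longrightarrow> smooth g \<Longrightarrow> smooth (\<lambda>x. f x * g x)"
  by (simp add: smooth_def Ck_mult)

lemma smooth_affine: "bounded_linear A \<Longrightarrow> smooth f \<Longrightarrow> smooth (\<lambda>x. f (A x + c))"
  by (simp add: smooth_def Ck_affine)

lemma smooth_deriv_along: "smooth f \<Longrightarrow> smooth (deriv_along v f)"
  unfolding smooth_def by (metis Ck.simps(2))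

lemma smooth_continuous_on: "smooth f \<Longrightarrow> continuous_on S f"
  unfolding smooth_def using Ck.simps(1) continuous_on_subset by blast

lemma smooth_has_derivative: "smooth f \<Longrightarrow> (f has_derivative frechet_derivative f (at x)) (at x)"
  using smooth_differentiable frechet_derivative_works by blast

lemma smooth_linear_deriv: "smooth f \<Longrightarrow> linear (frechet_derivative f (at x))"
  using smooth_has_derivative has_derivative_linear by blast

lemma deriv_along_cmult:
  assumes "smooth f"
  shows "frechet_derivative (\<lambda>x. c * f x) (at x) v = c * frechet_derivative f (at x) v"
  using frechet_derivative_at[OF has_derivative_mult_right[OF smooth_has_derivative[OF assms]], symmetric]
  by simp

section \<open>Averaging along a line\<close>

text \<open>Two weights matter: \<open>w = 1\<close> averages along a segment, and
  \<open>w s = 1 - s\<close> gives the homotopy operator that makes this average cohomologous to the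
  original form.\<close>

definition line_avg ::
    "(real \<Rightarrow> real) \<Rightarrow> 'a::euclidean_space \<Rightarrow> ('a \<Rightarrow> real) \<Rightarrow> 'a \<Rightarrow> real" where
  "line_avg w u f = (\<lambda>x. integral {0..1} (\<lambda>s. w s * f (x + s *\<^sub>R u)))"

lemma line_avg_integrable:
  assumes "continuous_on UNIV w" "smooth f"
  shows "(\<lambda>s. w s * f (x + s *\<^sub>R u)) integrable_on {0..1}"
  by (intro integrable_continuous_interval continuous_intros
      continuous_on_compose2[OF smooth_continuous_on[OF assms(2), of UNIV]]
      continuous_on_subset[OF assms(1)]) auto

text \<open>Differentiation under the integral sign. The derivative is packaged as a bounded linear
  function \<open>F x s\<close> because \<open>leibniz_rule\<close> integrates such a family; its
  continuity is checked componentwise on directional derivatives of \<open>f\<close>.\<close>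

lemma line_avg_has_derivative:
  fixes f :: "'a::euclidean_space \<Rightarrow> real"
  assumes w: "continuous_on UNIV w" and f: "smooth f"
  shows "(line_avg w u f has_derivative (\<lambda>v. line_avg w u (deriv_along v f) x)) (at x)"
proof -
  define F where "F x s = w s *\<^sub>R Blinfun (frechet_derivative f (at (x + s *\<^sub>R u)))" for x s
  have bl: "bounded_linear (frechet_derivative f (at y))" for y
    using smooth_linear_deriv[OF f] linear_conv_bounded_linear by blast
  have F: "blinfun_apply (F x s) v = w s * frechet_derivative f (at (x + s *\<^sub>R u)) v" for x s v
    by (simp add: F_def bounded_linear_Blinfun_apply[OF bl] scaleR_blinfun.rep_eq)
  have cont: "continuous_on S (\<lambda>p. F (fst p) (snd p))" for S
    by (rule continuous_on_blinfun_componentwise)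
      (auto simp: F intro!: continuous_intros
        continuous_on_compose2[OF smooth_continuous_on[OF smooth_deriv_along[OF f], of UNIV]]
        continuous_on_compose2[OF w])
  have "((\<lambda>x. integral (cbox 0 1) (\<lambda>s. w s * f (x + s *\<^sub>R u)))
      has_derivative blinfun_apply (integral (cbox 0 1) (F x))) (at x within UNIV)"
  proof (rule leibniz_rule)
    show "((\<lambda>x. w s * f (x + s *\<^sub>R u)) has_derivative blinfun_apply (F x s)) (at x within UNIV)" for x s
    proof -
      have "((\<lambda>x. f (x + s *\<^sub>R u)) has_derivative frechet_derivative f (at (x + s *\<^sub>R u))) (at x)"
        by (rule has_derivative_compose[of "\<lambda>x. x + s *\<^sub>R u" "\<lambda>h. h"])
          (auto intro!: derivative_eq_intros smooth_has_derivative f)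
      from has_derivative_mult_right[OF this, of "w s"] show ?thesis
        by (simp add: F[abs_def])
    qed
    show "(\<lambda>s. w s * f (x + s *\<^sub>R u)) integrable_on cbox 0 1" for x
      using line_avg_integrable[OF w f] by simp
    show "continuous_on (UNIV \<times> cbox 0 1) (\<lambda>(x, t). F x t)"
      using cont by (simp add: case_prod_unfold)
  qed auto
  moreover have "F x integrable_on cbox 0 1"
    by (rule integrable_continuous)
      (use continuous_on_compose2[OF cont[of UNIV], of "{0..1}" "\<lambda>s. (x, s)"]
        continuous_on_Pair[OF continuous_on_const continuous_on_id, of "{0..1}" x] in simp)
  then have "blinfun_apply (integral (cbox 0 1) (F x)) = (\<lambda>v. line_avg w u (deriv_along v f) x)"
    by (intro ext) (simp add: blinfun_apply_integral F line_avg_def)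
  moreover have "line_avg w u f = (\<lambda>x. integral (cbox 0 1) (\<lambda>s. w s * f (x + s *\<^sub>R u)))"
    by (simp add: line_avg_def)
  ultimately show ?thesis by simp
qed

lemma deriv_along_line_avg:
  assumes "continuous_on UNIV w" "smooth f"
  shows "frechet_derivative (line_avg w u f) (at x) v = line_avg w u (deriv_along v f) x"
  using frechet_derivative_at[OF line_avg_has_derivative[OF assms]] by metis

lemma smooth_line_avg:
  assumes w: "continuous_on UNIV w" and f: "smooth f"
  shows "smooth (line_avg w u f)"
proof -
  have "Ck k (line_avg w u f)" for k
    using f
  proof (induction k arbitrary: f)
    case 0
    then show ?case
      using line_avg_has_derivative[OF w 0]
      by (auto intro!: continuous_at_imp_continuous_on has_derivative_continuous)
  next
    case (Suc k)
    then show ?case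
      using line_avg_has_derivative[OF w Suc.prems]
      by (auto simp: deriv_along_line_avg[OF w] differentiable_def intro: smooth_deriv_along)
  qed
  then show ?thesis by (simp add: smooth_def)
qed

lemma has_field_derivative_line:
  assumes "smooth f"
  shows "((\<lambda>s. f (x + s *\<^sub>R u)) has_real_derivative frechet_derivative f (at (x + s *\<^sub>R u)) u) (at s)"
proof -
  have "((\<lambda>s. f (x + s *\<^sub>R u)) has_derivative (\<lambda>h. frechet_derivative f (at (x + s *\<^sub>R u)) (h *\<^sub>R u))) (at s)"
    by (rule has_derivative_compose[of "\<lambda>s. x + s *\<^sub>R u" "\<lambda>h. h *\<^sub>R u"])
      (auto intro!: derivative_eq_intros smooth_has_derivative assms)
  then show ?thesis
    by (simp add: has_field_derivative_def linear_scale[OF smooth_linear_deriv[OF assms]] mult_commute_abs)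
qed

lemma line_avg_deriv_const:
  assumes "smooth f"
  shows "line_avg (\<lambda>s. 1) u (deriv_along u f) x = f (x + u) - f x"
proof -
  have "((\<lambda>s. frechet_derivative f (at (x + s *\<^sub>R u)) u) has_integral
      f (x + 1 *\<^sub>R u) - f (x + 0 *\<^sub>R u)) {0..1}"
    by (rule fundamental_theorem_of_calculus)
      (auto intro: has_field_derivative_line assms DERIV_subset
        simp: has_real_derivative_iff_has_vector_derivative[symmetric])
  then show ?thesis by (simp add: line_avg_def integral_unique)
qed

text \<open>Integration by parts: the ramp \<open>1 - s\<close> is 0 at \<open>s = 1\<close> and 1
  at \<open>s = 0\<close>, so the boundary contributes \<open>- f x\<close>, and its slope -1
  contributes the plain average.\<close>

lemma line_avg_deriv_ramp:
  assumes "smooth f"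
  shows "line_avg (\<lambda>s. 1 - s) u (deriv_along u f) x = line_avg (\<lambda>s. 1) u f x - f x"
proof -
  have "((\<lambda>s. (1 - s) * frechet_derivative f (at (x + s *\<^sub>R u)) u - f (x + s *\<^sub>R u)) has_integral
      (1 - 1) * f (x + 1 *\<^sub>R u) - (1 - 0) * f (x + 0 *\<^sub>R u)) {0..1}"
  proof (rule fundamental_theorem_of_calculus)
    fix s :: real
    have "((\<lambda>s. (1 - s) * f (x + s *\<^sub>R u)) has_real_derivative
        (1 - s) * frechet_derivative f (at (x + s *\<^sub>R u)) u - f (x + s *\<^sub>R u)) (at s)"
      by (rule derivative_eq_intros has_field_derivative_line assms refl | simp)+
    then show "((\<lambda>s. (1 - s) * f (x + s *\<^sub>R u)) has_vector_derivative
        (1 - s) * frechet_derivative f (at (x + s *\<^sub>R u)) u - f (x + s *\<^sub>R u)) (at s within {0..1})"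
      unfolding has_real_derivative_iff_has_vector_derivative[symmetric] by (rule DERIV_subset) simp
  qed simp
  then have "integral {0..1} (\<lambda>s. (1 - s) * frechet_derivative f (at (x + s *\<^sub>R u)) u - f (x + s *\<^sub>R u)) = - f x"
    by (simp add: integral_unique)
  moreover have "integral {0..1} (\<lambda>s. (1 - s) * frechet_derivative f (at (x + s *\<^sub>R u)) u - f (x + s *\<^sub>R u))
      = line_avg (\<lambda>s. 1 - s) u (deriv_along u f) x - line_avg (\<lambda>s. 1) u f x"
    using line_avg_integrable[OF _ assms, of "\<lambda>s. 1" x u]
      line_avg_integrable[OF _ smooth_deriv_along[OF assms], of "\<lambda>s. 1 - s" x u u]
    by (simp add: line_avg_def integral_diff continuous_intros)
  ultimately show ?thesis by simp
qed

section \<open>Integration over the unit cube\<close>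

lemma mem_slab:
  fixes b :: "'a::euclidean_space"
  assumes "b \<in> Basis"
  shows "x \<in> cbox (p *\<^sub>R b) (One + (q - 1) *\<^sub>R b) \<longleftrightarrow>
    (p \<le> x \<bullet> b \<and> x \<bullet> b \<le> q) \<and> (\<forall>i\<in>Basis - {b}. 0 \<le> x \<bullet> i \<and> x \<bullet> i \<le> 1)"
proof -
  have "(p *\<^sub>R b \<bullet> i \<le> x \<bullet> i \<and> x \<bullet> i \<le> (One + (q - 1) *\<^sub>R b) \<bullet> i) \<longleftrightarrow>
      (if i = b then p \<le> x \<bullet> i \<and> x \<bullet> i \<le> q else 0 \<le> x \<bullet> i \<and> x \<bullet> i \<le> 1)" if "i \<in> Basis" for i
    using that assms by (simp add: inner_Basis inner_left_distrib)
  then show ?thesis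
    using assms by (auto simp: mem_box)
qed

lemma integral_slab_split:
  fixes f :: "'a::euclidean_space \<Rightarrow> real"
  assumes "continuous_on UNIV f" "b \<in> Basis" "p \<le> m" "m \<le> q"
  shows "integral (cbox (p *\<^sub>R b) (One + (q - 1) *\<^sub>R b)) f =
    integral (cbox (p *\<^sub>R b) (One + (m - 1) *\<^sub>R b)) f + integral (cbox (m *\<^sub>R b) (One + (q - 1) *\<^sub>R b)) f"
proof -
  have "cbox (p *\<^sub>R b) (One + (q - 1) *\<^sub>R b) \<inter> {x. x \<bullet> b \<le> m} = cbox (p *\<^sub>R b) (One + (m - 1) *\<^sub>R b)"
    using assms(3,4) by (auto simp: mem_slab[OF assms(2)])
  moreover have "cbox (p *\<^sub>R b) (One + (q - 1) *\<^sub>R b) \<inter> {x. x \<bullet> b \<ge> m} = cbox (m *\<^sub>R b) (One + (q - 1) *\<^sub>R b)"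
    using assms(3,4) by (auto simp: mem_slab[OF assms(2)])
  moreover have "f integrable_on cbox (p *\<^sub>R b) (One + (q - 1) *\<^sub>R b)"
    by (rule integrable_continuous[OF continuous_on_subset[OF assms(1)]]) simp
  ultimately show ?thesis
    using integral_split[OF _ assms(2)] by metis
qed

text \<open>Shifting the cube by \<open>t\<close> along \<open>b\<close> removes the slab over 0 to
  \<open>t\<close> and adds the slab over 1 to \<open>1 + t\<close>; by periodicity these have the
  same integral.\<close>

lemma integral_cube_shift:
  fixes f :: "'a::euclidean_space \<Rightarrow> real"
  assumes f: "continuous_on UNIV f" and b: "b \<in> Basis" and per: "\<And>x. f (x + b) = f x"
    and t: "0 \<le> t" "t \<le> 1"
  shows "integral (cbox 0 One) (\<lambda>x. f (x + t *\<^sub>R b)) = integral (cbox 0 One) f"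
proof -
  define I where "I p q = integral (cbox (p *\<^sub>R b) (One + (q - 1) *\<^sub>R b)) f" for p q
  have split: "I p q = I p m + I m q" if "p \<le> m" "m \<le> q" for p q m
    unfolding I_def using integral_slab_split[OF f b that] .
  have shift: "I (p + t) (q + t) = integral (cbox (p *\<^sub>R b) (One + (q - 1) *\<^sub>R b)) (\<lambda>x. f (x + t *\<^sub>R b))" for p q t
    unfolding I_def using integral_shift_cbox_plus[of "p *\<^sub>R b" "One + (q - 1) *\<^sub>R b" f "t *\<^sub>R b"]
    by (simp add: o_def algebra_simps)
  have "I 1 (1 + t) = I 0 t"
    using shift[of 0 1 t] by (simp add: per I_def algebra_simps)
  \<comment> \<open>The slab over 0 to \<open>1 + t\<close> is cut once at \<open>t\<close> and once
    at 1.\<close>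
  then have "I t (1 + t) = I 0 1"
    using split[of 0 t "1 + t"] split[of 0 1 "1 + t"] t by simp
  then show ?thesis
    using shift[of 0 t 1] by (simp add: I_def algebra_simps)
qed

text \<open>Averaging the derivative over the translates by \<open>s\<close> times \<open>b\<close>
  gives \<open>f (x + b) - f x = 0\<close> pointwise. After exchanging the integrals, shift
  invariance shows that this averaging leaves the integral over the cube unchanged.\<close>

lemma integral_cube_deriv:
  fixes f :: "'a::euclidean_space \<Rightarrow> real"
  assumes f: "smooth f" and b: "b \<in> Basis" and per: "\<And>x. f (x + b) = f x"
  shows "integral (cbox 0 One) (deriv_along b f) = 0"
proof -
  let ?g = "deriv_along b f"
  have g: "continuous_on UNIV ?g"
    by (rule smooth_continuous_on[OF smooth_deriv_along[OF f]])
  have "((\<lambda>y. f (y + b)) has_derivative frechet_derivative f (at (x + b))) (at x)" for x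
    by (rule has_derivative_compose[of "\<lambda>x. x + b" "\<lambda>h. h"])
      (auto intro!: derivative_eq_intros smooth_has_derivative f)
  then have "frechet_derivative f (at (x + b)) = frechet_derivative f (at x)" for x
    using frechet_derivative_at[of f _ x] by (simp add: per)
  then have gper: "?g (x + b) = ?g x" for x by simp
  have "0 = integral (cbox 0 One) (\<lambda>x. line_avg (\<lambda>s. 1) b ?g x)"
    by (simp add: line_avg_deriv_const[OF f] per)
  also have "\<dots> = integral (cbox 0 One) (\<lambda>x. integral (cbox 0 1) (\<lambda>s. ?g (x + s *\<^sub>R b)))"
    by (simp add: line_avg_def)
  also have "\<dots> = integral (cbox 0 1) (\<lambda>s. integral (cbox 0 One) (\<lambda>x. ?g (x + s *\<^sub>R b)))"
    by (rule integral_swap_continuous)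
      (auto simp: case_prod_unfold intro!: continuous_intros continuous_on_compose2[OF g])
  also have "\<dots> = integral (cbox 0 1) (\<lambda>s::real. integral (cbox 0 One) ?g)"
    by (rule integral_cong) (use integral_cube_shift[OF g b gper] in auto)
  finally show ?thesis by simp
qed

section \<open>Exterior calculus\<close>

lemma forms_smooth: "\<omega> \<in> forms \<Longrightarrow> smooth (\<lambda>x. \<omega> x vs)"
  by (simp add: forms_def)

lemma forms_alternating: "\<omega> \<in> forms \<Longrightarrow> alternating (\<omega> x)"
  by (simp add: forms_def)

lemma forms_periodic: "\<omega> \<in> forms \<Longrightarrow> l \<in> period_lattice \<Longrightarrow> \<omega> (x + l) = \<omega> x"
  by (simp add: forms_def)

lemma contract_forms: "\<omega> \<in> forms \<Longrightarrow> (\<lambda>x. contract v (\<omega> x)) \<in> forms"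
  using alternating_contract by (auto simp: forms_def) (simp add: contract_def)

lemma twist_forms: "\<omega> \<in> forms \<Longrightarrow> (\<lambda>x. twist (\<omega> x)) \<in> forms"
  using alternating_twist by (auto simp: forms_def) (simp add: twist_def smooth_cmult)

lemma smooth_shuffle:
  "\<alpha> \<in> forms \<Longrightarrow> \<beta> \<in> forms \<Longrightarrow> smooth (\<lambda>x. shuffle (\<alpha> x) (\<beta> x) vs)"
  by (induction vs arbitrary: \<alpha> \<beta>)
    (auto simp: shuffle_Nil shuffle_Cons forms_smooth
      intro!: smooth_mult smooth_add contract_forms twist_forms)

lemma shuffle_forms: "\<alpha> \<in> forms \<Longrightarrow> \<beta> \<in> forms \<Longrightarrow> (\<lambda>x. shuffle (\<alpha> x) (\<beta> x)) \<in> forms"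
  using smooth_shuffle[of \<alpha> \<beta>] alternating_shuffle[OF forms_alternating forms_alternating, of \<alpha> \<beta>]
    forms_periodic[of \<alpha>] forms_periodic[of \<beta>]
  unfolding forms_def[THEN eqset_imp_iff, of "\<lambda>x. shuffle (\<alpha> x) (\<beta> x)"] by simp

lemma ext_d_Nil: "ext_d \<omega> x [] = 0"
  by (simp add: ext_d_def)

text \<open>Cartan's formula for the constant field \<open>v\<close>. The term with index 0 is the
  derivative along \<open>v\<close>; in the others every index is shifted by one, which flips the
  sign. The result is a recursion on the arguments that matches \<open>shuffle_Cons\<close>.\<close>

lemma ext_d_Cons:
  "ext_d \<omega> x (v # vs) =
     frechet_derivative (\<lambda>y. \<omega> y vs) (at x) v - ext_d (\<lambda>y. contract v (\<omega> y)) x vs"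
proof -
  have "{j. Suc j \<in> - {0}} = UNIV" "\<And>i. {j. Suc j \<in> - {Suc i}} = - {i}" by auto
  then show ?thesis
    by (simp add: ext_d_def sum.lessThan_Suc_shift nths_Cons contract_def sum_negf nths_all
        del: sum.lessThan_Suc)
qed

lemma contract_ext_d:
  "contract v (ext_d \<omega> x) =
     (\<lambda>vs. frechet_derivative (\<lambda>y. \<omega> y vs) (at x) v - ext_d (\<lambda>y. contract v (\<omega> y)) x vs)"
  by (simp add: contract_def ext_d_Cons[unfolded contract_def])

lemma ext_d_minus: "\<omega> \<in> forms \<Longrightarrow> ext_d (\<lambda>x vs. - \<omega> x vs) x vs = - ext_d \<omega> x vs"
  using ext_d_lin[of \<omega> \<omega> "-1" 0] by simp

lemma ext_d_add:
  "\<alpha> \<in> forms \<Longrightarrow> \<beta> \<in> forms \<Longrightarrow> ext_d (\<lambda>x vs. \<alpha> x vs + \<beta> x vs) x vs = ext_d \<alpha> x vs + ext_d \<beta> x vs"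
  using ext_d_lin[of \<alpha> \<beta> 1 1] by simp

text \<open>The differential raises the degree by one, so it anticommutes with the grading
  involution.\<close>

lemma ext_d_twist: "\<omega> \<in> forms \<Longrightarrow> ext_d (\<lambda>x. twist (\<omega> x)) x vs = - twist (ext_d \<omega> x) vs"
proof (induction vs arbitrary: \<omega>)
  case (Cons v vs)
  have "frechet_derivative (\<lambda>y. twist (\<omega> y) vs) (at x) v
      = (-1) ^ length vs * frechet_derivative (\<lambda>y. \<omega> y vs) (at x) v"
    unfolding twist_def by (rule deriv_along_cmult[OF forms_smooth[OF Cons.prems]])
  then show ?case
    using Cons.IH[OF contract_forms[OF Cons.prems]]
    by (simp add: ext_d_Cons contract_twist ext_d_minus twist_forms contract_forms Cons.prems)
      (simp add: twist_def ext_d_Cons algebra_simps)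
qed (simp add: ext_d_Nil twist_def)

lemma shuffle_has_derivative:
  assumes "\<alpha> \<in> forms" "\<beta> \<in> forms"
  shows "((\<lambda>x. shuffle (\<alpha> x) (\<beta> x) vs) has_derivative (\<lambda>v.
     shuffle (\<lambda>us. frechet_derivative (\<lambda>y. \<alpha> y us) (at x) v) (\<beta> x) vs
     + shuffle (\<alpha> x) (\<lambda>us. frechet_derivative (\<lambda>y. \<beta> y us) (at x) v) vs)) (at x)"
  using assms
proof (induction vs arbitrary: \<alpha> \<beta>)
  case Nil
  show ?case
    using has_derivative_mult[OF smooth_has_derivative[OF forms_smooth[OF Nil(1), of "[]"], of x]
        smooth_has_derivative[OF forms_smooth[OF Nil(2), of "[]"], of x]]
    by (simp add: shuffle_Nil add.commute)
next
  case (Cons w vs)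
  have tw: "frechet_derivative (\<lambda>y. twist (\<alpha> y) us) (at x) v
      = twist (\<lambda>us. frechet_derivative (\<lambda>y. \<alpha> y us) (at x) v) us" for us v
    unfolding twist_def by (rule deriv_along_cmult[OF forms_smooth[OF Cons.prems(1)]])
  show ?case
    using has_derivative_add[OF Cons.IH[OF contract_forms[OF Cons.prems(1), of w] Cons.prems(2)]
       Cons.IH[OF twist_forms[OF Cons.prems(1)] contract_forms[OF Cons.prems(2), of w]]]
    by (simp add: shuffle_Cons tw) (simp add: contract_def algebra_simps)
qed

text \<open>The graded Leibniz rule. Cartan's formula reduces it to the product rule for the
  derivative along the first vector and to the induction hypothesis for the two products with one
  contracted factor.\<close>

lemma ext_d_shuffle:
  assumes "\<alpha> \<in> forms" "\<beta> \<in> forms"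
  shows "ext_d (\<lambda>x. shuffle (\<alpha> x) (\<beta> x)) x vs
    = shuffle (ext_d \<alpha> x) (\<beta> x) vs + shuffle (twist (\<alpha> x)) (ext_d \<beta> x) vs"
  using assms
proof (induction vs arbitrary: \<alpha> \<beta>)
  case Nil
  then show ?case by (simp add: ext_d_Nil shuffle_Nil)
next
  case (Cons v vs)
  note f = Cons.prems contract_forms[OF Cons.prems(1), of v] contract_forms[OF Cons.prems(2), of v]
    twist_forms[OF Cons.prems(1)]
  have tw: "ext_d (\<lambda>x. twist (\<alpha> x)) x = (\<lambda>us. - twist (ext_d \<alpha> x) us)"
    by (rule ext) (rule ext_d_twist[OF f(1)])
  have "ext_d (\<lambda>x. shuffle (\<alpha> x) (\<beta> x)) x (v # vs)
      = frechet_derivative (\<lambda>y. shuffle (\<alpha> y) (\<beta> y) vs) (at x) v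
      - (ext_d (\<lambda>x. shuffle (contract v (\<alpha> x)) (\<beta> x)) x vs
        + ext_d (\<lambda>x. shuffle (twist (\<alpha> x)) (contract v (\<beta> x))) x vs)"
    by (simp add: ext_d_Cons contract_shuffle ext_d_add shuffle_forms f)
  also have "\<dots> = shuffle (ext_d \<alpha> x) (\<beta> x) (v # vs) + shuffle (twist (\<alpha> x)) (ext_d \<beta> x) (v # vs)"
    unfolding Cons.IH[OF f(3,2)] Cons.IH[OF f(5,4)]
      frechet_derivative_at[OF shuffle_has_derivative[OF f(1,2)], symmetric]
    by (simp add: shuffle_Cons contract_ext_d contract_twist shuffle_diff_left shuffle_diff_right tw shuffle_minus_left)
  finally show ?case .
qed

lemma wedge_eq_shuffle_fun: "wedge \<alpha> \<beta> = (\<lambda>x. shuffle (\<alpha> x) (\<beta> x))"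
  by (intro ext) (rule wedge_eq_shuffle)

lemma closed_forms_ext_d: "\<omega> \<in> closed_forms \<Longrightarrow> ext_d \<omega> x = (\<lambda>vs. 0)"
  by (auto simp: closed_forms_def)

lemma closed_forms_forms: "\<omega> \<in> closed_forms \<Longrightarrow> \<omega> \<in> forms"
  by (simp add: closed_forms_def)

lemma wedge_closed:
  assumes "\<alpha> \<in> closed_forms" "\<beta> \<in> closed_forms"
  shows "wedge \<alpha> \<beta> \<in> closed_forms"
proof -
  note f = closed_forms_forms[OF assms(1)] closed_forms_forms[OF assms(2)]
  have "ext_d (\<lambda>x. shuffle (\<alpha> x) (\<beta> x)) x vs = 0" for x vs
    unfolding ext_d_shuffle[OF f] closed_forms_ext_d[OF assms(1)] closed_forms_ext_d[OF assms(2)]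
    by (simp add: shuffle_zero_left shuffle_zero_right)
  then show ?thesis
    using shuffle_forms[OF f] by (simp add: closed_forms_def wedge_eq_shuffle_fun)
qed

text \<open>One factor is changed at a time. The primitives are the product of \<gamma> with \<beta>
  and the product of \<open>twist\<close> of \<alpha>' with \<delta>; the involution cancels the
  sign in the Leibniz rule.\<close>

lemma cohomologous_wedge:
  assumes "cohomologous \<alpha> \<alpha>'" "cohomologous \<beta> \<beta>'"
  shows "cohomologous (wedge \<alpha> \<beta>) (wedge \<alpha>' \<beta>')"
proof -
  note d0 = closed_forms_ext_d closed_forms_forms
  have c: "\<alpha> \<in> closed_forms" "\<alpha>' \<in> closed_forms" "\<beta> \<in> closed_forms" "\<beta>' \<in> closed_forms"
    using assms by (auto simp: cohomologous_def)
  obtain \<gamma> where g: "\<gamma> \<in> forms" "\<And>x vs. \<alpha> x vs - \<alpha>' x vs = ext_d \<gamma> x vs"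
    using assms unfolding cohomologous_def by blast
  obtain \<delta> where d: "\<delta> \<in> forms" "\<And>x vs. \<beta> x vs - \<beta>' x vs = ext_d \<delta> x vs"
    using assms unfolding cohomologous_def by blast
  have "wedge \<alpha> \<beta> x vs - wedge \<alpha>' \<beta> x vs = ext_d (\<lambda>x. shuffle (\<gamma> x) (\<beta> x)) x vs" for x vs
    unfolding wedge_eq_shuffle ext_d_shuffle[OF g(1) d0(2)[OF c(3)]] d0(1)[OF c(3)]
    by (simp add: g(2)[symmetric, abs_def] shuffle_zero_right shuffle_diff_left)
  then have 1: "cohomologous (wedge \<alpha> \<beta>) (wedge \<alpha>' \<beta>)"
    using wedge_closed[OF c(1,3)] wedge_closed[OF c(2,3)] shuffle_forms[OF g(1) d0(2)[OF c(3)]]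
    unfolding cohomologous_def by blast
  have tw0: "ext_d (\<lambda>x. twist (\<alpha>' x)) x = (\<lambda>vs. 0)" for x
    using ext_d_twist[OF d0(2)[OF c(2)]] by (intro ext) (simp add: d0(1)[OF c(2)] twist_def[of "\<lambda>_. 0"])
  have "wedge \<alpha>' \<beta> x vs - wedge \<alpha>' \<beta>' x vs = ext_d (\<lambda>x. shuffle (twist (\<alpha>' x)) (\<delta> x)) x vs" for x vs
    unfolding wedge_eq_shuffle ext_d_shuffle[OF twist_forms[OF d0(2)[OF c(2)]] d(1)]
    by (simp add: tw0 d(2)[symmetric, abs_def] shuffle_zero_left shuffle_diff_right)
  then have 2: "cohomologous (wedge \<alpha>' \<beta>) (wedge \<alpha>' \<beta>')"
    using wedge_closed[OF c(2,3)] wedge_closed[OF c(2,4)]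
      shuffle_forms[OF twist_forms[OF d0(2)[OF c(2)]] d(1)]
    unfolding cohomologous_def by blast
  show ?thesis by (rule cohomologous_trans[OF 1 2])
qed

text \<open>All maps of tori that occur are affine. Recording the linear part \<open>A\<close> makes
  the derivative constant, and pullback acts on constant forms through \<open>A\<close>
  alone.\<close>

definition torus_map :: "('a::periodic_space \<Rightarrow> 'b::periodic_space) \<Rightarrow> ('a \<Rightarrow> 'b) \<Rightarrow> bool" where
  "torus_map f A \<longleftrightarrow> linear A \<and> A ` period_lattice \<subseteq> period_lattice \<and> (\<exists>c. f = (\<lambda>x. A x + c))"

lemma torus_mapI:
  "linear A \<Longrightarrow> A ` period_lattice \<subseteq> period_lattice \<Longrightarrow> (\<And>x. f x = A x + c) \<Longrightarrow> torus_map f A"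
  unfolding torus_map_def by blast

lemma torus_map_has_derivative: "torus_map f A \<Longrightarrow> (f has_derivative A) (at x)"
  unfolding torus_map_def
  by (auto simp: linear_conv_bounded_linear intro!: has_derivative_add_const bounded_linear_imp_has_derivative)

lemma pullback_torus_map: "torus_map f A \<Longrightarrow> pullback f \<omega> = (\<lambda>x vs. \<omega> (f x) (map A vs))"
  using frechet_derivative_at[OF torus_map_has_derivative, of f A, symmetric]
  by (simp add: pullback_def)

lemma pullback_forms:
  assumes f: "torus_map f A" and "\<omega> \<in> forms"
  shows "pullback f \<omega> \<in> forms"
proof -
  obtain c where c: "linear A" "A ` period_lattice \<subseteq> period_lattice" "f = (\<lambda>x. A x + c)"
    using f unfolding torus_map_def by blast
  have "f (x + l) = f x + A l" for x l
    using linear_add[OF c(1)] by (simp add: c(3))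
  moreover have "smooth (\<lambda>x. \<omega> (f x) (map A vs))" for vs
    unfolding c(3) using c(1) forms_smooth[OF assms(2)]
    by (intro smooth_affine[of A "\<lambda>y. \<omega> y (map A vs)"]) (simp_all add: linear_conv_bounded_linear)
  ultimately show ?thesis
    using c(2) assms(2) unfolding pullback_torus_map[OF f]
    by (auto simp: forms_def alternating_map[OF _ c(1)] image_subset_iff)
qed

lemma ext_d_pullback:
  assumes f: "torus_map f A" and "\<omega> \<in> forms"
  shows "ext_d (pullback f \<omega>) x vs = pullback f (ext_d \<omega>) x vs"
  using assms(2) unfolding pullback_torus_map[OF f]
proof (induction vs arbitrary: \<omega>)
  case (Cons v vs)
  have "((\<lambda>x. \<omega> (f x) (map A vs)) has_derivative
      (\<lambda>v. frechet_derivative (\<lambda>y. \<omega> y (map A vs)) (at (f x)) (A v))) (at x)"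
    by (rule has_derivative_compose[OF torus_map_has_derivative[OF f]])
      (rule smooth_has_derivative[OF forms_smooth[OF Cons.prems]])
  from frechet_derivative_at[OF this]
  have "frechet_derivative (\<lambda>x. \<omega> (f x) (map A vs)) (at x) v
      = frechet_derivative (\<lambda>y. \<omega> y (map A vs)) (at (f x)) (A v)" by metis
  then show ?case
    using Cons.IH[OF contract_forms[OF Cons.prems, of "A v"]]
    by (simp add: ext_d_Cons) (simp add: contract_def)
qed (simp add: ext_d_Nil)

lemma cohomologous_pullback:
  assumes f: "torus_map f A" and "cohomologous \<alpha> \<beta>"
  shows "cohomologous (pullback f \<alpha>) (pullback f \<beta>)"
proof -
  have cl: "pullback f \<omega> \<in> closed_forms" if "\<omega> \<in> closed_forms" for \<omega>
    using that unfolding closed_forms_def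
    by (auto simp: pullback_forms[OF f] ext_d_pullback[OF f]) (simp add: pullback_def)
  obtain \<gamma> where g: "\<gamma> \<in> forms" "\<And>x vs. \<alpha> x vs - \<beta> x vs = ext_d \<gamma> x vs"
    using assms unfolding cohomologous_def by blast
  have "pullback f \<alpha> x vs - pullback f \<beta> x vs = ext_d (pullback f \<gamma>) x vs" for x vs
    unfolding ext_d_pullback[OF f g(1)] by (simp add: pullback_def g(2))
  then show ?thesis
    using assms(2) cl pullback_forms[OF f g(1)] unfolding cohomologous_def by blast
qed

section \<open>Closed forms on the torus are cohomologous to constant ones\<close>

text \<open>Periodicity along the standard basis makes the unit cube usable for integration. The
  lattice must also contain 0 for the class to be closed under products: a basis vector of a product
  has one component equal to 0.\<close>

class cubic_space = periodic_space +
  assumes Basis_lattice: "insert 0 Basis \<subseteq> (period_lattice :: 'a set)"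

instance real :: cubic_space
  by standard (simp add: period_lattice_real_def)

instance complex :: cubic_space
  by standard (auto simp: period_lattice_complex_def Basis_complex_def)

instance prod :: (cubic_space, cubic_space) cubic_space
proof
  show "insert 0 Basis \<subseteq> (period_lattice :: ('a \<times> 'b) set)"
    using Basis_lattice[where 'a = 'a] Basis_lattice[where 'a = 'b]
    unfolding period_lattice_prod_def Basis_prod_def zero_prod_def by auto
qed

lemma line_avg_add:
  assumes "continuous_on UNIV w" "smooth f" "smooth g"
  shows "line_avg w u (\<lambda>x. f x + g x) x = line_avg w u f x + line_avg w u g x"
  using integral_add[OF line_avg_integrable[OF assms(1,2)] line_avg_integrable[OF assms(1,3)]]
  by (simp add: line_avg_def distrib_left)

lemma line_avg_cmult: "line_avg w u (\<lambda>x. c * f x) x = c * line_avg w u f x"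
  unfolding line_avg_def by (simp only: mult.left_commute[of _ c] integral_mult_right)

lemma line_avg_zero: "line_avg w u (\<lambda>x. 0) x = 0"
  by (simp add: line_avg_def)

definition line_form :: "(real \<Rightarrow> real) \<Rightarrow> 'a::euclidean_space \<Rightarrow> 'a form \<Rightarrow> 'a form" where
  "line_form w u \<omega> = (\<lambda>x vs. line_avg w u (\<lambda>y. \<omega> y vs) x)"

lemma line_form_forms:
  assumes w: "continuous_on UNIV w" and \<omega>: "\<omega> \<in> forms"
  shows "line_form w u \<omega> \<in> forms"
proof -
  note sm = forms_smooth[OF \<omega>]
  have "alternating (line_form w u \<omega> x)" for x
    unfolding alternating_def
  proof (intro conjI allI impI)
    fix us ws
    have "\<omega> y (us @ (v + v') # ws) = \<omega> y (us @ v # ws) + \<omega> y (us @ v' # ws)"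
      "\<omega> y (us @ (r *\<^sub>R v) # ws) = r * \<omega> y (us @ v # ws)" for y v v' r
      using linear_add[OF alternating_linear[OF forms_alternating[OF \<omega>]]]
        linear_scale[OF alternating_linear[OF forms_alternating[OF \<omega>]]] by simp_all
    then show "linear (\<lambda>v. line_form w u \<omega> x (us @ v # ws))"
      by (intro linearI) (simp_all add: line_form_def line_avg_add[OF w sm sm] line_avg_cmult)
  next
    fix vs :: "'a list" assume "\<not> distinct vs"
    then show "line_form w u \<omega> x vs = 0"
      using alternating_not_distinct[OF forms_alternating[OF \<omega>]]
      by (simp add: line_form_def line_avg_zero)
  qed
  moreover have "line_form w u \<omega> (x + l) = line_form w u \<omega> x" if "l \<in> period_lattice" for x l
  proof -
    have "\<omega> (x + l + s *\<^sub>R u) = \<omega> (x + s *\<^sub>R u)" for s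
      using forms_periodic[OF \<omega> that, of "x + s *\<^sub>R u"] by (simp add: add_ac)
    then show ?thesis by (simp add: line_form_def line_avg_def)
  qed
  moreover have "smooth (\<lambda>x. line_form w u \<omega> x vs)" for vs
    unfolding line_form_def by (rule smooth_line_avg[OF w sm])
  ultimately show ?thesis by (simp add: forms_def)
qed

lemma smooth_ext_d: "\<omega> \<in> forms \<Longrightarrow> smooth (\<lambda>x. ext_d \<omega> x vs)"
proof (induction vs arbitrary: \<omega>)
  case (Cons v vs)
  then show ?case
    using smooth_lin[OF smooth_deriv_along[OF forms_smooth[OF Cons.prems, of vs], of v]
        Cons.IH[OF contract_forms[OF Cons.prems, of v]], of 1 "-1"]
    by (simp add: ext_d_Cons)
qed (simp add: ext_d_Nil smooth_const)

text \<open>The differential commutes with translations, hence with any weighted average of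
  translates.\<close>

lemma ext_d_line_form:
  assumes w: "continuous_on UNIV w" and "\<omega> \<in> forms"
  shows "ext_d (line_form w u \<omega>) x vs = line_form w u (ext_d \<omega>) x vs"
  using assms(2)
proof (induction vs arbitrary: \<omega>)
  case Nil
  then show ?case by (simp add: ext_d_Nil line_form_def line_avg_zero)
next
  case (Cons v vs)
  note c = contract_forms[OF Cons.prems, of v]
  have "ext_d (line_form w u \<omega>) x (v # vs)
      = line_avg w u (deriv_along v (\<lambda>y. \<omega> y vs)) x
        + (-1) * ext_d (line_form w u (\<lambda>y. contract v (\<omega> y))) x vs"
    unfolding ext_d_Cons line_form_def deriv_along_line_avg[OF w forms_smooth[OF Cons.prems]]
    by (simp add: contract_def)
  also have "\<dots> = line_avg w u (\<lambda>y. frechet_derivative (\<lambda>y. \<omega> y vs) (at y) v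
      + (-1) * ext_d (\<lambda>y. contract v (\<omega> y)) y vs) x"
    unfolding Cons.IH[OF c]
    by (simp only: line_form_def line_avg_cmult
        line_avg_add[OF w smooth_deriv_along[OF forms_smooth[OF Cons.prems]]
          smooth_cmult[OF smooth_ext_d[OF c]]])
  also have "\<dots> = line_form w u (ext_d \<omega>) x (v # vs)"
    by (simp add: line_form_def ext_d_Cons)
  finally show ?case .
qed

lemma line_form_closed:
  assumes "continuous_on UNIV w" "\<omega> \<in> closed_forms"
  shows "line_form w u \<omega> \<in> closed_forms"
proof -
  have f: "\<omega> \<in> forms" "\<And>y. ext_d \<omega> y = (\<lambda>vs. 0)"
    using closed_forms_forms[OF assms(2)] closed_forms_ext_d[OF assms(2)] by auto
  then show ?thesis
    using line_form_forms[OF assms(1) f(1)] ext_d_line_form[OF assms(1) f(1)]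
    by (simp add: closed_forms_def) (simp add: line_form_def line_avg_zero)
qed

text \<open>
  Along the flow of the constant field \<open>u\<close>, Cartan's formula reads \<open>\<partial>\<^sub>s (T\<^sub>s \<omega>) = d (T\<^sub>s (\<iota>\<^sub>u \<omega>))\<close> for
  closed \<open>\<omega>\<close>; multiply by \<open>1 - s\<close> and integrate by parts over \<open>[0, 1]\<close>.
\<close>

lemma cohomologous_line_form:
  assumes "\<omega> \<in> closed_forms"
  shows "cohomologous (line_form (\<lambda>s. 1) u \<omega>) \<omega>"
proof -
  have f: "\<omega> \<in> forms" by (rule closed_forms_forms[OF assms])
  define w where "w = (\<lambda>s::real. 1 - s)"
  have w: "continuous_on UNIV w" unfolding w_def by (intro continuous_intros)
  have "ext_d (\<lambda>y. contract u (\<omega> y)) y vs = frechet_derivative (\<lambda>z. \<omega> z vs) (at y) u" for y vs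
    using closed_forms_ext_d[OF assms, of y] ext_d_Cons[of \<omega> y u vs] by simp
  then have "line_form (\<lambda>s. 1) u \<omega> x vs - \<omega> x vs
      = ext_d (line_form w u (\<lambda>y. contract u (\<omega> y))) x vs" for x vs
    using line_avg_deriv_ramp[OF forms_smooth[OF f, of vs], of u x]
    by (simp add: ext_d_line_form[OF w contract_forms[OF f]]) (simp add: line_form_def w_def)
  then show ?thesis
    using line_form_closed[OF continuous_on_const assms] assms line_form_forms[OF w contract_forms[OF f]]
    unfolding cohomologous_def by blast
qed

lemma smooth_const_if_deriv_zero:
  fixes f :: "'a::euclidean_space \<Rightarrow> real"
  assumes f: "smooth f" and d: "\<And>b x. b \<in> Basis \<Longrightarrow> frechet_derivative f (at x) b = 0"
  shows "f x = f y"
proof (rule has_derivative_zero_unique[where f = f and s = UNIV])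
  have "frechet_derivative f (at z) = (\<lambda>v. 0)" for z
    by (rule linear_eq_stdbasis[OF smooth_linear_deriv[OF f] linear_zero]) (simp add: d)
  then show "(f has_derivative (\<lambda>v. 0)) (at z within UNIV)" for z
    using smooth_has_derivative[OF f, of z] by simp
qed auto

lemma closed_form_cohomologous_const:
  fixes \<omega> :: "'a::cubic_space form"
  assumes "\<omega> \<in> closed_forms"
  obtains \<phi> where "alternating \<phi>" "cohomologous \<omega> (\<lambda>_. \<phi>)"
proof -
  have "\<exists>\<omega>'. cohomologous \<omega> \<omega>' \<and> (\<forall>u\<in>F. \<forall>x vs. frechet_derivative (\<lambda>y. \<omega>' y vs) (at x) u = 0)"
    if "finite F" "F \<subseteq> Basis" for F
    using that
  proof (induction F rule: finite_induct)
    case empty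
    then show ?case using cohomologous_refl[OF assms] by auto
  next
    case (insert u F)
    then obtain \<omega>' where \<omega>': "cohomologous \<omega> \<omega>'"
        "\<And>v x vs. v \<in> F \<Longrightarrow> frechet_derivative (\<lambda>y. \<omega>' y vs) (at x) v = 0"
      by blast
    then have cl: "\<omega>' \<in> closed_forms" and f: "\<omega>' \<in> forms"
      by (auto simp: cohomologous_def closed_forms_def)
    have "u \<in> period_lattice" using insert.prems Basis_lattice by auto
    \<comment> \<open>For \<open>v = u\<close> the averaged derivative is the difference of the
      values at \<open>x + u\<close> and \<open>x\<close>, which is 0 by periodicity. For
      \<open>v\<close> in \<open>F\<close> differentiation commutes with averaging, so the
      directions treated earlier are not spoiled.\<close>
    then have "frechet_derivative (\<lambda>y. line_form (\<lambda>s. 1) u \<omega>' y vs) (at x) v = 0"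
      if "v \<in> insert u F" for v x vs
      using that \<omega>'(2) forms_periodic[OF f]
      by (auto simp: line_form_def deriv_along_line_avg[OF _ forms_smooth[OF f]] line_avg_zero
          line_avg_deriv_const[OF forms_smooth[OF f]])
    moreover have "cohomologous \<omega> (line_form (\<lambda>s. 1) u \<omega>')"
      using cohomologous_trans[OF \<omega>'(1) cohomologous_sym[OF cohomologous_line_form[OF cl]]] .
    ultimately show ?case by blast
  qed
  from this[OF finite_Basis] obtain \<omega>' where \<omega>': "cohomologous \<omega> \<omega>'"
      "\<And>v x vs. v \<in> Basis \<Longrightarrow> frechet_derivative (\<lambda>y. \<omega>' y vs) (at x) v = 0"
    by blast
  then have f: "\<omega>' \<in> forms" by (auto simp: cohomologous_def closed_forms_def)
  have "\<omega>' x vs = \<omega>' 0 vs" for x vs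
    by (rule smooth_const_if_deriv_zero[OF forms_smooth[OF f] \<omega>'(2)])
  then have "\<omega>' = (\<lambda>_. \<omega>' 0)" by (intro ext)
  with \<omega>'(1) forms_alternating[OF f, of 0] show thesis
    by (metis that)
qed

lemma ext_d_const: "ext_d (\<lambda>_. \<phi>) x vs = 0"
  by (simp add: ext_d_def)

lemma const_closed: "alternating \<phi> \<Longrightarrow> (\<lambda>_. \<phi>) \<in> closed_forms"
  by (simp add: closed_forms_def forms_def smooth_const ext_d_const)

section \<open>Means over the cube and uniqueness of the constant representative\<close>

definition cube_mean :: "'a::euclidean_space form \<Rightarrow> 'a list \<Rightarrow> real" where
  "cube_mean \<omega> vs = integral (cbox 0 One) (\<lambda>x. \<omega> x vs)"

lemma integrable_cube: "smooth f \<Longrightarrow> f integrable_on cbox 0 One"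
  by (intro integrable_continuous smooth_continuous_on)

lemma cube_mean_const: "cube_mean (\<lambda>_. \<phi>) vs = \<phi> vs"
  by (simp add: cube_mean_def content_cbox_if mem_box box_ne_empty)

lemma cube_mean_lin:
  assumes "\<alpha> \<in> forms" "\<beta> \<in> forms"
  shows "cube_mean (\<lambda>x vs. a * \<alpha> x vs + b * \<beta> x vs) vs = a * cube_mean \<alpha> vs + b * cube_mean \<beta> vs"
  using integrable_cube[OF smooth_cmult[OF forms_smooth[OF assms(1)]], of a vs]
    integrable_cube[OF smooth_cmult[OF forms_smooth[OF assms(2)]], of b vs]
  by (simp add: cube_mean_def integral_add)

text \<open>The coefficients of an exact form are signed sums of directional derivatives of periodic
  functions. The directions are arbitrary, so linearity first reduces them to basis vectors, for
  which periodicity is available.\<close>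

lemma cube_mean_ext_d:
  fixes \<gamma> :: "'a::cubic_space form"
  assumes "\<gamma> \<in> forms"
  shows "cube_mean (ext_d \<gamma>) vs = 0"
proof -
  have z: "integral (cbox 0 One) (deriv_along v (\<lambda>x. \<gamma> x us)) = 0" for v us
  proof -
    let ?f = "\<lambda>x. \<gamma> x us"
    note f = forms_smooth[OF assms, of us]
    note int = integrable_cube[OF smooth_deriv_along[OF f]]
    have "linear (\<lambda>v. integral (cbox 0 One) (deriv_along v ?f))"
      by (rule linearI) (simp_all add: linear_add[OF smooth_linear_deriv[OF f]]
          linear_scale[OF smooth_linear_deriv[OF f]] integral_add[OF int int])
    moreover have "integral (cbox 0 One) (deriv_along b ?f) = 0" if "b \<in> Basis" for b
      using that Basis_lattice forms_periodic[OF assms]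
      by (intro integral_cube_deriv[OF f]) auto
    ultimately have "(\<lambda>v. integral (cbox 0 One) (deriv_along v ?f)) = (\<lambda>v. 0)"
      using linear_eq_stdbasis linear_zero by blast
    then show ?thesis by metis
  qed
  have sm: "smooth (\<lambda>x. (-1) ^ i * frechet_derivative (\<lambda>y. \<gamma> y us) (at x) v)" for i :: nat and us v
    by (rule smooth_cmult[OF smooth_deriv_along[OF forms_smooth[OF assms]]])
  have "cube_mean (ext_d \<gamma>) vs = (\<Sum>i<length vs. integral (cbox 0 One)
      (\<lambda>x. (-1) ^ i * frechet_derivative (\<lambda>y. \<gamma> y (nths vs (- {i}))) (at x) (vs ! i)))"
    unfolding cube_mean_def ext_d_def
    by (rule integral_sum) (simp, rule integrable_cube, rule sm)
  then show ?thesis by (simp add: z)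
qed

lemma cube_mean_cohomologous:
  fixes \<alpha> :: "'a::cubic_space form"
  assumes "cohomologous \<alpha> \<beta>"
  shows "cube_mean \<alpha> = cube_mean \<beta>"
proof (rule ext)
  fix vs
  obtain \<gamma> where g: "\<gamma> \<in> forms" "\<And>x vs. \<alpha> x vs - \<beta> x vs = ext_d \<gamma> x vs"
    using assms unfolding cohomologous_def by blast
  have "\<alpha> \<in> forms" "\<beta> \<in> forms"
    using assms by (auto simp: cohomologous_def closed_forms_def)
  from cube_mean_lin[OF this, of 1 "-1" vs] cube_mean_ext_d[OF g(1), of vs]
  show "cube_mean \<alpha> vs = cube_mean \<beta> vs"
    by (simp add: g(2)[symmetric, abs_def])
qed

section \<open>The cohomology algebra of the torus\<close>

lemma abs_coh_eq: "cohomologous \<alpha> \<beta> \<Longrightarrow> abs_coh \<alpha> = abs_coh \<beta>"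
  by (rule Quotient3_rel_abs[OF Quotient3_coh])

lemma cohomologous_rep_abs: "\<omega> \<in> closed_forms \<Longrightarrow> cohomologous (rep_coh (abs_coh \<omega>)) \<omega>"
  by (rule Quotient3_rep_abs[OF Quotient3_coh cohomologous_refl])

lemma abs_rep_coh: "abs_coh (rep_coh a) = a"
  by (rule Quotient3_abs_rep[OF Quotient3_coh])

lemma rep_coh_closed: "rep_coh a \<in> closed_forms"
  using Quotient3_rep_reflp[OF Quotient3_coh, of a] by (simp add: cohomologous_def)

text \<open>
  Exact forms have mean zero, so the mean of any representative is the constant representative.
\<close>

definition harmonic :: "'a::cubic_space coh \<Rightarrow> 'a list \<Rightarrow> real" where
  "harmonic a = cube_mean (rep_coh a)"

definition cls :: "('a::cubic_space list \<Rightarrow> real) \<Rightarrow> 'a coh" where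
  "cls \<phi> = abs_coh (\<lambda>_. \<phi>)"

lemma harmonic_abs: "\<omega> \<in> closed_forms \<Longrightarrow> harmonic (abs_coh \<omega>) = cube_mean \<omega>"
  unfolding harmonic_def by (rule cube_mean_cohomologous[OF cohomologous_rep_abs])

lemma harmonic_cls: "alternating \<phi> \<Longrightarrow> harmonic (cls \<phi>) = \<phi>"
  by (simp add: cls_def harmonic_abs const_closed cube_mean_const[abs_def])

lemma coh_cases:
  obtains \<phi> where "alternating \<phi>" "a = cls \<phi>"
proof -
  obtain \<phi> where "alternating \<phi>" "cohomologous (rep_coh a) (\<lambda>_. \<phi>)"
    by (rule closed_form_cohomologous_const[OF rep_coh_closed])
  then show thesis
    using that[of \<phi>] abs_coh_eq abs_rep_coh unfolding cls_def by metis
qed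

lemma alternating_harmonic: "alternating (harmonic a)"
  by (cases a rule: coh_cases) (simp add: harmonic_cls)

lemma cls_harmonic: "cls (harmonic a) = a"
  by (cases a rule: coh_cases) (simp add: harmonic_cls)

lemma harmonic_inject: "harmonic a = harmonic b \<longleftrightarrow> a = b"
  by (metis cls_harmonic)

text \<open>Lets the operations defined through \<open>rep_coh\<close> be evaluated on constant
  forms instead.\<close>

lemma cohomologous_rep_harmonic: "cohomologous (rep_coh a) (\<lambda>_. harmonic a)"
  using cohomologous_rep_abs[OF const_closed[OF alternating_harmonic[of a]]] cls_harmonic[of a]
  by (simp add: cls_def)

lemma harmonic_add: "harmonic (a + b) = (\<lambda>vs. harmonic a vs + harmonic b vs)"
proof -
  have "a + b = abs_coh (\<lambda>x vs. rep_coh a x vs + rep_coh b x vs)"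
    using plus_coh.abs_eq[OF cohomologous_refl cohomologous_refl, OF rep_coh_closed rep_coh_closed, of a b]
    by (simp add: abs_rep_coh)
  then show ?thesis
    using harmonic_abs[OF closed_forms_lin[OF rep_coh_closed[of a] rep_coh_closed[of b], of 1 1]]
      cube_mean_lin[OF closed_forms_forms[OF rep_coh_closed[of a]] closed_forms_forms[OF rep_coh_closed[of b]], of 1 1]
    by (simp add: harmonic_def fun_eq_iff)
qed

lemma harmonic_scaleR: "harmonic (r *\<^sub>R a) = (\<lambda>vs. r * harmonic a vs)"
proof -
  have "r *\<^sub>R a = abs_coh (\<lambda>x vs. r * rep_coh a x vs)"
    using scaleR_coh.abs_eq[OF cohomologous_refl, OF rep_coh_closed, of r a]
    by (simp add: abs_rep_coh)
  then show ?thesis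
    using harmonic_abs[OF closed_forms_lin[OF rep_coh_closed[of a] rep_coh_closed[of a], of r 0]]
      cube_mean_lin[OF closed_forms_forms[OF rep_coh_closed[of a]] closed_forms_forms[OF rep_coh_closed[of a]], of r 0]
    by (simp add: harmonic_def fun_eq_iff)
qed

lemma harmonic_zero: "harmonic 0 = (\<lambda>vs. 0)"
  using harmonic_scaleR[of 0 0] by simp

lemma harmonic_minus: "harmonic (- a) = (\<lambda>vs. - harmonic a vs)"
  using harmonic_scaleR[of "-1" a] by simp

lemma harmonic_diff: "harmonic (a - b) = (\<lambda>vs. harmonic a vs - harmonic b vs)"
  using harmonic_add[of a "- b"] by (simp add: harmonic_minus)

lemma harmonic_sum: "harmonic (sum f A) vs = (\<Sum>i\<in>A. harmonic (f i) vs)"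
  by (induction A rule: infinite_finite_induct) (simp_all add: harmonic_zero harmonic_add)

lemma harmonic_cup: "harmonic (a \<smile> b) = shuffle (harmonic a) (harmonic b)"
proof -
  have "cohomologous (wedge (rep_coh a) (rep_coh b)) (\<lambda>_. shuffle (harmonic a) (harmonic b))"
    using cohomologous_wedge[OF cohomologous_rep_harmonic cohomologous_rep_harmonic, of a b]
    by (simp add: wedge_eq_shuffle_fun)
  then have "a \<smile> b = cls (shuffle (harmonic a) (harmonic b))"
    unfolding cup_def cls_def by (rule abs_coh_eq)
  then show ?thesis by (simp add: harmonic_cls alternating_shuffle alternating_harmonic)
qed

lemma coh_one_eq: "coh_one = cls unit_form"
  by (simp add: coh_one_def cls_def fun_form_def unit_form_def[abs_def])

text \<open>The algebra laws are inherited from the shuffle product through \<open>harmonic\<close>;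
  afterwards the general ring rules apply to cohomology classes.\<close>

instantiation coh :: (cubic_space) real_algebra_1
begin

definition times_coh :: "'a coh \<Rightarrow> 'a coh \<Rightarrow> 'a coh" where "a * b = a \<smile> b"

definition one_coh :: "'a coh" where "1 = coh_one"

instance
proof
  fix a b c :: "'a coh" and r :: real
  have one: "harmonic (coh_one :: 'a coh) = unit_form"
    by (simp add: coh_one_eq harmonic_cls alternating_unit_form)
  note h = times_coh_def one_coh_def harmonic_inject[symmetric] harmonic_cup harmonic_add harmonic_scaleR one
  show "a * b * c = a * (b * c)" by (simp add: h shuffle_assoc)
  show "(a + b) * c = a * c + b * c" by (simp add: h shuffle_add_left)
  show "a * (b + c) = a * b + a * c" by (simp add: h shuffle_add_right)
  show "(r *\<^sub>R a) * b = r *\<^sub>R (a * b)" by (simp add: h shuffle_scale_left)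
  show "a * (r *\<^sub>R b) = r *\<^sub>R (a * b)" by (simp add: h shuffle_scale_right)
  show "1 * a = a" by (simp add: h shuffle_unit_left)
  show "a * 1 = a" by (simp add: h shuffle_unit_right)
  show "0 \<noteq> (1 :: 'a coh)"
    by (simp add: h harmonic_zero fun_eq_iff unit_form_def)
qed

end

lemma harmonic_times: "harmonic (a * b) = shuffle (harmonic a) (harmonic b)"
  by (simp add: times_coh_def harmonic_cup)

lemma harmonic_one: "harmonic 1 = unit_form"
  by (simp add: one_coh_def coh_one_eq harmonic_cls alternating_unit_form)

lemma coh_eqI:
  assumes "span (set bs) = UNIV" "distinct bs" "\<And>us. us \<in> set (subseqs bs) \<Longrightarrow> harmonic a us = harmonic b us"
  shows "a = b"
  using alternating_eqI[OF alternating_harmonic alternating_harmonic assms] by (simp add: harmonic_inject)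

text \<open>A constant form does not see the translation part of \<open>f\<close>. This is why the
  four inclusions, which differ by translations, induce the same map.\<close>

lemma harmonic_coh_pull:
  assumes "torus_map f A"
  shows "harmonic (coh_pull f a) = (\<lambda>vs. harmonic a (map A vs))"
proof -
  have "cohomologous (pullback f (rep_coh a)) (\<lambda>_ vs. harmonic a (map A vs))"
    using cohomologous_pullback[OF assms cohomologous_rep_harmonic, of a]
    by (simp add: pullback_torus_map[OF assms, of "\<lambda>_. harmonic a"])
  then have "coh_pull f a = cls (\<lambda>vs. harmonic a (map A vs))"
    unfolding coh_pull_def cls_def by (rule abs_coh_eq)
  moreover have "linear A" using assms by (simp add: torus_map_def)
  ultimately show ?thesis
    by (simp add: harmonic_cls alternating_map alternating_harmonic)
qed

lemma coh_pull_hom: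
  assumes "torus_map f A"
  shows "coh_pull f (a + b) = coh_pull f a + coh_pull f b"
    "coh_pull f (r *\<^sub>R a) = r *\<^sub>R coh_pull f a"
    "coh_pull f (a * b) = coh_pull f a * coh_pull f b"
    "coh_pull f 1 = 1" "coh_pull f 0 = 0" "coh_pull f (- a) = - coh_pull f a"
    "coh_pull f (a - b) = coh_pull f a - coh_pull f b"
proof -
  have "shuffle (\<lambda>us. harmonic a (map A us)) (\<lambda>us. harmonic b (map A us)) = (\<lambda>vs. shuffle (harmonic a) (harmonic b) (map A vs))"
    by (rule ext) (rule shuffle_map)
  then show "coh_pull f (a * b) = coh_pull f a * coh_pull f b"
    by (simp add: harmonic_inject[symmetric] harmonic_coh_pull[OF assms] harmonic_times)
  show "coh_pull f 1 = 1"
    by (simp add: harmonic_inject[symmetric] harmonic_coh_pull[OF assms] harmonic_one)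
      (simp add: unit_form_def[abs_def])
qed (simp_all add: harmonic_inject[symmetric] harmonic_coh_pull[OF assms] harmonic_add harmonic_scaleR
      harmonic_zero harmonic_minus harmonic_diff)

text \<open>Taking the mean preserves homogeneity, so the degree can be tested on the constant
  representative.\<close>

lemma mem_coh_deg: "a \<in> coh_deg k \<longleftrightarrow> (\<forall>vs. int (length vs) \<noteq> k \<longrightarrow> harmonic a vs = 0)"
proof
  assume "a \<in> coh_deg k"
  then obtain \<omega> where "a = abs_coh \<omega>" "\<omega> \<in> closed_forms" "homogeneous k \<omega>"
    by (auto simp: coh_deg_def)
  then show "\<forall>vs. int (length vs) \<noteq> k \<longrightarrow> harmonic a vs = 0"
    by (simp add: harmonic_abs cube_mean_def homogeneous_def)
next
  assume "\<forall>vs. int (length vs) \<noteq> k \<longrightarrow> harmonic a vs = 0"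
  then have "homogeneous k (\<lambda>_. harmonic a)" by (simp add: homogeneous_def)
  moreover have "a = abs_coh (\<lambda>_. harmonic a)" using cls_harmonic[of a] by (simp add: cls_def)
  ultimately show "a \<in> coh_deg k"
    using const_closed[OF alternating_harmonic[of a]] unfolding coh_deg_def by blast
qed

lemma subspace_coh_deg: "subspace (coh_deg k :: 'a::cubic_space coh set)"
  by (auto simp: subspace_def mem_coh_deg harmonic_add harmonic_scaleR harmonic_zero)

lemma coh_deg_times: "a \<in> coh_deg j \<Longrightarrow> b \<in> coh_deg k \<Longrightarrow> a * b \<in> coh_deg (j + k)"
  by (auto simp: mem_coh_deg harmonic_times intro: shuffle_homogeneous)

lemma coh_deg_one: "1 \<in> coh_deg 0"
  by (simp add: mem_coh_deg harmonic_one unit_form_def)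

lemma coh_deg_pull:
  fixes f :: "'a::cubic_space \<Rightarrow> 'b::cubic_space"
  shows "torus_map f A \<Longrightarrow> a \<in> coh_deg k \<Longrightarrow> coh_pull f a \<in> coh_deg k"
  by (simp add: mem_coh_deg harmonic_coh_pull)

definition coh_component :: "int \<Rightarrow> 'a::cubic_space coh \<Rightarrow> 'a coh" where
  "coh_component k a = cls (\<lambda>vs. if int (length vs) = k then harmonic a vs else 0)"

lemma harmonic_coh_component:
  "harmonic (coh_component k a) = (\<lambda>vs. if int (length vs) = k then harmonic a vs else 0)"
  by (simp add: coh_component_def harmonic_cls alternating_restrict alternating_harmonic)

definition covector :: "('a \<Rightarrow> real) \<Rightarrow> 'a list \<Rightarrow> real" where
  "covector l vs = (case vs of [v] \<Rightarrow> l v | _ \<Rightarrow> 0)"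

lemma alternating_covector:
  assumes "linear l"
  shows "alternating (covector l)"
proof -
  have "covector l (us @ v # ws) = (if us = [] \<and> ws = [] then l v else 0)" for us v ws
    by (cases us; cases ws) (auto simp: covector_def split: list.split)
  moreover have "linear (\<lambda>v. if us = [] \<and> ws = [] then l v else 0)" for us ws :: "'a list"
    using assms by (cases "us = [] \<and> ws = []") (auto simp: linear_zero)
  ultimately show ?thesis
    by (intro alternatingI) (simp_all add: covector_def split: list.split)
qed

text \<open>A linear function is in general not periodic, so \<open>fun_form l\<close> need not lie
  in \<open>forms\<close>, and its differential is evaluated directly.\<close>

lemma ext_d_fun_form_linear:
  assumes "linear (l :: 'a::periodic_space \<Rightarrow> real)"
  shows "ext_d (fun_form l) = (\<lambda>_. covector l)"
proof (intro ext)
  fix x vs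
  have "(l has_derivative l) (at x)"
    using assms by (simp add: bounded_linear_imp_has_derivative linear_conv_bounded_linear)
  then have D: "frechet_derivative l (at x) = l"
    by (rule frechet_derivative_at[symmetric])
  show "ext_d (fun_form l) x vs = covector l vs"
  proof (cases vs)
    case (Cons v ws)
    have "contract v (fun_form l y) = (\<lambda>_. 0)" for y
      by (simp add: contract_def fun_form_def)
    moreover have "frechet_derivative (\<lambda>y. fun_form l y ws) (at x) v = (if ws = [] then l v else 0)"
      by (simp add: fun_form_def D)
    ultimately show ?thesis
      using Cons by (simp add: ext_d_Cons ext_d_zero covector_def split: list.split)
  qed (simp add: ext_d_Nil covector_def)
qed

lemma harmonic_linear_form: "linear l \<Longrightarrow> harmonic (abs_coh (ext_d (fun_form l))) = covector l"
  using harmonic_cls[OF alternating_covector] by (simp add: ext_d_fun_form_linear cls_def)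

section \<open>The abelian surface and the fixed tori\<close>

definition incl_lin :: "L \<Rightarrow> X" where
  "incl_lin p = (of_real (fst p), of_real (snd p))"

definition proj :: "X \<Rightarrow> L" where
  "proj z = (Re (fst z), Re (snd z))"

text \<open>The index is an arbitrary choice, by \<open>coh_pull_incl\<close>.\<close>

definition res :: "X coh \<Rightarrow> L coh" where
  "res = coh_pull (incl (False, False))"

definition lift :: "L coh \<Rightarrow> X coh" where
  "lift = coh_pull proj"

lemma torus_map_incl: "torus_map (incl \<epsilon>) incl_lin"
proof (rule torus_mapI)
  show "linear incl_lin"
    by (rule linearI) (simp_all add: incl_lin_def scaleR_conv_of_real)
  show "incl_lin ` period_lattice \<subseteq> period_lattice"
    by (auto simp: incl_lin_def period_lattice_prod_def period_lattice_complex_def period_lattice_real_def)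
  show "incl \<epsilon> p = incl_lin p + (Complex 0 (of_bool (fst \<epsilon>) / 2), Complex 0 (of_bool (snd \<epsilon>) / 2))" for p
    by (simp add: incl_def incl_lin_def complex_eq_iff split: prod.split)
qed

lemma torus_map_proj: "torus_map proj proj"
proof (rule torus_mapI)
  show "linear proj"
    by (rule linearI) (simp_all add: proj_def)
  show "proj ` period_lattice \<subseteq> period_lattice"
    by (auto simp: proj_def period_lattice_prod_def period_lattice_complex_def period_lattice_real_def)
  show "proj z = proj z + 0" for z by simp
qed

lemma torus_map_tau: "torus_map tau tau"
proof (rule torus_mapI)
  show "linear tau"
    by (rule linearI) (auto simp: tau_def complex_eq_iff)
  show "tau ` period_lattice \<subseteq> period_lattice"
    by (auto simp: tau_def period_lattice_prod_def period_lattice_complex_def)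
  show "tau z = tau z + 0" for z by simp
qed

lemma coh_pull_incl: "coh_pull (incl \<epsilon>) a = res a"
  by (simp add: res_def harmonic_inject[symmetric] harmonic_coh_pull[OF torus_map_incl])

lemma harmonic_res: "harmonic (res a) = (\<lambda>vs. harmonic a (map incl_lin vs))"
  by (simp add: res_def harmonic_coh_pull[OF torus_map_incl])

lemma harmonic_lift: "harmonic (lift \<eta>) = (\<lambda>vs. harmonic \<eta> (map proj vs))"
  by (simp add: lift_def harmonic_coh_pull[OF torus_map_proj])

lemmas res_hom = coh_pull_hom[OF torus_map_incl, of "(False, False)", folded res_def]

lemmas lift_hom = coh_pull_hom[OF torus_map_proj, folded lift_def]

lemma res_sum: "res (sum f A) = (\<Sum>i\<in>A. res (f i))"
  by (induction A rule: infinite_finite_induct) (simp_all add: res_hom)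

lemma lift_sum: "lift (sum f A) = (\<Sum>i\<in>A. lift (f i))"
  by (induction A rule: infinite_finite_induct) (simp_all add: lift_hom)

lemma res_lift: "res (lift \<eta>) = \<eta>"
  by (simp add: harmonic_inject[symmetric] harmonic_res harmonic_lift o_def incl_lin_def proj_def)

text \<open>Real directions come before imaginary ones, unlike in the oriented frame of
  \<open>integral_X\<close>. In every sublist the vectors tangent to the tori thus precede the fibre
  vectors, as in \<open>fibre_part\<close>; \<open>poincare_duality_X\<close> has to swap two
  vectors to pass between the orders.\<close>

lemma span_frame_X: "span (set [(1, 0), (0, 1), (\<i>, 0), (0, \<i>)] :: X set) = UNIV"
proof -
  have "set [(1, 0), (0, 1), (\<i>, 0), (0, \<i>)] = (Basis :: X set)"
    by (auto simp: Basis_prod_def Basis_complex_def)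
  then show ?thesis by (simp only: span_Basis)
qed

lemma span_frame_L: "span (set [(1, 0), (0, 1)] :: L set) = UNIV"
proof -
  have "set [(1, 0), (0, 1)] = (Basis :: L set)"
    by (auto simp: Basis_prod_def)
  then show ?thesis by (simp only: span_Basis)
qed

lemma X_coh_eqI:
  assumes "list_all (\<lambda>us. harmonic a us = harmonic b us) (subseqs [(1, 0), (0, 1), (\<i>, 0), (0, \<i>)])"
  shows "a = (b :: X coh)"
  by (rule coh_eqI[OF span_frame_X]) (use assms in \<open>auto simp only: list_all_iff, simp\<close>)

lemma L_coh_eqI:
  assumes "list_all (\<lambda>us. harmonic a us = harmonic b us) (subseqs [(1, 0), (0, 1)])"
  shows "a = (b :: L coh)"
  by (rule coh_eqI[OF span_frame_L]) (use assms in \<open>auto simp only: list_all_iff, simp\<close>)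

lemma integral_X_eq: "integral_X a = harmonic a [(1, 0), (\<i>, 0), (0, 1), (0, \<i>)]"
proof -
  have "(Complex 1 1, Complex 1 1) = (One :: X)"
    by (simp add: Basis_prod_def Basis_complex_def sum.union_disjoint prod_eq_iff complex_eq_iff)
  then show ?thesis
    by (simp add: integral_X_def harmonic_def cube_mean_def zero_prod_def)
qed

lemma integral_L_eq: "integral_L \<eta> = harmonic \<eta> [(1, 0), (0, 1)]"
proof -
  have "(1, 1) = (One :: L)"
    by (simp add: Basis_prod_def sum.union_disjoint prod_eq_iff)
  then show ?thesis
    by (simp add: integral_L_def harmonic_def cube_mean_def zero_prod_def)
qed

lemma integral_X_hom:
  "integral_X (a + b) = integral_X a + integral_X b" "integral_X (r *\<^sub>R a) = r * integral_X a"
  "integral_X 0 = 0" "integral_X (a - b) = integral_X a - integral_X b"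
  by (simp_all add: integral_X_eq harmonic_add harmonic_scaleR harmonic_zero harmonic_diff)

section \<open>Coordinate classes and multiplication by \<open>P_cl\<close>\<close>

definition u1 :: "L coh" where "u1 = abs_coh (ext_d (fun_form fst))"
definition u2 :: "L coh" where "u2 = abs_coh (ext_d (fun_form snd))"

lemma linear_coords:
  "linear (\<lambda>z::X. Re (fst z))" "linear (\<lambda>z::X. Im (fst z))"
  "linear (\<lambda>z::X. Re (snd z))" "linear (\<lambda>z::X. Im (snd z))"
  "linear (fst :: L \<Rightarrow> real)" "linear (snd :: L \<Rightarrow> real)"
  by (rule linearI; simp)+

lemma harmonic_coords:
  "harmonic x1 = covector (\<lambda>z. Re (fst z))" "harmonic y1 = covector (\<lambda>z. Im (fst z))"
  "harmonic x2 = covector (\<lambda>z. Re (snd z))" "harmonic y2 = covector (\<lambda>z. Im (snd z))"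
  "harmonic u1 = covector fst" "harmonic u2 = covector snd"
  unfolding x1_def y1_def x2_def y2_def u1_def u2_def
  by (rule harmonic_linear_form linear_coords)+

lemma covector_simps [simp]:
  "covector l [] = 0" "covector l [v] = l v" "covector l (v # w # vs) = 0"
  by (simp_all add: covector_def)

lemma covector_map: "covector l (map f vs) = covector (\<lambda>v. l (f v)) vs"
  by (simp add: covector_def split: list.split)

lemma lift_u: "lift u1 = x1" "lift u2 = x2"
  by (simp_all add: harmonic_inject[symmetric] harmonic_lift harmonic_coords covector_map proj_def)

lemma res_x: "res x1 = u1" "res x2 = u2"
  by (simp_all add: lift_u[symmetric] res_lift)

lemma P_cl_eq: "P_cl = - (y1 * y2)"
  by (simp add: P_cl_def times_coh_def)

lemma shuffle_covector:
  "shuffle (covector l) (covector m) vs =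
     (case vs of [v, w] \<Rightarrow> l v * m w - l w * m v | _ \<Rightarrow> 0)"
proof (cases "length vs = 2")
  case True
  then obtain v w where "vs = [v, w]"
    by (metis (no_types, opaque_lifting) One_nat_def Suc_1 length_0_conv length_Suc_conv)
  then show ?thesis
    by (simp add: shuffle_Cons shuffle_Nil contract_def twist_def)
next
  case False
  then have "shuffle (covector l) (covector m) vs = 0"
    by (intro shuffle_homogeneous[of 1 _ 1]) (auto simp: covector_def split: list.split)
  with False show ?thesis by (auto split: list.split)
qed

lemma harmonic_P: "harmonic P_cl vs =
    (case vs of [v, w] \<Rightarrow> Im (fst w) * Im (snd v) - Im (fst v) * Im (snd w) | _ \<Rightarrow> 0)"
  by (simp add: P_cl_eq harmonic_minus harmonic_times harmonic_coords shuffle_covector split: list.split)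

lemma harmonic_P_simps [simp]:
  "harmonic P_cl [] = 0" "harmonic P_cl [v] = 0" "harmonic P_cl (v # w # u # vs) = 0"
  "harmonic P_cl [v, w] = Im (fst w) * Im (snd v) - Im (fst v) * Im (snd w)"
  by (simp_all add: harmonic_P)

lemmas shuffle_eval = shuffle_Nil shuffle_Cons contract_def twist_def

lemma res_P: "res P_cl = 0"
  by (auto simp: harmonic_inject[symmetric] harmonic_res harmonic_zero harmonic_P fun_eq_iff map_eq_Cons_conv incl_lin_def
      split: list.split)

text \<open>On a sublist of the frame \<open>P_cl\<close> is nonzero only if it receives both
  imaginary vectors. Then \<open>a\<close> receives real vectors only, where it agrees with
  \<open>lift (res a)\<close>.\<close>

lemma times_P_eq_lift: "a * P_cl = lift (res a) * P_cl"
  by (rule X_coh_eqI) (simp add: harmonic_times harmonic_lift harmonic_res shuffle_eval incl_lin_def proj_def)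

lemma P_times_eq_lift: "P_cl * a = lift (res a) * P_cl"
  by (rule X_coh_eqI) (simp add: harmonic_times harmonic_lift harmonic_res shuffle_eval incl_lin_def proj_def)

lemma P_commute: "P_cl * a = a * P_cl"
  using P_times_eq_lift times_P_eq_lift by simp

lemma P_P: "P_cl * P_cl = 0"
  using times_P_eq_lift[of P_cl] by (simp add: res_P lift_hom)

text \<open>The projection formula for the Gysin map in its explicit form: multiplying a
  pushed-forward class by \<open>a\<close> amounts to multiplying by the restriction of
  \<open>a\<close> before pushing forward.\<close>

lemma times_lift_P: "a * (lift \<eta> * P_cl) = lift (res a * \<eta>) * P_cl"
  using times_P_eq_lift[of "a * lift \<eta>"] by (simp add: res_hom res_lift mult.assoc)

lemma lift_P_times: "lift \<eta> * P_cl * a = lift (\<eta> * res a) * P_cl"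
  using times_P_eq_lift[of "lift \<eta> * a"] by (simp add: res_hom res_lift mult.assoc P_commute)

section \<open>Integration, Poincare duality and the Gysin map\<close>

lemma harmonic_Cons_zero:
  "harmonic a (0 # vs) = 0" "harmonic a (v # 0 # vs) = 0" "harmonic a (v # w # 0 # vs) = 0"
  "harmonic a (u # v # w # 0 # vs) = 0"
  using linear_0[OF alternating_linear[OF alternating_harmonic[of a], of "[]"]]
    linear_0[OF alternating_linear[OF alternating_harmonic[of a], of "[v]"]]
    linear_0[OF alternating_linear[OF alternating_harmonic[of a], of "[v, w]"]]
    linear_0[OF alternating_linear[OF alternating_harmonic[of a], of "[u, v, w]"]] by simp_all

text \<open>This fixes the sign of P: \<open>x1 x2 P = -x1 x2 y1 y2 = x1 y1 x2 y2\<close>, so a top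
  class on L keeps its integral.\<close>

lemma integral_X_lift_P: "integral_X (lift \<eta> * P_cl) = integral_L \<eta>"
  by (simp add: integral_X_eq integral_L_eq harmonic_times harmonic_lift shuffle_eval proj_def)

lemma integral_X_lift: "integral_X (lift \<eta>) = 0"
  by (simp add: integral_X_eq harmonic_lift proj_def harmonic_Cons_zero flip: zero_prod_def)

text \<open>Each monomial in the coordinate classes picks out one coefficient of \<open>c\<close>.\<close>

lemma poincare_duality_X:
  assumes "\<And>a. integral_X (a * c) = 0"
  shows "c = 0"
proof (rule X_coh_eqI)
  note e = integral_X_eq harmonic_times harmonic_one harmonic_coords shuffle_eval unit_form_def
  have 0: "harmonic c [(1, 0), (\<i>, 0), (0, 1), (0, \<i>)] = 0"
    using assms[of 1] by (simp add: e)
  have 1: "harmonic c [(1, 0), (\<i>, 0), (0, 1)] = 0" "harmonic c [(1, 0), (\<i>, 0), (0, \<i>)] = 0"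
    "harmonic c [(1, 0), (0, 1), (0, \<i>)] = 0" "harmonic c [(\<i>, 0), (0, 1), (0, \<i>)] = 0"
    using assms[of x1] assms[of y1] assms[of x2] assms[of y2] by (simp_all add: e)
  have 2: "harmonic c [(1, 0), (\<i>, 0)] = 0" "harmonic c [(1, 0), (0, 1)] = 0" "harmonic c [(1, 0), (0, \<i>)] = 0"
    "harmonic c [(\<i>, 0), (0, 1)] = 0" "harmonic c [(\<i>, 0), (0, \<i>)] = 0" "harmonic c [(0, 1), (0, \<i>)] = 0"
    using assms[of "x1 * y1"] assms[of "x1 * x2"] assms[of "x1 * y2"]
      assms[of "y1 * x2"] assms[of "y1 * y2"] assms[of "x2 * y2"] by (simp_all add: e)
  have 3: "harmonic c [(1, 0)] = 0" "harmonic c [(\<i>, 0)] = 0" "harmonic c [(0, 1)] = 0" "harmonic c [(0, \<i>)] = 0"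
    using assms[of "y1 * x2 * y2"] assms[of "x1 * x2 * y2"] assms[of "x1 * y1 * y2"]
      assms[of "x1 * y1 * x2"] by (simp_all add: e)
  have 4: "harmonic c [] = 0"
    using assms[of "x1 * y1 * x2 * y2"] by (simp add: e)
  have swap: "harmonic c (us @ (0, 1) # (\<i>, 0) # ws) = - harmonic c (us @ (\<i>, 0) # (0, 1) # ws)" for us ws
    by (rule alternating_swap[OF alternating_harmonic])
  note sw = swap[of "[]" "[]"] swap[of "[]" "[(0, \<i>)]"] swap[of "[(1, 0)]" "[]"] swap[of "[(1, 0)]" "[(0, \<i>)]"]
  show "list_all (\<lambda>us. harmonic c us = harmonic 0 us) (subseqs [(1, 0), (0, 1), (\<i>, 0), (0, \<i>)])"
    using 0 1 2 3 4 sw by (simp add: harmonic_zero)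
qed

text \<open>The product is only graded commutative, so both sides are recorded; they yield the two
  halves of \<open>nondegenerate_on\<close>. The test classes are 1, \<open>u1\<close>,
  \<open>u2\<close> and their product.\<close>

lemma poincare_duality_L:
  "(\<And>\<xi>. integral_L (\<eta> * \<xi>) = 0) \<Longrightarrow> \<eta> = 0" "(\<And>\<xi>. integral_L (\<xi> * \<eta>) = 0) \<Longrightarrow> \<eta> = 0"
proof -
  note e = integral_L_eq harmonic_times harmonic_one harmonic_coords shuffle_eval unit_form_def harmonic_zero
  show "\<eta> = 0" if "\<And>\<xi>. integral_L (\<eta> * \<xi>) = 0"
    by (rule L_coh_eqI) (use that[of 1] that[of u1] that[of u2] that[of "u1 * u2"] in \<open>simp add: e\<close>)
  show "\<eta> = 0" if "\<And>\<xi>. integral_L (\<xi> * \<eta>) = 0"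
    by (rule L_coh_eqI) (use that[of 1] that[of u1] that[of u2] that[of "u1 * u2"] in \<open>simp add: e\<close>)
qed

text \<open>The projection formula \<open>times_lift_P\<close> shows that the candidate satisfies
  the defining identity, and duality on X shows that it is the only one, which resolves the
  \<open>THE\<close>.\<close>

lemma gysin_eq: "gysin \<epsilon> \<eta> = lift \<eta> * P_cl"
  unfolding gysin_def times_coh_def[symmetric] coh_pull_incl
proof (rule the_equality)
  show eq: "\<forall>a. integral_X (a * (lift \<eta> * P_cl)) = integral_L (res a * \<eta>)"
    by (simp add: times_lift_P integral_X_lift_P)
  fix c assume c: "\<forall>a. integral_X (a * c) = integral_L (res a * \<eta>)"
  have "c - lift \<eta> * P_cl = 0"
    by (rule poincare_duality_X) (use c eq in \<open>simp add: right_diff_distrib integral_X_hom\<close>)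
  then show "c = lift \<eta> * P_cl" by simp
qed

section \<open>Invariant classes\<close>

lemma mem_inv_coh: "a \<in> inv_coh \<longleftrightarrow> (\<forall>vs. harmonic a (map tau vs) = harmonic a vs)"
  by (simp add: inv_coh_def harmonic_inject[symmetric] harmonic_coh_pull[OF torus_map_tau] fun_eq_iff)

lemma lift_inv: "lift \<eta> \<in> inv_coh"
  by (simp add: mem_inv_coh harmonic_lift o_def proj_def[abs_def] tau_def case_prod_beta)

lemma P_inv: "P_cl \<in> inv_coh"
  by (auto simp: mem_inv_coh harmonic_P tau_def map_eq_Cons_conv split: list.split)

lemma inv_coh_times: "a \<in> inv_coh \<Longrightarrow> b \<in> inv_coh \<Longrightarrow> a * b \<in> inv_coh"
  by (simp add: inv_coh_def coh_pull_hom[OF torus_map_tau])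

lemma subspace_inv_coh: "subspace inv_coh"
  by (simp add: subspace_def inv_coh_def coh_pull_hom[OF torus_map_tau])

text \<open>The component of degree \<open>2\<close> along the fibres of \<open>proj\<close>; the sign is that of \<open>P(\<partial>\<^sub>y\<^sub>1, \<partial>\<^sub>y\<^sub>2)\<close>.\<close>

definition fibre_part :: "X coh \<Rightarrow> L coh" where
  "fibre_part a = cls (\<lambda>vs. - harmonic a (map incl_lin vs @ [(\<i>, 0), (0, \<i>)]))"

lemma harmonic_fibre_part: "harmonic (fibre_part a) = (\<lambda>vs. - harmonic a (map incl_lin vs @ [(\<i>, 0), (0, \<i>)]))"
proof -
  have lin: "linear incl_lin" using torus_map_incl by (simp add: torus_map_def)
  have "alternating (\<lambda>vs. - harmonic a (map incl_lin vs @ [(\<i>, 0), (0, \<i>)]))"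
    unfolding alternating_def
  proof (intro conjI allI impI)
    show "linear (\<lambda>v. - harmonic a (map incl_lin (us @ v # ws) @ [(\<i>, 0), (0, \<i>)]))" for us ws
      using linear_compose[OF lin alternating_linear[OF alternating_harmonic[of a], of "map incl_lin us"
          "map incl_lin ws @ [(\<i>, 0), (0, \<i>)]"]]
      by (simp add: o_def linear_compose_neg)
    show "- harmonic a (map incl_lin vs @ [(\<i>, 0), (0, \<i>)]) = 0" if "\<not> distinct vs" for vs
      using that alternating_not_distinct[OF alternating_harmonic[of a]] by (simp add: distinct_map)
  qed
  then show ?thesis by (simp add: fibre_part_def harmonic_cls)
qed

text \<open>Invariance kills the values on sublists with exactly one imaginary vector. Those with
  none are recorded by \<open>res\<close>, those with two by \<open>fibre_part\<close>.\<close>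

lemma inv_coh_decomp:
  assumes "a \<in> inv_coh"
  shows "a = lift (res a) + lift (fibre_part a) * P_cl"
proof -
  have neg: "harmonic a (us @ (- v) # ws) = - harmonic a (us @ v # ws)" for us v ws
    using linear_neg[OF alternating_linear[OF alternating_harmonic[of a]]] .
  have neg': "harmonic a (us @ (- \<i>, 0) # ws) = - harmonic a (us @ (\<i>, 0) # ws)"
     "harmonic a (us @ (0, - \<i>) # ws) = - harmonic a (us @ (0, \<i>) # ws)" for us ws
    using neg[of us "(\<i>, 0)"] neg[of us "(0, \<i>)"] by simp_all
  note n = neg'[of "[]", simplified] neg'[of "[v]" for v, simplified] neg'[of "[v, w]" for v w, simplified]
  have inv: "harmonic a (map tau vs) = harmonic a vs" for vs
    using assms by (simp add: mem_inv_coh)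
  \<comment> \<open>The eight sublists with exactly one imaginary vector: there \<open>tau\<close>
    changes the sign of that vector only, so the value equals its own negative.\<close>
  note i = inv[of "[(\<i>, 0)]"] inv[of "[(0, \<i>)]"] inv[of "[(1, 0), (\<i>, 0)]"] inv[of "[(1, 0), (0, \<i>)]"]
    inv[of "[(0, 1), (\<i>, 0)]"] inv[of "[(0, 1), (0, \<i>)]"]
    inv[of "[(1, 0), (0, 1), (\<i>, 0)]"] inv[of "[(1, 0), (0, 1), (0, \<i>)]"]
  show ?thesis
    by (rule X_coh_eqI) (use i in \<open>simp add: n harmonic_add harmonic_times harmonic_lift harmonic_res harmonic_fibre_part
        shuffle_eval incl_lin_def proj_def tau_def harmonic_Cons_zero flip: zero_prod_def\<close>)
qed

lemma inv_coh_eq: "inv_coh = {lift \<eta> + lift \<xi> * P_cl | \<eta> \<xi>. True}"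
  using inv_coh_decomp lift_inv P_inv inv_coh_times subspace_add[OF subspace_inv_coh] by auto

text \<open>Injectivity of the Gysin map: multiplying by \<open>lift \<eta>\<close> and integrating
  gives the pairing of \<xi> with \<eta> on L.\<close>

lemma lift_P_eq_0_iff: "lift \<xi> * P_cl = 0 \<longleftrightarrow> \<xi> = 0"
proof
  assume "lift \<xi> * P_cl = 0"
  then have "integral_L (\<xi> * \<eta>) = 0" for \<eta>
    using integral_X_lift_P[of "\<xi> * \<eta>"] lift_P_times[of \<xi> "lift \<eta>"]
    by (simp add: res_lift integral_X_hom)
  then show "\<xi> = 0" by (rule poincare_duality_L)
qed (simp add: lift_hom)

lemma inv_coh_eq_iff:
  "lift \<eta> + lift \<xi> * P_cl = lift \<eta>' + lift \<xi>' * P_cl \<longleftrightarrow> \<eta> = \<eta>' \<and> \<xi> = \<xi>'"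
proof
  assume eq: "lift \<eta> + lift \<xi> * P_cl = lift \<eta>' + lift \<xi>' * P_cl"
  have "\<eta> = \<eta>'"
    using arg_cong[OF eq, of res] by (simp add: res_hom res_lift res_P)
  with eq have "lift (\<xi> - \<xi>') * P_cl = 0" by (simp add: lift_hom left_diff_distrib)
  with \<open>\<eta> = \<eta>'\<close> show "\<eta> = \<eta>' \<and> \<xi> = \<xi>'" by (simp add: lift_P_eq_0_iff)
qed simp

section \<open>Monomial bases\<close>

text \<open>Here a pair of truth values is an exponent vector; that the same type also indexes the
  tori is a coincidence. The lists \<open>coords\<close> are dual to these monomials.\<close>

definition u_mono :: "bool \<times> bool \<Rightarrow> L coh" where
  "u_mono s = (if fst s then u1 else 1) * (if snd s then u2 else 1)"

definition coords :: "bool \<times> bool \<Rightarrow> L list" where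
  "coords s = (if fst s then [(1, 0)] else []) @ (if snd s then [(0, 1)] else [])"

lemma UNIV_bool2: "(UNIV :: (bool \<times> bool) set) = {(False, False), (True, False), (False, True), (True, True)}"
  by (auto simp: UNIV_bool UNIV_Times_UNIV[symmetric] simp del: UNIV_Times_UNIV)

lemma harmonic_u_mono: "harmonic (u_mono s) (coords t) = (if s = t then 1 else 0)"
  by (cases s; cases t; cases "fst s"; cases "snd s"; cases "fst t"; cases "snd t")
    (simp_all add: u_mono_def coords_def harmonic_times harmonic_one harmonic_coords shuffle_eval unit_form_def)

lemma u_mono_expansion: "\<eta> = (\<Sum>s\<in>UNIV. harmonic \<eta> (coords s) *\<^sub>R u_mono s)"
proof (rule L_coh_eqI)
  have "harmonic \<eta> (coords t) = harmonic (\<Sum>s\<in>UNIV. harmonic \<eta> (coords s) *\<^sub>R u_mono s) (coords t)" for t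
    by (simp add: harmonic_sum harmonic_scaleR harmonic_u_mono if_distrib cong: if_cong)
  from this[of "(False, False)"] this[of "(True, False)"] this[of "(False, True)"] this[of "(True, True)"]
  show "list_all (\<lambda>us. harmonic \<eta> us = harmonic (\<Sum>s\<in>UNIV. harmonic \<eta> (coords s) *\<^sub>R u_mono s) us)
      (subseqs [(1, 0), (0, 1)])"
    by (simp add: coords_def)
qed

lemma u_mono_coeff: "harmonic (\<Sum>s\<in>UNIV. c s *\<^sub>R u_mono s) (coords t) = c t"
  by (simp add: harmonic_sum harmonic_scaleR harmonic_u_mono if_distrib cong: if_cong)

lemma u_mono_deg: "u_mono s \<in> coh_deg (of_bool (fst s) + of_bool (snd s))"
proof -
  have "u1 \<in> coh_deg 1" "u2 \<in> coh_deg 1"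
    by (auto simp: mem_coh_deg harmonic_coords covector_def split: list.split)
  then show ?thesis
    unfolding u_mono_def by (intro coh_deg_times) (auto simp: coh_deg_one)
qed

lemma u_squares: "u1 * u1 = 0" "u2 * u2 = 0" "u2 * u1 = - (u1 * u2)"
  by (auto simp: harmonic_inject[symmetric] harmonic_times harmonic_coords harmonic_zero harmonic_minus shuffle_covector
      fun_eq_iff split: list.split)

section \<open>Presentations by normal words\<close>

lemma ideal_left: "x \<in> two_sided_ideal S \<Longrightarrow> c * x \<in> two_sided_ideal S"
proof (induction rule: two_sided_ideal.induct)
  case (mult s a b)
  then show ?case using two_sided_ideal.mult[of s S "c * a" b] by (simp add: mult.assoc)
qed (simp_all add: two_sided_ideal.zero two_sided_ideal.add distrib_left)

lemma ideal_right: "x \<in> two_sided_ideal S \<Longrightarrow> x * c \<in> two_sided_ideal S"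
proof (induction rule: two_sided_ideal.induct)
  case (mult s a b)
  then show ?case using two_sided_ideal.mult[of s S a "b * c"] by (simp add: mult.assoc)
qed (simp_all add: two_sided_ideal.zero two_sided_ideal.add distrib_right)

lemma ideal_base: "s \<in> S \<Longrightarrow> s \<in> two_sided_ideal S"
  using two_sided_ideal.mult[of s S 1 1] by simp

lemma ideal_uminus: "x \<in> two_sided_ideal S \<Longrightarrow> - x \<in> two_sided_ideal S"
  using ideal_left[of x S "- 1"] by simp

lemma ideal_diff:
  "x \<in> two_sided_ideal S \<Longrightarrow> y \<in> two_sided_ideal S \<Longrightarrow> x - y \<in> two_sided_ideal S"
  using two_sided_ideal.add[OF _ ideal_uminus, of x S y] by simp

definition ideal_cong :: "'r::ring_1 set \<Rightarrow> 'r \<Rightarrow> 'r \<Rightarrow> bool" where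
  "ideal_cong S p q \<longleftrightarrow> p - q \<in> two_sided_ideal S"

lemma ideal_cong_refl: "ideal_cong S p p"
  by (simp add: ideal_cong_def two_sided_ideal.zero)

lemma ideal_cong_trans [trans]: "ideal_cong S p q \<Longrightarrow> ideal_cong S q r \<Longrightarrow> ideal_cong S p r"
  using two_sided_ideal.add[of "p - q" S "q - r"] by (simp add: ideal_cong_def)

lemma ideal_cong_left: "ideal_cong S p q \<Longrightarrow> ideal_cong S (c * p) (c * q)"
  using ideal_left[of "p - q" S c] by (simp add: ideal_cong_def right_diff_distrib)

lemma ideal_cong_right: "ideal_cong S p q \<Longrightarrow> ideal_cong S (p * c) (q * c)"
  using ideal_right[of "p - q" S c] by (simp add: ideal_cong_def left_diff_distrib)

lemma ideal_cong_base: "p - q \<in> S \<Longrightarrow> ideal_cong S p q"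
  by (simp add: ideal_cong_def ideal_base)

lemma ideal_cong_0_base: "p \<in> S \<Longrightarrow> ideal_cong S p 0"
  by (simp add: ideal_cong_def ideal_base)

lemma ideal_cong_add:
  "ideal_cong S p q \<Longrightarrow> ideal_cong S p' q' \<Longrightarrow> ideal_cong S (p + p') (q + q')"
  using two_sided_ideal.add[of "p - q" S "p' - q'"] by (simp add: ideal_cong_def algebra_simps)

section \<open>Words and scalars in the free algebra\<close>

definition word :: "'g list \<Rightarrow> 'g free_alg" where
  "word ws = Poly_Mapping.single (Mono ws) 1"

lemma word_Nil: "word [] = 1"
  by (simp add: word_def zero_mono_def[symmetric])

lemma word_append: "word (v @ w) = word v * word w"
  by (simp add: word_def mult_single plus_mono_def)

lemma gen_eq_word: "gen g = word [g]"
  by (simp add: gen_def word_def)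

lemma word_Cons: "word (g # ws) = gen g * word ws"
  using word_append[of "[g]" ws] by (simp add: gen_eq_word)

lemma scalar_word: "scalar r * word ws = Poly_Mapping.single (Mono ws) r"
  by (simp add: scalar_def word_def mult_single)

lemma free_alg_induct [case_names zero word add]:
  fixes p :: "'g free_alg"
  assumes "P 0" "\<And>r ws. P (scalar r * word ws)" "\<And>p q. P p \<Longrightarrow> P q \<Longrightarrow> P (p + q)"
  shows "P p"
proof -
  have w: "P (Poly_Mapping.single w r)" for w r
    using assms(2)[of r "letters w"] by (simp add: scalar_word)
  have "P (\<Sum>w\<in>A. Poly_Mapping.single w (Poly_Mapping.lookup p w))" if "finite A" for A
    using that by (induction A rule: finite_induct) (simp_all add: assms w)
  moreover have "(\<Sum>w\<in>Poly_Mapping.keys p. Poly_Mapping.single w (Poly_Mapping.lookup p w)) = p"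
    by (rule poly_mapping_eqI) (simp add: lookup_sum lookup_single when_def in_keys_iff)
  ultimately show ?thesis by (metis finite_keys)
qed

lemma scalar_one: "scalar 1 = 1" and scalar_zero: "scalar 0 = 0"
  and scalar_minus_one: "scalar (-1) = -1"
  by (simp_all add: scalar_def single_uminus)

lemma scalar_mult: "scalar (r * s) = scalar r * scalar s"
  by (simp add: scalar_def mult_single)

lemma scalar_add: "scalar (r + s) = scalar r + scalar s"
  by (simp add: scalar_def single_add)

lemma scalar_commute: "p * scalar r = scalar r * p"
proof (induction p rule: free_alg_induct)
  case (word s ws)
  show ?case by (simp add: scalar_word) (simp add: scalar_def mult_single mult.commute)
qed (simp_all add: distrib_left distrib_right)

context
  fixes B :: "'b::real_vector set" and m :: "'b \<Rightarrow> 'b \<Rightarrow> 'b" and u :: 'b and \<phi> :: "'g \<Rightarrow> 'b"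
  assumes alg: "unital_algebra B m u" and gens: "\<And>g. \<phi> g \<in> B"
begin

abbreviation ev :: "'g free_alg \<Rightarrow> 'b" where "ev \<equiv> free_eval m u \<phi>"

definition word_eval :: "'g list \<Rightarrow> 'b" where
  "word_eval ws = foldr (\<lambda>g. m (\<phi> g)) ws u"

text \<open>The algebra lives on a subset of its type, so every law is conditional on membership;
  \<open>word_eval_mem\<close> and \<open>ev_mem\<close> discharge the conditions.\<close>

lemma alg_facts:
  "subspace B" "u \<in> B"
  "a \<in> B \<Longrightarrow> m u a = a" "a \<in> B \<Longrightarrow> m a u = a" "a \<in> B \<Longrightarrow> b \<in> B \<Longrightarrow> m a b \<in> B"
  "a \<in> B \<Longrightarrow> b \<in> B \<Longrightarrow> c \<in> B \<Longrightarrow> m (m a b) c = m a (m b c)"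
  "a \<in> B \<Longrightarrow> b \<in> B \<Longrightarrow> c \<in> B \<Longrightarrow> m (a + b) c = m a c + m b c"
  "a \<in> B \<Longrightarrow> b \<in> B \<Longrightarrow> c \<in> B \<Longrightarrow> m c (a + b) = m c a + m c b"
  "a \<in> B \<Longrightarrow> c \<in> B \<Longrightarrow> m (r *\<^sub>R a) c = r *\<^sub>R m a c"
  "a \<in> B \<Longrightarrow> c \<in> B \<Longrightarrow> m c (r *\<^sub>R a) = r *\<^sub>R m c a"
  using alg unfolding unital_algebra_def bilinear_on_def by blast+

lemma word_eval_mem: "word_eval ws \<in> B"
  by (induction ws) (simp_all add: word_eval_def alg_facts gens)

lemma word_eval_append: "word_eval (v @ w) = m (word_eval v) (word_eval w)"
proof (induction v)
  case Nil
  then show ?case using word_eval_mem[of w] by (simp add: word_eval_def alg_facts)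
next
  case (Cons g v)
  have "word_eval ((g # v) @ w) = m (\<phi> g) (m (word_eval v) (word_eval w))"
    using Cons by (simp add: word_eval_def)
  then show ?case
    using alg_facts(6)[OF gens word_eval_mem word_eval_mem, of g v w] by (simp add: word_eval_def)
qed

lemma ev_eq_sum:
  assumes "finite A" "Poly_Mapping.keys p \<subseteq> A"
  shows "ev p = (\<Sum>w\<in>A. Poly_Mapping.lookup p w *\<^sub>R word_eval (letters w))"
  unfolding free_eval_def word_eval_def
  by (rule sum.mono_neutral_left) (use assms in \<open>auto simp: in_keys_iff\<close>)

lemma ev_add: "ev (p + q) = ev p + ev q"
proof -
  define A where "A = Poly_Mapping.keys p \<union> Poly_Mapping.keys q"
  have A: "finite A" "Poly_Mapping.keys p \<subseteq> A" "Poly_Mapping.keys q \<subseteq> A" "Poly_Mapping.keys (p + q) \<subseteq> A"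
    using keys_add[of p q] by (auto simp: A_def)
  show ?thesis
    unfolding ev_eq_sum[OF A(1,2)] ev_eq_sum[OF A(1,3)] ev_eq_sum[OF A(1,4)]
    by (simp add: lookup_add scaleR_add_left sum.distrib)
qed

lemma ev_word: "ev (scalar r * word ws) = r *\<^sub>R word_eval ws"
  by (simp add: scalar_word free_eval_def word_eval_def)

lemma ev_zero: "ev 0 = 0"
  by (simp add: free_eval_def)

lemma ev_mem: "ev p \<in> B"
  by (induction p rule: free_alg_induct)
    (simp_all add: ev_zero ev_add ev_word subspace_0 subspace_add subspace_scale alg_facts(1) word_eval_mem)

lemma ev_scalar_mult: "ev (scalar r * p) = r *\<^sub>R ev p"
proof (induction p rule: free_alg_induct)
  case (word s ws)
  show ?case using ev_word[of "r * s" ws] by (simp add: ev_word scalar_mult mult.assoc)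
qed (simp_all add: ev_zero ev_add distrib_left scaleR_add_right)

lemma ev_uminus: "ev (- p) = - ev p"
  using ev_scalar_mult[of "-1" p] by (simp add: scalar_minus_one)

lemma ev_diff: "ev (p - q) = ev p - ev q"
  using ev_add[of p "- q"] by (simp add: ev_uminus)

lemma ev_word_mult: "ev (word v * q) = m (word_eval v) (ev q)"
proof (induction q rule: free_alg_induct)
  case zero
  have "m (word_eval v) 0 = 0"
    using alg_facts(10)[OF alg_facts(2) word_eval_mem, of v 0] by simp
  then show ?case by (simp add: ev_zero)
next
  case (word r ws)
  have "word v * (scalar r * word ws) = scalar r * word (v @ ws)"
    by (simp add: word_append scalar_commute flip: mult.assoc)
  then show ?case
    by (simp add: ev_word word_eval_append alg_facts(10) word_eval_mem)
qed (simp add: ev_add distrib_left alg_facts(8) ev_mem word_eval_mem)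

lemma ev_mult: "ev (p * q) = m (ev p) (ev q)"
proof (induction p rule: free_alg_induct)
  case zero
  have "m 0 (ev q) = 0"
    using alg_facts(9)[OF alg_facts(2) ev_mem, of 0 q] by simp
  then show ?case by (simp add: ev_zero)
next
  case (word r ws)
  show ?case
    by (simp add: mult.assoc ev_scalar_mult ev_word_mult ev_word[of 1, simplified scalar_one, simplified]
        alg_facts(9) word_eval_mem ev_mem)
qed (simp add: ev_add distrib_right alg_facts(7) ev_mem)

lemma ev_gen: "ev (gen g) = \<phi> g"
  using ev_word[of 1 "[g]"] by (simp add: gen_eq_word scalar_one word_eval_def alg_facts gens)

lemma ev_one: "ev 1 = u"
  using ev_word[of 1 "[]"] by (simp add: word_Nil scalar_one word_eval_def)

lemma ev_scalar: "ev (scalar r) = r *\<^sub>R u"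
  using ev_scalar_mult[of r 1] by (simp add: ev_one)

lemma ev_sum: "ev (sum f A) = (\<Sum>i\<in>A. ev (f i))"
  by (induction A rule: infinite_finite_induct) (simp_all add: ev_zero ev_add)

lemma ev_ideal:
  assumes "\<And>s. s \<in> S \<Longrightarrow> ev s = 0" "p \<in> two_sided_ideal S"
  shows "ev p = 0"
  using assms(2)
proof (induction rule: two_sided_ideal.induct)
  case (mult s a b)
  have "ev (a * s * b) = ev (a * (0 * b))"
    by (simp only: ev_mult mult.assoc assms(1)[OF mult(1)] ev_zero)
  then show ?case by (simp add: ev_zero)
qed (simp_all add: ev_zero ev_add)

text \<open>
  If left multiplication by a generator maps normal words to multiples of normal words modulo the
  relations, then the normal words span the quotient; they are independent since their values are.
\<close>

lemma presented_algebraI: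
  fixes nf :: "'i::finite \<Rightarrow> 'g list"
  assumes rels: "\<And>s. s \<in> S \<Longrightarrow> ev s = 0"
    and nil: "nf i0 = []"
    and step: "\<And>g i. \<exists>j r. ideal_cong S (gen g * word (nf i)) (scalar r * word (nf j))"
    and val: "\<And>i. ev (word (nf i)) = v i"
    and indep: "\<And>c. (\<Sum>i\<in>UNIV. c i *\<^sub>R v i) = 0 \<Longrightarrow> c = (\<lambda>i. 0)"
    and span: "\<And>b. b \<in> B \<Longrightarrow> \<exists>c. b = (\<Sum>i\<in>UNIV. c i *\<^sub>R v i)"
  shows "presented_algebra B m u \<phi> S"
proof -
  have wd: "\<exists>j r. ideal_cong S (word ws) (scalar r * word (nf j))" for ws
  proof (induction ws)
    case Nil
    show ?case
      by (rule exI[of _ i0], rule exI[of _ 1]) (simp add: nil scalar_one ideal_cong_refl)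
  next
    case (Cons g ws)
    then obtain j r where 1: "ideal_cong S (word ws) (scalar r * word (nf j))" by blast
    obtain k s where 2: "ideal_cong S (gen g * word (nf j)) (scalar s * word (nf k))"
      using step by blast
    have "ideal_cong S (gen g * word ws) (gen g * (scalar r * word (nf j)))"
      by (rule ideal_cong_left[OF 1])
    also have "gen g * (scalar r * word (nf j)) = scalar r * (gen g * word (nf j))"
      by (simp only: scalar_commute[of "gen g" r] flip: mult.assoc)
    also have "ideal_cong S \<dots> (scalar r * (scalar s * word (nf k)))"
      by (rule ideal_cong_left[OF 2])
    finally show ?case
      by (metis word_Cons scalar_mult mult.assoc)
  qed
  have red: "\<exists>c. ideal_cong S p (\<Sum>i\<in>UNIV. scalar (c i) * word (nf i))" for p
  proof (induction p rule: free_alg_induct)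
    case zero
    show ?case by (rule exI[of _ "\<lambda>i. 0"]) (simp add: scalar_zero ideal_cong_refl)
  next
    case (word r ws)
    obtain j s where "ideal_cong S (word ws) (scalar s * word (nf j))" using wd by blast
    from ideal_cong_left[OF this, of "scalar r"]
    have "ideal_cong S (scalar r * word ws) (scalar (r * s) * word (nf j))"
      by (simp add: scalar_mult mult.assoc)
    moreover have "(\<Sum>i\<in>UNIV. scalar (if i = j then r * s else 0) * word (nf i))
        = (\<Sum>i\<in>UNIV. if i = j then scalar (r * s) * word (nf i) else 0)"
      by (rule sum.cong) (auto simp: scalar_zero)
    ultimately show ?case
      by (intro exI[of _ "\<lambda>i. if i = j then r * s else 0"]) simp
  next
    case (add p q)
    then obtain c d where "ideal_cong S p (\<Sum>i\<in>UNIV. scalar (c i) * word (nf i))"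
      "ideal_cong S q (\<Sum>i\<in>UNIV. scalar (d i) * word (nf i))" by blast
    from ideal_cong_add[OF this] show ?case
      by (intro exI[of _ "\<lambda>i. c i + d i"]) (simp add: scalar_add distrib_right sum.distrib)
  qed
  have evs: "ev (\<Sum>i\<in>UNIV. scalar (c i) * word (nf i)) = (\<Sum>i\<in>UNIV. c i *\<^sub>R v i)" for c
    by (simp add: ev_sum ev_scalar_mult val)
  have ideal0: "ev p = 0" if "p \<in> two_sided_ideal S" for p
    using ev_ideal[of S p] rels that by blast
  have "range ev = B"
    using ev_mem span evs by (auto simp: image_iff) metis
  moreover have "p \<in> two_sided_ideal S" if "ev p = 0" for p
  proof -
    obtain c where c: "ideal_cong S p (\<Sum>i\<in>UNIV. scalar (c i) * word (nf i))"
      using red by blast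
    then have "ev (p - (\<Sum>i\<in>UNIV. scalar (c i) * word (nf i))) = 0"
      unfolding ideal_cong_def by (rule ideal0)
    then have "c = (\<lambda>i. 0)" using that by (intro indep) (simp add: ev_diff evs)
    with c show ?thesis by (simp add: ideal_cong_def scalar_zero)
  qed
  ultimately show ?thesis
    using alg ideal0 unfolding presented_algebra_def by auto
qed

end

text \<open>Formulated in an arbitrary ring, so that it serves for normal words in a free algebra
  and for classes on X.\<close>

definition ext_mono :: "(ext_gen \<Rightarrow> 'r::ring_1) \<Rightarrow> bool \<times> bool \<Rightarrow> 'r" where
  "ext_mono X s = (if fst s then X X1 else 1) * (if snd s then X X2 else 1)"

definition ext_word :: "(ext_gen \<Rightarrow> 'g) \<Rightarrow> bool \<times> bool \<Rightarrow> 'g list" where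
  "ext_word X s = (if fst s then [X X1] else []) @ (if snd s then [X X2] else [])"

lemma word_ext_word: "word (ext_word X s) = ext_mono (\<lambda>k. gen (X k)) s"
  by (simp add: ext_word_def ext_mono_def word_append word_Nil gen_eq_word)

text \<open>The squares arise from the coefficients (1, 0) and (0, 1), anticommutativity by
  polarization from (1, 1).\<close>

lemma exterior_rels_cong:
  fixes X :: "ext_gen \<Rightarrow> 'g free_alg"
  assumes "exterior_rels X \<subseteq> S"
  shows "ideal_cong S (X X1 * X X1) 0" "ideal_cong S (X X2 * X X2) 0"
    "ideal_cong S (X X2 * X X1) (- (X X1 * X X2))"
proof -
  have r: "(scalar a * X X1 + scalar b * X X2) * (scalar a * X X1 + scalar b * X X2) \<in> two_sided_ideal S" for a b
    using assms by (intro ideal_base) (auto simp: exterior_rels_def)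
  have 1: "X X1 * X X1 \<in> two_sided_ideal S" "X X2 * X X2 \<in> two_sided_ideal S"
    using r[of 1 0] r[of 0 1] by (simp_all add: scalar_one scalar_zero)
  then show "ideal_cong S (X X1 * X X1) 0" "ideal_cong S (X X2 * X X2) 0"
    by (simp_all add: ideal_cong_def)
  have "(X X1 + X X2) * (X X1 + X X2) - X X1 * X X1 - X X2 * X X2 \<in> two_sided_ideal S"
    using r[of 1 1] 1 by (intro ideal_diff) (simp_all add: scalar_one)
  then show "ideal_cong S (X X2 * X X1) (- (X X1 * X X2))"
    by (simp add: ideal_cong_def algebra_simps)
qed

lemma ext_mono_step:
  fixes X :: "ext_gen \<Rightarrow> 'g free_alg"
  assumes "exterior_rels X \<subseteq> S"
  shows "\<exists>t r. ideal_cong S (X k * ext_mono X s) (scalar r * ext_mono X t)"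
proof -
  note rel = exterior_rels_cong[OF assms]
  obtain p q where s: "s = (p, q)" by fastforce
  \<comment> \<open>With scalar 0 the target monomial is irrelevant, hence
    \<open>undefined\<close>.\<close>
  have zero: "\<exists>t r. ideal_cong S x (scalar r * ext_mono X t)" if "ideal_cong S x 0" for x
    using that by (intro exI[of _ undefined] exI[of _ 0]) (simp add: scalar_zero)
  show ?thesis
  proof (cases k)
    case X1
    show ?thesis
    proof (cases p)
      case True
      then show ?thesis
        using ideal_cong_right[OF rel(1), of "if q then X X2 else 1"]
        by (intro zero) (simp add: s X1 ext_mono_def mult.assoc)
    next
      case False
      then show ?thesis
        by (intro exI[of _ "(True, q)"] exI[of _ 1]) (simp add: s X1 ext_mono_def scalar_one ideal_cong_refl)
    qed
  next
    case X2
    show ?thesis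
    proof (cases p)
      case True
      show ?thesis
      proof (cases q)
        case True
        have "ideal_cong S (X X2 * X X1 * X X2) (- (X X1 * X X2) * X X2)"
          by (rule ideal_cong_right[OF rel(3)])
        also have "- (X X1 * X X2) * X X2 = - (X X1) * (X X2 * X X2)"
          by (simp add: mult.assoc)
        also have "ideal_cong S \<dots> (- (X X1) * 0)"
          by (rule ideal_cong_left[OF rel(2)])
        finally show ?thesis
          using True \<open>p\<close> by (intro zero) (simp add: s X2 ext_mono_def mult.assoc)
      next
        case False
        then show ?thesis
          using rel(3) \<open>p\<close>
          by (intro exI[of _ "(True, True)"] exI[of _ "-1"]) (simp add: s X2 ext_mono_def scalar_minus_one)
      qed
    next
      case False
      show ?thesis
      proof (cases q)
        case True
        then show ?thesis
          using rel(2) False by (intro zero) (simp add: s X2 ext_mono_def)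
      next
        case False
        then show ?thesis
          using \<open>\<not> p\<close>
          by (intro exI[of _ "(False, True)"] exI[of _ 1]) (simp add: s X2 ext_mono_def scalar_one ideal_cong_refl)
      qed
    qed
  qed
qed

lemma ext_mono_commute:
  assumes "\<And>k. ideal_cong S (G * X k) (X k * G)"
  shows "ideal_cong S (G * ext_mono X s) (ext_mono X s * G)"
proof -
  have c: "ideal_cong S (G * (if b then X k else 1)) ((if b then X k else 1) * G)" for b k
    using assms[of k] by (simp add: ideal_cong_refl)
  let ?p = "if fst s then X X1 else 1" and ?q = "if snd s then X X2 else 1"
  have "ideal_cong S (G * ?p * ?q) (?p * G * ?q)"
    by (rule ideal_cong_right[OF c])
  also have "?p * G * ?q = ?p * (G * ?q)" by (simp only: mult.assoc)
  also have "ideal_cong S \<dots> (?p * (?q * G))"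
    by (rule ideal_cong_left[OF c])
  finally show ?thesis by (simp add: ext_mono_def mult.assoc)
qed

section \<open>Gradings from projections\<close>

text \<open>The projections themselves give a decomposition. Applying \<open>\<pi> j\<close> to any
  other one leaves only its component of degree \<open>j\<close>, which proves uniqueness.\<close>

lemma graded_decomposition:
  fixes \<pi> :: "nat \<Rightarrow> 'b::real_vector \<Rightarrow> 'b"
  assumes add: "\<And>k. linear (\<pi> k)"
    and mem: "\<And>k b. b \<in> B \<Longrightarrow> \<pi> k b \<in> D k"
    and deg: "\<And>j k d. d \<in> D k \<Longrightarrow> \<pi> j d = (if j = k then d else 0)"
    and zero: "\<And>k b. k > n \<Longrightarrow> \<pi> k b = 0"
    and sum: "\<And>b. (\<Sum>k\<le>n. \<pi> k b) = b"
    and "b \<in> B"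
  shows "\<exists>!c. (\<forall>k. c k \<in> D k) \<and> finite {k. c k \<noteq> 0} \<and> b = (\<Sum>k | c k \<noteq> 0. c k)"
proof (rule ex1I)
  let ?c = "\<lambda>k. \<pi> k b"
  have sub: "{k. ?c k \<noteq> 0} \<subseteq> {..n}" using zero by (auto simp: not_less[symmetric])
  have "(\<Sum>k | ?c k \<noteq> 0. ?c k) = (\<Sum>k\<le>n. ?c k)"
    by (rule sum.mono_neutral_left) (use sub in auto)
  then show "(\<forall>k. ?c k \<in> D k) \<and> finite {k. ?c k \<noteq> 0} \<and> b = (\<Sum>k | ?c k \<noteq> 0. ?c k)"
    using mem[OF \<open>b \<in> B\<close>] sum[of b] finite_subset[OF sub] by simp
next
  fix c assume c: "(\<forall>k. c k \<in> D k) \<and> finite {k. c k \<noteq> 0} \<and> b = (\<Sum>k | c k \<noteq> 0. c k)"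
  show "c = (\<lambda>k. \<pi> k b)"
  proof
    fix j
    have "\<pi> j b = (\<Sum>k | c k \<noteq> 0. \<pi> j (c k))"
      using c linear_sum[OF add, of j c "{k. c k \<noteq> 0}"] by auto
    also have "\<dots> = (\<Sum>k | c k \<noteq> 0. if j = k then c k else 0)"
      using c deg by (intro sum.cong) auto
    also have "\<dots> = c j" using c by auto
    finally show "c j = \<pi> j b" by simp
  qed
qed

context
  fixes v :: "'i::finite \<Rightarrow> 'b::real_vector"
  assumes indep: "\<And>c. (\<Sum>i\<in>UNIV. c i *\<^sub>R v i) = 0 \<Longrightarrow> c = (\<lambda>i. 0)"
begin

lemma dim_span_family: "dim (span (v ` A)) = card A"
proof -
  have inj: "inj v"
  proof (rule injI, rule ccontr)
    fix i j assume ij: "v i = v j" "i \<noteq> j"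
    let ?c = "\<lambda>k. (if k = i then 1 else 0) - (if k = j then 1 else (0::real))"
    have "(\<Sum>k\<in>UNIV. ?c k *\<^sub>R v k) = 0"
      using ij by (simp add: scaleR_diff_left sum_subtractf if_distrib[of "\<lambda>r. r *\<^sub>R _"] cong: if_cong)
    from fun_cong[OF indep[OF this], of i] ij show False by simp
  qed
  have "independent (v ` A)"
  proof
    assume "dependent (v ` A)"
    then obtain c w where c: "w \<in> v ` A" "c w \<noteq> 0" "(\<Sum>x\<in>v ` A. c x *\<^sub>R x) = 0"
      using dependent_finite[of "v ` A"] by auto
    have "(\<Sum>i\<in>UNIV. (if i \<in> A then c (v i) else 0) *\<^sub>R v i) = (\<Sum>i\<in>A. c (v i) *\<^sub>R v i)"
      by (simp add: if_distrib[of "\<lambda>r. r *\<^sub>R _"] sum.If_cases cong: if_cong)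
    also have "\<dots> = 0"
      using c(3) by (simp add: sum.reindex[OF inj_on_subset[OF inj]])
    finally have "(if i \<in> A then c (v i) else 0) = 0" for i
      by (rule fun_cong[OF indep])
    with c(1,2) show False by (metis imageE)
  qed
  then show ?thesis
    using dim_span_eq_card_independent card_image[OF inj_on_subset[OF inj]] by (metis subset_UNIV)
qed

text \<open>Projecting the expansion of an element of \<open>D k\<close> to degree \<open>k\<close>
  deletes all basis vectors of other degrees, so those of degree \<open>k\<close> span
  \<open>D k\<close>.\<close>

lemma dim_graded_piece:
  assumes span: "\<And>b. b \<in> B \<Longrightarrow> \<exists>c. b = (\<Sum>i\<in>UNIV. c i *\<^sub>R v i)"
    and deg: "\<And>i. v i \<in> D (deg i)" and D: "\<And>k. subspace (D k)" "\<And>k. D k \<subseteq> B"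
    and lin: "\<And>k. linear (\<pi> k)"
    and proj: "\<And>j k d. d \<in> D k \<Longrightarrow> \<pi> j d = (if j = k then d else 0)"
  shows "dim (D k) = card {i. deg i = k}"
proof -
  have "b \<in> span (v ` {i. deg i = k})" if b: "b \<in> D k" for b
  proof -
    obtain c where c: "b = (\<Sum>i\<in>UNIV. c i *\<^sub>R v i)" using span b D(2) by blast
    have "b = \<pi> k b" using proj[OF b] by simp
    also have "\<dots> = (\<Sum>i\<in>UNIV. c i *\<^sub>R \<pi> k (v i))"
      unfolding c by (simp add: linear_sum[OF lin] linear_scale[OF lin])
    also have "\<dots> = (\<Sum>i | deg i = k. c i *\<^sub>R v i)"
      by (rule sum.mono_neutral_cong_right) (auto simp: proj[OF deg])
    finally show ?thesis by (auto intro!: span_sum span_scale intro: span_base)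
  qed
  moreover have "span (v ` {i. deg i = k}) \<subseteq> D k"
    using deg by (intro span_minimal D(1)) auto
  ultimately have "D k = span (v ` {i. deg i = k})" by blast
  then show ?thesis using dim_span_family[of "{i. deg i = k}"] by metis
qed

end

section \<open>The orientifold product\<close>

lemma cup_eq: "((\<smile>) :: 'a::cubic_space coh \<Rightarrow> 'a coh \<Rightarrow> 'a coh) = (*)"
  by (intro ext) (simp add: times_coh_def)

lemma coh_one_eq_1: "coh_one = (1 :: 'a::cubic_space coh)"
  by (simp add: one_coh_def)

lemma star_eq:
  "\<alpha> \<star> \<beta> = (fst \<alpha> * fst \<beta> + (\<Sum>\<epsilon>\<in>UNIV. lift (snd \<alpha> $ \<epsilon> * snd \<beta> $ \<epsilon>) * P_cl),
     \<chi> \<epsilon>. res (fst \<alpha>) * snd \<beta> $ \<epsilon> + snd \<alpha> $ \<epsilon> * res (fst \<beta>))"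
  by (simp add: star_def cup_eq gysin_eq coh_pull_incl case_prod_beta)

lemma orient_eqI: "fst \<alpha> = fst \<beta> \<Longrightarrow> (\<And>\<epsilon>. snd \<alpha> $ \<epsilon> = snd \<beta> $ \<epsilon>) \<Longrightarrow> (\<alpha> :: orient) = \<beta>"
  by (simp add: prod_eq_iff vec_eq_iff)

lemma fst_star: "fst (\<alpha> \<star> \<beta>) = fst \<alpha> * fst \<beta> + (\<Sum>\<epsilon>\<in>UNIV. lift (snd \<alpha> $ \<epsilon> * snd \<beta> $ \<epsilon>) * P_cl)"
  and snd_star: "snd (\<alpha> \<star> \<beta>) $ \<epsilon> = res (fst \<alpha>) * snd \<beta> $ \<epsilon> + snd \<alpha> $ \<epsilon> * res (fst \<beta>)"
  by (simp_all add: star_eq)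

text \<open>In the ambient component the projection formula matches the terms. In a reflection
  component the terms that went through a Gysin map vanish because \<open>res P_cl = 0\<close>: the
  normal bundle of each torus is trivial.\<close>

lemma star_assoc: "\<alpha> \<star> \<beta> \<star> \<gamma> = \<alpha> \<star> (\<beta> \<star> \<gamma>)"
proof (rule orient_eqI)
  show "fst (\<alpha> \<star> \<beta> \<star> \<gamma>) = fst (\<alpha> \<star> (\<beta> \<star> \<gamma>))"
    by (simp only: fst_star snd_star distrib_left distrib_right sum_distrib_left sum_distrib_right
        lift_P_times times_lift_P lift_hom(1) sum.distrib)
      (simp only: mult.assoc add_ac)
  show "snd (\<alpha> \<star> \<beta> \<star> \<gamma>) $ \<epsilon> = snd (\<alpha> \<star> (\<beta> \<star> \<gamma>)) $ \<epsilon>" for \<epsilon>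
    by (simp add: fst_star snd_star distrib_left distrib_right mult.assoc add.assoc res_hom res_sum res_P)
qed

lemma star_bilinear:
  "(\<alpha> + \<beta>) \<star> \<gamma> = \<alpha> \<star> \<gamma> + \<beta> \<star> \<gamma>" "\<gamma> \<star> (\<alpha> + \<beta>) = \<gamma> \<star> \<alpha> + \<gamma> \<star> \<beta>"
  "(r *\<^sub>R \<alpha>) \<star> \<gamma> = r *\<^sub>R (\<alpha> \<star> \<gamma>)" "\<gamma> \<star> (r *\<^sub>R \<alpha>) = r *\<^sub>R (\<gamma> \<star> \<alpha>)"
  by (rule orient_eqI;
      simp add: fst_star snd_star distrib_left distrib_right add_ac scaleR_add_right lift_hom res_hom
        sum.distrib scaleR_sum_right)+

lemma star_amb: "amb a \<star> \<beta> = (a * fst \<beta>, \<chi> \<epsilon>. res a * snd \<beta> $ \<epsilon>)"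
  by (rule orient_eqI) (simp_all add: fst_star snd_star amb_def lift_hom)

lemma star_unit: "amb coh_one \<star> \<alpha> = \<alpha>" "\<alpha> \<star> amb coh_one = \<alpha>"
  by (rule orient_eqI; simp add: coh_one_eq_1 fst_star snd_star amb_def lift_hom res_hom)+

lemma unital_algebra_starI:
  assumes "subspace B" "amb coh_one \<in> B" "\<And>\<alpha> \<beta>. \<alpha> \<in> B \<Longrightarrow> \<beta> \<in> B \<Longrightarrow> \<alpha> \<star> \<beta> \<in> B"
  shows "unital_algebra B (\<star>) (amb coh_one)"
  using assms by (simp add: unital_algebra_def bilinear_on_def star_bilinear star_unit star_assoc)

lemma mem_orient_alg: "\<alpha> \<in> \<B> \<longleftrightarrow> fst \<alpha> \<in> inv_coh"
  by (simp add: orient_alg_def case_prod_beta)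

lemma one_inv: "1 \<in> inv_coh"
  using lift_inv[of 1] by (simp add: lift_hom)

lemma unital_algebra_inv: "unital_algebra inv_coh (\<smile>) coh_one"
  by (simp add: unital_algebra_def bilinear_on_def cup_eq coh_one_eq_1 subspace_inv_coh inv_coh_times
      one_inv distrib_left distrib_right mult.assoc)

lemma unital_algebra_orient: "unital_algebra \<B> (\<star>) (amb coh_one)"
proof (rule unital_algebra_starI)
  show "subspace \<B>"
    using subspace_inv_coh by (auto simp: subspace_def mem_orient_alg)
  show "amb coh_one \<in> \<B>"
    by (simp add: mem_orient_alg amb_def coh_one_eq_1 one_inv)
  show "\<alpha> \<star> \<beta> \<in> \<B>" if "\<alpha> \<in> \<B>" "\<beta> \<in> \<B>" for \<alpha> \<beta>
    using that by (auto simp: mem_orient_alg fst_star inv_coh_times lift_inv P_inv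
        intro!: subspace_add[OF subspace_inv_coh] subspace_sum[OF subspace_inv_coh])
qed

section \<open>The gradings\<close>

lemma linear_coh_component: "linear (coh_component k)"
  by (rule linearI) (auto simp: harmonic_inject[symmetric] harmonic_coh_component harmonic_add harmonic_scaleR)

lemma coh_component_mem: "coh_component k a \<in> coh_deg k"
  by (simp add: mem_coh_deg harmonic_coh_component)

lemma coh_component_deg: "a \<in> coh_deg k \<Longrightarrow> coh_component j a = (if j = k then a else 0)"
  by (auto simp: mem_coh_deg harmonic_inject[symmetric] harmonic_coh_component harmonic_zero fun_eq_iff)

lemma zero_coh_deg: "(0 :: 'a::cubic_space coh) \<in> coh_deg k"
  by (rule subspace_0[OF subspace_coh_deg])

lemma coh_component_inv: "a \<in> inv_coh \<Longrightarrow> coh_component k a \<in> inv_coh"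
  by (simp add: mem_inv_coh harmonic_coh_component)

lemma coh_component_X_zero: "k > 4 \<Longrightarrow> coh_component k (a :: X coh) = 0"
  by (rule X_coh_eqI) (simp add: harmonic_coh_component harmonic_zero)

lemma coh_component_L_zero: "k > 2 \<Longrightarrow> coh_component k (\<eta> :: L coh) = 0"
  by (rule L_coh_eqI) (simp add: harmonic_coh_component harmonic_zero)

text \<open>The bound 5 lies beyond the top degree 4 and is shared with the shifted sum on
  L.\<close>

lemma coh_component_X_sum: "(\<Sum>k\<le>5. coh_component (int k) a) = (a :: X coh)"
proof (rule X_coh_eqI)
  have "harmonic (\<Sum>k\<le>5. coh_component (int k) a) us = harmonic a us" if "length us \<le> 5" for us
    using that by (simp add: harmonic_sum harmonic_coh_component)
  then show "list_all (\<lambda>us. harmonic (\<Sum>k\<le>5. coh_component (int k) a) us = harmonic a us)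
      (subseqs [(1, 0), (0, 1), (\<i>, 0), (0, \<i>)])"
    by (simp del: One_nat_def)
qed

lemma coh_component_L_sum: "(\<Sum>k\<le>5. coh_component (int k - 1) \<eta>) = (\<eta> :: L coh)"
proof (rule L_coh_eqI)
  \<comment> \<open>By the shift, a list of length \<open>n\<close> is met by the summand
    \<open>k = n + 1\<close>; the summand \<open>k = 0\<close> has degree -1 and vanishes.\<close>
  have "int n = int k - 1 \<longleftrightarrow> Suc n = k" for n k by auto
  then have "harmonic (\<Sum>k\<le>5. coh_component (int k - 1) \<eta>) us = harmonic \<eta> us" if "length us \<le> 4" for us
    using that by (simp add: harmonic_sum harmonic_coh_component)
  then show "list_all (\<lambda>us. harmonic (\<Sum>k\<le>5. coh_component (int k - 1) \<eta>) us = harmonic \<eta> us)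
      (subseqs [(1, 0), (0, 1)])"
    by (simp del: One_nat_def)
qed

lemma graded_algebra_inv:
  "graded_algebra inv_coh (\<lambda>k. inv_coh \<inter> coh_deg (int k)) (\<smile>) coh_one"
  unfolding graded_algebra_def
proof (intro conjI allI ballI)
  show "unital_algebra inv_coh (\<smile>) coh_one" by (rule unital_algebra_inv)
  show "subspace (inv_coh \<inter> coh_deg (int k))" for k
    by (intro subspace_inter subspace_inv_coh subspace_coh_deg)
  show "coh_one \<in> inv_coh \<inter> coh_deg (int 0)"
    by (simp add: coh_one_eq_1 one_inv coh_deg_one)
  show "a \<smile> b \<in> inv_coh \<inter> coh_deg (int (j + k))"
    if "a \<in> inv_coh \<inter> coh_deg (int j)" "b \<in> inv_coh \<inter> coh_deg (int k)" for j k a b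
    using that by (simp add: cup_eq inv_coh_times coh_deg_times)
  show "\<exists>!c. (\<forall>k. c k \<in> inv_coh \<inter> coh_deg (int k)) \<and> finite {k. c k \<noteq> 0} \<and> b = (\<Sum>k | c k \<noteq> 0. c k)"
    if "b \<in> inv_coh" for b
  proof (rule graded_decomposition[where \<pi> = "\<lambda>k. coh_component (int k)" and n = 5 and B = inv_coh])
    show "coh_component (int j) d = (if j = k then d else 0)" if "d \<in> inv_coh \<inter> coh_deg (int k)" for j k d
      using that coh_component_deg[of d "int k" "int j"] by simp
  qed (use that in \<open>simp_all add: linear_coh_component coh_component_mem coh_component_inv
        coh_component_X_zero coh_component_X_sum\<close>)
qed auto

lemma mem_orient_deg:
  "\<alpha> \<in> orient_deg k \<longleftrightarrow> fst \<alpha> \<in> inv_coh \<and> fst \<alpha> \<in> coh_deg (int k) \<and> (\<forall>\<epsilon>. snd \<alpha> $ \<epsilon> \<in> coh_deg (int k - 1))"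
  by (simp add: orient_deg_def case_prod_beta)

definition orient_component :: "nat \<Rightarrow> orient \<Rightarrow> orient" where
  "orient_component k \<alpha> = (coh_component (int k) (fst \<alpha>), \<chi> \<epsilon>. coh_component (int k - 1) (snd \<alpha> $ \<epsilon>))"

lemma linear_orient_component: "linear (orient_component k)"
  by (rule linearI; rule orient_eqI)
    (simp_all add: orient_component_def linear_add[OF linear_coh_component] linear_scale[OF linear_coh_component])

lemma orient_component_deg:
  "\<alpha> \<in> orient_deg k \<Longrightarrow> orient_component j \<alpha> = (if j = k then \<alpha> else 0)"
  using coh_component_deg[of "fst \<alpha>" "int k" "int j"]
    coh_component_deg[of "snd \<alpha> $ \<epsilon>" "int k - 1" "int j - 1" for \<epsilon>]
  by (intro orient_eqI) (simp_all add: orient_component_def mem_orient_deg del: split_paired_All)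

lemma subspace_orient_deg: "subspace (orient_deg k)"
  using subspace_inv_coh subspace_coh_deg[of "int k", where 'a = X] subspace_coh_deg[of "int k - 1", where 'a = L]
  by (auto simp: subspace_def mem_orient_deg)

lemma P_deg: "P_cl \<in> coh_deg 2"
  by (auto simp: mem_coh_deg harmonic_P split: list.split)

lemma e_deg: "e_cl \<epsilon> \<in> orient_deg 1"
  using subspace_0[OF subspace_inv_coh]
  by (simp add: mem_orient_deg e_cl_def axis_def coh_one_eq_1 coh_deg_one zero_coh_deg)

text \<open>The shift by one is consistent because the Gysin map raises the degree by the
  codimension 2: \<open>(j - 1) + (k - 1) + 2 = j + k\<close>.\<close>

lemma star_deg:
  assumes "\<alpha> \<in> orient_deg j" "\<beta> \<in> orient_deg k"
  shows "\<alpha> \<star> \<beta> \<in> orient_deg (j + k)"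
proof -
  have a: "fst \<alpha> \<in> inv_coh" "fst \<alpha> \<in> coh_deg (int j)" "\<And>\<epsilon>. snd \<alpha> $ \<epsilon> \<in> coh_deg (int j - 1)"
    and b: "fst \<beta> \<in> inv_coh" "fst \<beta> \<in> coh_deg (int k)" "\<And>\<epsilon>. snd \<beta> $ \<epsilon> \<in> coh_deg (int k - 1)"
    using assms by (auto simp: mem_orient_deg)
  have "lift (snd \<alpha> $ \<epsilon> * snd \<beta> $ \<epsilon>) * P_cl \<in> coh_deg (int (j + k))" for \<epsilon>
    using coh_deg_times[OF coh_deg_pull[OF torus_map_proj coh_deg_times[OF a(3) b(3)]] P_deg, of \<epsilon> \<epsilon>]
    by (simp add: lift_def algebra_simps)
  moreover have "res (fst \<alpha>) * snd \<beta> $ \<epsilon> \<in> coh_deg (int (j + k) - 1)" for \<epsilon>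
    using coh_deg_times[OF coh_deg_pull[OF torus_map_incl a(2)] b(3), of "(False, False)" \<epsilon>]
    by (simp add: res_def algebra_simps)
  moreover have "snd \<alpha> $ \<epsilon> * res (fst \<beta>) \<in> coh_deg (int (j + k) - 1)" for \<epsilon>
    using coh_deg_times[OF a(3) coh_deg_pull[OF torus_map_incl b(2)], of \<epsilon> "(False, False)"]
    by (simp add: res_def algebra_simps)
  moreover have "fst \<alpha> * fst \<beta> \<in> coh_deg (int (j + k))"
    using coh_deg_times[OF a(2) b(2)] by simp
  moreover have "fst (\<alpha> \<star> \<beta>) \<in> inv_coh"
    using unital_algebra_orient a(1) b(1) by (auto simp: unital_algebra_def mem_orient_alg[symmetric])
  ultimately show ?thesis
    by (auto simp: mem_orient_deg snd_star)
      (auto simp: fst_star intro!: subspace_add[OF subspace_coh_deg] subspace_sum[OF subspace_coh_deg])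
qed

lemma graded_algebra_orient: "graded_algebra \<B> orient_deg (\<star>) (amb coh_one)"
  unfolding graded_algebra_def
proof (intro conjI allI ballI)
  show "unital_algebra \<B> (\<star>) (amb coh_one)" by (rule unital_algebra_orient)
  show "subspace (orient_deg k)" for k by (rule subspace_orient_deg)
  show "orient_deg k \<subseteq> \<B>" for k by (auto simp: mem_orient_deg mem_orient_alg)
  show "amb coh_one \<in> orient_deg 0"
    by (simp add: mem_orient_deg amb_def coh_one_eq_1 one_inv coh_deg_one zero_coh_deg)
  show "\<alpha> \<star> \<beta> \<in> orient_deg (j + k)" if "\<alpha> \<in> orient_deg j" "\<beta> \<in> orient_deg k" for j k \<alpha> \<beta>
    using that by (rule star_deg)
  show "\<exists>!c. (\<forall>k. c k \<in> orient_deg k) \<and> finite {k. c k \<noteq> 0} \<and> b = (\<Sum>k | c k \<noteq> 0. c k)"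
    if "b \<in> \<B>" for b
  proof (rule graded_decomposition[where \<pi> = orient_component and n = 5 and B = \<B>])
    show "orient_component k c \<in> orient_deg k" if "c \<in> \<B>" for k c
      using that by (simp add: orient_component_def mem_orient_deg mem_orient_alg coh_component_inv coh_component_mem)
    show "orient_component k c = 0" if "k > 5" for k c
      using that by (intro orient_eqI) (simp_all add: orient_component_def coh_component_X_zero coh_component_L_zero)
    show "(\<Sum>k\<le>5. orient_component k c) = c" for c
      by (rule orient_eqI) (simp_all add: orient_component_def fst_sum snd_sum
          coh_component_X_sum coh_component_L_sum)
  qed (use that in \<open>simp_all add: linear_orient_component orient_component_deg\<close>)
qed

section \<open>The presentation of the invariant ambient algebra\<close>

lemma sum_UNIV_prod: "(\<Sum>i\<in>UNIV. f i) = (\<Sum>t\<in>UNIV. \<Sum>s\<in>UNIV. f (s :: 'a::finite, t :: 'b::finite))"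
proof -
  have "(\<Sum>i\<in>UNIV. f i) = (\<Sum>s\<in>UNIV. \<Sum>t\<in>UNIV. f (s, t))"
    unfolding sum.cartesian_product by (rule sum.cong) auto
  also have "\<dots> = (\<Sum>t\<in>UNIV. \<Sum>s\<in>UNIV. f (s, t))" by (rule sum.swap)
  finally show ?thesis .
qed

lemma sum_UNIV_option: "(\<Sum>t\<in>UNIV. f t) = f None + (\<Sum>t\<in>UNIV. f (Some (t :: 'a::finite)))"
  unfolding UNIV_option_conv by (subst sum.insert) (auto simp: sum.reindex)

lemma sum_UNIV_bool: "(\<Sum>j\<in>UNIV. f j) = f False + f True"
  by (simp add: UNIV_bool)

definition u_comb :: "(bool \<times> bool \<Rightarrow> real) \<Rightarrow> L coh" where
  "u_comb c = (\<Sum>s\<in>UNIV. c s *\<^sub>R u_mono s)"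

lemma u_comb_eq_0: "u_comb c = 0 \<Longrightarrow> c s = 0"
  using u_mono_coeff[of c s] by (simp add: u_comb_def harmonic_zero)

lemma u_comb_surj: "\<exists>c. \<eta> = u_comb c"
  by (rule exI[of _ "\<lambda>s. harmonic \<eta> (coords s)"]) (simp only: u_comb_def u_mono_expansion[symmetric])

lemma x_squares: "x1 * x1 = 0" "x2 * x2 = 0" "x2 * x1 = - (x1 * x2)"
  unfolding lift_u[symmetric] lift_hom(3)[symmetric] u_squares by (simp_all add: lift_hom(5,6))

lemma x_square_zero: "(a *\<^sub>R x1 + b *\<^sub>R x2) * (a *\<^sub>R x1 + b *\<^sub>R x2) = 0"
  by (simp add: distrib_left distrib_right x_squares mult.commute)

lemma ext_class_lift: "ext_class k = lift (res (ext_class k))"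
  by (cases k) (simp_all add: res_x lift_u)

lemma lift_u_mono: "lift (u_mono s) = ext_mono ext_class s"
  by (simp add: u_mono_def ext_mono_def lift_hom lift_u)

lemma r0_class_inv: "r0_class g \<in> inv_coh"
proof (cases g)
  case (Ext k)
  then show ?thesis using lift_inv[of "res (ext_class k)"] by (simp add: ext_class_lift[symmetric])
qed (simp add: P_inv)

lemmas ev_simps = ev_mult ev_add ev_diff ev_scalar ev_gen ev_zero ev_one

text \<open>The normal words are \<open>x1^a x2^b P^c\<close> with exponents 0 or 1. Their values
  are independent by \<open>inv_coh_eq_iff\<close> and span by \<open>inv_coh_eq\<close>.\<close>

lemma r0_presentation: "presented_algebra inv_coh (\<smile>) coh_one r0_class (r0_rels gen)"
proof -
  note ev = ev_simps[OF unital_algebra_inv, of r0_class, OF r0_class_inv]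
  note ev' = ev[unfolded cup_eq coh_one_eq_1]
  let ?X = "\<lambda>k. gen (Ext k) :: r0_gen free_alg"
  let ?T = "\<lambda>j. if j then [PP] else []"
  show ?thesis
    unfolding cup_eq coh_one_eq_1
  proof (rule presented_algebraI[OF unital_algebra_inv[unfolded cup_eq coh_one_eq_1] r0_class_inv,
        where nf = "\<lambda>(s, j). ext_word Ext s @ ?T j" and ?i0.0 = "((False, False), False)"
          and v = "\<lambda>(s, j). lift (u_mono s) * (if j then P_cl else 1)"])
    fix s :: "r0_gen free_alg" assume "s \<in> r0_rels gen"
    then consider (ext) a b where "s = (scalar a * ?X X1 + scalar b * ?X X2) * (scalar a * ?X X1 + scalar b * ?X X2)"
      | (P) "s = gen PP * gen PP" | (comm) k where "s = ?X k * gen PP - gen PP * ?X k"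
      by (auto simp: r0_rels_def exterior_rels_def)
    then show "free_eval (*) 1 r0_class s = 0"
      by cases (simp_all add: ev' x_square_zero P_P P_commute[of "ext_class k" for k])
  next
    fix g :: r0_gen and i :: "(bool \<times> bool) \<times> bool"
    obtain s j where i: "i = (s, j)" by (cases i)
    have ext: "exterior_rels ?X \<subseteq> r0_rels gen" by (auto simp: r0_rels_def)
    show "\<exists>l r. ideal_cong (r0_rels gen) (gen g * word (case i of (s, j) \<Rightarrow> ext_word Ext s @ ?T j))
        (scalar r * word (case l of (s, j) \<Rightarrow> ext_word Ext s @ ?T j))"
    proof (cases g)
      case (Ext k)
      obtain t r where "ideal_cong (r0_rels gen) (?X k * ext_mono ?X s) (scalar r * ext_mono ?X t)"
        using ext_mono_step[OF ext] by blast
      from ideal_cong_right[OF this, of "word (?T j)"] show ?thesis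
        by (intro exI[of _ "(t, j)"] exI[of _ r]) (simp add: i Ext word_append word_ext_word mult.assoc)
    next
      case PP
      have c: "ideal_cong (r0_rels gen) (gen PP * ?X k) (?X k * gen PP)" for k
      proof -
        have "ideal_cong (r0_rels gen) (?X k * gen PP) (gen PP * ?X k)"
          by (rule ideal_cong_base) (auto simp: r0_rels_def)
        from ideal_uminus[OF this[unfolded ideal_cong_def]] show ?thesis
          by (simp add: ideal_cong_def)
      qed
      from ideal_cong_right[OF ext_mono_commute[of _ _ ?X, OF c], of s "word (?T j)"]
      have 1: "ideal_cong (r0_rels gen) (gen PP * (ext_mono ?X s * word (?T j)))
          (ext_mono ?X s * (gen PP * word (?T j)))"
        by (simp add: mult.assoc)
      show ?thesis
      proof (cases j)
        case False
        then show ?thesis using 1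
          by (intro exI[of _ "(s, True)"] exI[of _ 1])
            (simp add: i PP word_append word_ext_word word_Nil word_Cons scalar_one)
      next
        case True
        have "ideal_cong (r0_rels gen) (gen PP * gen PP) 0"
          by (rule ideal_cong_0_base) (simp add: r0_rels_def)
        from ideal_cong_trans[OF 1] ideal_cong_left[OF this, of "ext_mono ?X s"] True show ?thesis
          by (intro exI[of _ i] exI[of _ 0])
            (simp add: i PP word_append word_ext_word word_Nil word_Cons scalar_zero)
      qed
    qed
  next
    fix i :: "(bool \<times> bool) \<times> bool"
    obtain s j where i: "i = (s, j)" by (cases i)
    show "free_eval (*) 1 r0_class (word (case i of (s, j) \<Rightarrow> ext_word Ext s @ ?T j))
        = (case i of (s, j) \<Rightarrow> lift (u_mono s) * (if j then P_cl else 1))"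
      by (simp add: i word_append word_ext_word lift_u_mono ext_mono_def ev' word_Cons word_Nil)
  next
    fix c :: "(bool \<times> bool) \<times> bool \<Rightarrow> real"
    have "(\<Sum>i\<in>UNIV. c i *\<^sub>R (case i of (s, j) \<Rightarrow> lift (u_mono s) * (if j then P_cl else 1)))
        = lift (u_comb (\<lambda>s. c (s, False))) + lift (u_comb (\<lambda>s. c (s, True))) * P_cl"
      by (simp add: sum_UNIV_prod sum_UNIV_bool u_comb_def lift_sum lift_hom distrib_right)
    note sum = this
    show "c = (\<lambda>i. 0)"
      if "(\<Sum>i\<in>UNIV. c i *\<^sub>R (case i of (s, j) \<Rightarrow> lift (u_mono s) * (if j then P_cl else 1))) = 0"
    proof (rule ext)
      fix i :: "(bool \<times> bool) \<times> bool"
      obtain s j where i: "i = (s, j)" by (cases i)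
      have "u_comb (\<lambda>s. c (s, False)) = 0 \<and> u_comb (\<lambda>s. c (s, True)) = 0"
        using that inv_coh_eq_iff[of _ _ 0 0] unfolding sum by (simp add: lift_hom)
      then have "c (s, False) = 0" "c (s, True) = 0" by (auto dest: u_comb_eq_0)
      then show "c i = 0" by (cases j) (simp_all add: i)
    qed
  next
    fix b :: "X coh" assume "b \<in> inv_coh"
    then obtain \<eta> \<xi> where b: "b = lift \<eta> + lift \<xi> * P_cl" by (auto simp: inv_coh_eq)
    obtain c d where "\<eta> = u_comb c" "\<xi> = u_comb d" using u_comb_surj by metis
    then show "\<exists>c. b = (\<Sum>i\<in>UNIV. c i *\<^sub>R (case i of (s, j) \<Rightarrow> lift (u_mono s) * (if j then P_cl else 1)))"
      by (intro exI[of _ "\<lambda>(s, j). if j then d s else c s"])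
        (simp add: b sum_UNIV_prod sum_UNIV_bool u_comb_def lift_sum lift_hom distrib_right)
  qed (simp add: ext_word_def)
qed

section \<open>The subalgebra generated by the classes \<open>x\<^sub>k\<close>\<close>

lemma amb_eq_iff: "amb a = amb b \<longleftrightarrow> a = b"
  by (simp add: amb_def)

lemma star_amb_amb: "amb a \<star> amb b = amb (a * b)"
  by (rule orient_eqI) (simp_all add: fst_star snd_star amb_def lift_hom)

lemma amb_lin: "amb (a + b) = amb a + amb b" "amb (r *\<^sub>R a) = r *\<^sub>R amb a" "amb 0 = 0"
  "amb (a - b) = amb a - amb b"
  by (simp_all add: amb_def zero_prod_def)

lemma amb_sum: "amb (sum f A) = (\<Sum>i\<in>A. amb (f i))"
  by (induction A rule: infinite_finite_induct) (simp_all add: amb_lin)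

lemma unital_algebra_lift: "unital_algebra (range (\<lambda>\<eta>. amb (lift \<eta>))) (\<star>) (amb coh_one)"
proof (rule unital_algebra_starI)
  show "subspace (range (\<lambda>\<eta>. amb (lift \<eta>)))"
    unfolding subspace_def by (auto simp: image_iff amb_lin[symmetric] lift_hom[symmetric] amb_eq_iff)
  show "amb coh_one \<in> range (\<lambda>\<eta>. amb (lift \<eta>))"
    by (rule image_eqI[of _ _ 1]) (simp_all add: coh_one_eq_1 lift_hom)
qed (auto simp: star_amb_amb lift_hom(3)[symmetric])

lemma amb_ext_class_mem: "amb (ext_class k) \<in> range (\<lambda>\<eta>. amb (lift \<eta>))"
  using ext_class_lift[of k] by (metis rangeI)

text \<open>Proved for an explicit carrier first; the surjectivity clause of the presentation then
  identifies this carrier with \<open>Lambda_x\<close>.\<close>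

lemma Lambda_x_presentation_range:
  "presented_algebra (range (\<lambda>\<eta>. amb (lift \<eta>))) (\<star>) (amb coh_one) (\<lambda>k. amb (ext_class k))
     (exterior_rels gen)"
proof (rule presented_algebraI[OF unital_algebra_lift amb_ext_class_mem,
      where nf = "ext_word (\<lambda>k. k)" and ?i0.0 = "(False, False)" and v = "\<lambda>s. amb (lift (u_mono s))"])
  note ev = ev_simps[OF unital_algebra_lift, of "\<lambda>k. amb (ext_class k)", OF amb_ext_class_mem]
  show "free_eval (\<star>) (amb coh_one) (\<lambda>k. amb (ext_class k)) s = 0" if mem: "s \<in> exterior_rels gen" for s
  proof -
    obtain a b where s: "s = (scalar a * gen X1 + scalar b * gen X2) * (scalar a * gen X1 + scalar b * gen X2)"
      using mem unfolding exterior_rels_def by blast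
    show ?thesis
      unfolding s by (simp add: ev)
        (simp add: star_amb_amb star_bilinear(3) coh_one_eq_1 amb_lin[symmetric] x_square_zero)
  qed
  show "\<exists>t r. ideal_cong (exterior_rels gen) (gen g * word (ext_word (\<lambda>k. k) i))
      (scalar r * word (ext_word (\<lambda>k. k) t))" for g i
    using ext_mono_step[of gen "exterior_rels gen" g i] by (simp add: word_ext_word)
  show "free_eval (\<star>) (amb coh_one) (\<lambda>k. amb (ext_class k)) (word (ext_word (\<lambda>k. k) s)) = amb (lift (u_mono s))" for s
    by (simp add: word_ext_word lift_u_mono ext_mono_def ev star_amb_amb) (simp add: coh_one_eq_1)
  have sum: "(\<Sum>s\<in>UNIV. c s *\<^sub>R amb (lift (u_mono s))) = amb (lift (u_comb c))" for c
    by (simp add: u_comb_def lift_sum lift_hom amb_sum amb_lin)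
  show "c = (\<lambda>i. 0)" if "(\<Sum>s\<in>UNIV. c s *\<^sub>R amb (lift (u_mono s))) = 0" for c
  proof -
    have "lift (u_comb c) = 0" using that unfolding sum by (simp add: amb_def zero_prod_def)
    then have "u_comb c = 0" by (metis res_lift res_hom(5))
    then show ?thesis by (auto dest: u_comb_eq_0)
  qed
  show "\<exists>c. b = (\<Sum>s\<in>UNIV. c s *\<^sub>R amb (lift (u_mono s)))" if "b \<in> range (\<lambda>\<eta>. amb (lift \<eta>))" for b
    using that u_comb_surj unfolding sum by (metis imageE)
qed (simp add: ext_word_def)

lemma Lambda_x_eq: "Lambda_x = range (\<lambda>\<eta>. amb (lift \<eta>))"
  using Lambda_x_presentation_range by (simp add: presented_algebra_def Lambda_x_def)

section \<open>The presentation of the orientifold algebra\<close>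

lemma e_cl_eq: "e_cl \<epsilon> = (0, axis \<epsilon> 1)"
  by (simp add: e_cl_def coh_one_eq_1)

lemma star_amb_e: "amb a \<star> e_cl \<epsilon> = (0, axis \<epsilon> (res a))"
  by (rule orient_eqI) (simp_all add: e_cl_eq star_amb axis_def)

lemma star_e_amb: "e_cl \<epsilon> \<star> amb a = (0, axis \<epsilon> (res a))"
  by (rule orient_eqI) (simp_all add: e_cl_eq fst_star snd_star amb_def axis_def lift_hom)

lemma star_e_e: "e_cl \<epsilon> \<star> e_cl \<delta> = (if \<epsilon> = \<delta> then amb P_cl else 0)"
proof (rule orient_eqI)
  have "(\<Sum>\<kappa>\<in>UNIV. lift (axis \<epsilon> 1 $ \<kappa> * axis \<delta> 1 $ \<kappa>) * P_cl)
      = (\<Sum>\<kappa>\<in>UNIV. if \<kappa> = \<epsilon> then (if \<epsilon> = \<delta> then P_cl else 0) else 0)"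
    by (rule sum.cong) (auto simp: axis_def lift_hom)
  then show "fst (e_cl \<epsilon> \<star> e_cl \<delta>) = fst (if \<epsilon> = \<delta> then amb P_cl else 0)"
    by (simp add: fst_star e_cl_eq amb_def)
qed (simp add: snd_star e_cl_eq amb_def res_hom)

lemma axis_zero: "(0, axis \<epsilon> 0) = amb 0"
  by (simp add: amb_def axis_def vec_eq_iff)

lemma sum_axis: "(\<Sum>\<epsilon>\<in>UNIV. (0 :: X coh, axis \<epsilon> (f \<epsilon>))) = (0, \<chi> \<epsilon>. f \<epsilon>)"
  for f :: "bool \<times> bool \<Rightarrow> L coh"
  by (rule orient_eqI) (simp_all add: fst_sum snd_sum axis_def)

text \<open>A factor \<open>amb (lift \<eta>)\<close> is determined by its product with
  \<open>e_cl \<epsilon>\<close>, since \<open>res (lift \<eta>) = \<eta>\<close>. So both parts can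
  be read off from the components of \<open>b\<close>.\<close>

lemma orient_decomposition:
  assumes "b \<in> \<B>"
  shows "\<exists>!d. case d of (r, l) \<Rightarrow> r \<in> amb ` inv_coh \<and> (\<forall>\<epsilon>. l \<epsilon> \<in> Lambda_x) \<and>
     b = r + (\<Sum>\<epsilon>\<in>UNIV. l \<epsilon> \<star> e_cl \<epsilon>)"
proof (rule ex1I)
  have sum: "(\<Sum>\<epsilon>\<in>UNIV. amb (lift (f \<epsilon>)) \<star> e_cl \<epsilon>) = (0, \<chi> \<epsilon>. f \<epsilon>)" for f
    by (simp add: star_amb_e res_lift sum_axis)
  show "case (amb (fst b), \<lambda>\<epsilon>. amb (lift (snd b $ \<epsilon>))) of (r, l) \<Rightarrow> r \<in> amb ` inv_coh \<and>
      (\<forall>\<epsilon>. l \<epsilon> \<in> Lambda_x) \<and> b = r + (\<Sum>\<epsilon>\<in>UNIV. l \<epsilon> \<star> e_cl \<epsilon>)"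
    using assms by (simp add: sum Lambda_x_eq mem_orient_alg) (simp add: amb_def prod_eq_iff)
  fix d assume d: "case d of (r, l) \<Rightarrow> r \<in> amb ` inv_coh \<and> (\<forall>\<epsilon>. l \<epsilon> \<in> Lambda_x) \<and>
     b = r + (\<Sum>\<epsilon>\<in>UNIV. l \<epsilon> \<star> e_cl \<epsilon>)"
  obtain r l where rl: "d = (r, l)" by (cases d)
  with d obtain a where a: "r = amb a" by auto
  have "\<forall>\<epsilon>. \<exists>\<eta>. l \<epsilon> = amb (lift \<eta>)" using d rl by (auto simp: Lambda_x_eq)
  then obtain f where f: "l = (\<lambda>\<epsilon>. amb (lift (f \<epsilon>)))" by metis
  have "b = amb a + (0, \<chi> \<epsilon>. f \<epsilon>)" using d by (simp add: rl a f sum)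
  then show "d = (amb (fst b), \<lambda>\<epsilon>. amb (lift (snd b $ \<epsilon>)))"
    by (simp add: rl a f amb_def)
qed

lemma b_class_mem: "b_class g \<in> \<B>"
proof (cases g)
  case (R0 h)
  then show ?thesis using r0_class_inv[of h] by (simp add: mem_orient_alg amb_def)
next
  case (E \<epsilon>)
  then show ?thesis using subspace_0[OF subspace_inv_coh] by (simp add: mem_orient_alg e_cl_def)
qed

text \<open>An exponent vector and a tail: \<open>None\<close> stands for 1,
  \<open>Some None\<close> for P and \<open>Some (Some \<epsilon>)\<close> for the reflection unit
  of \<epsilon>. This gives 4 times 6 indices.\<close>

type_synonym b_index = "(bool \<times> bool) \<times> (bool \<times> bool) option option"

primrec tail_word :: "(bool \<times> bool) option option \<Rightarrow> b_gen list" where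
  "tail_word None = []"
| "tail_word (Some t) = (case t of None \<Rightarrow> [R0 PP] | Some \<epsilon> \<Rightarrow> [E \<epsilon>])"

primrec tail_class :: "(bool \<times> bool) option option \<Rightarrow> orient" where
  "tail_class None = amb coh_one"
| "tail_class (Some t) = (case t of None \<Rightarrow> amb P_cl | Some \<epsilon> \<Rightarrow> e_cl \<epsilon>)"

definition b_word :: "b_index \<Rightarrow> b_gen list" where
  "b_word i = ext_word (\<lambda>k. R0 (Ext k)) (fst i) @ tail_word (snd i)"

definition b_basis :: "b_index \<Rightarrow> orient" where
  "b_basis i = amb (lift (u_mono (fst i))) \<star> tail_class (snd i)"

lemma b_basis_sum:
  "(\<Sum>i\<in>UNIV. c i *\<^sub>R b_basis i) =
     (lift (u_comb (\<lambda>s. c (s, None))) + lift (u_comb (\<lambda>s. c (s, Some None))) * P_cl,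
      \<chi> \<epsilon>. u_comb (\<lambda>s. c (s, Some (Some \<epsilon>))))"
proof -
  have "(\<Sum>s\<in>UNIV. c (s, Some (Some \<epsilon>)) *\<^sub>R b_basis (s, Some (Some \<epsilon>)))
      = (0, axis \<epsilon> (u_comb (\<lambda>s. c (s, Some (Some \<epsilon>)))))" for \<epsilon>
    by (rule orient_eqI)
      (simp_all add: b_basis_def star_amb_e res_lift fst_sum snd_sum u_comb_def axis_def)
  moreover have "(\<Sum>s\<in>UNIV. c (s, None) *\<^sub>R b_basis (s, None)) = amb (lift (u_comb (\<lambda>s. c (s, None))))"
    by (simp add: b_basis_def star_unit u_comb_def lift_sum lift_hom amb_sum amb_lin)
  moreover have "(\<Sum>s\<in>UNIV. c (s, Some None) *\<^sub>R b_basis (s, Some None))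
      = amb (lift (u_comb (\<lambda>s. c (s, Some None))) * P_cl)"
    by (simp add: b_basis_def star_amb_amb u_comb_def lift_sum lift_hom amb_sum amb_lin sum_distrib_right)
  ultimately show ?thesis
    by (simp only: sum_UNIV_prod[where 'b = "(bool \<times> bool) option option"] sum_UNIV_option sum_axis)
      (simp add: amb_def)
qed

lemma b_basis_independent:
  assumes "(\<Sum>i\<in>UNIV. c i *\<^sub>R b_basis i) = 0"
  shows "c = (\<lambda>i. 0)"
proof (rule ext)
  have "lift (u_comb (\<lambda>s. c (s, None))) + lift (u_comb (\<lambda>s. c (s, Some None))) * P_cl = lift 0 + lift 0 * P_cl"
    using arg_cong[OF assms, of fst] by (simp add: b_basis_sum lift_hom)
  moreover have 3: "u_comb (\<lambda>s. c (s, Some (Some \<epsilon>))) = 0" for \<epsilon>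
    using arg_cong[OF assms, of "\<lambda>b. snd b $ \<epsilon>"] by (simp add: b_basis_sum)
  ultimately have "u_comb (\<lambda>s. c (s, None)) = 0" "u_comb (\<lambda>s. c (s, Some None)) = 0"
    unfolding inv_coh_eq_iff by simp_all
  then have z: "c (s, None) = 0" "c (s, Some None) = 0" "c (s, Some (Some \<epsilon>)) = 0" for s \<epsilon>
    using u_comb_eq_0[OF 3] by (auto dest: u_comb_eq_0)
  fix i :: b_index
  obtain s t where i: "i = (s, t)" by (cases i)
  show "c i = 0"
  proof (cases t)
    case (Some t')
    then show ?thesis by (cases t') (simp_all add: i z)
  qed (simp add: i z)
qed

lemma b_basis_spans:
  assumes "b \<in> \<B>"
  shows "\<exists>c. b = (\<Sum>i\<in>UNIV. c i *\<^sub>R b_basis i)"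
proof -
  obtain \<eta> \<xi> where b: "fst b = lift \<eta> + lift \<xi> * P_cl"
    using assms by (auto simp: mem_orient_alg inv_coh_eq)
  obtain c where c: "\<And>\<eta>. \<eta> = u_comb (c \<eta>)" using u_comb_surj by metis
  show ?thesis
    by (rule exI[of _ "\<lambda>(s, t). case t of None \<Rightarrow> c \<eta> s
        | Some t' \<Rightarrow> (case t' of None \<Rightarrow> c \<xi> s | Some \<epsilon> \<Rightarrow> c (snd b $ \<epsilon>) s)"])
      (simp add: b_basis_sum prod_eq_iff b c[symmetric])
qed

text \<open>A normal word is an exterior monomial followed by at most one letter P or E. Two such
  letters in a row always reduce to P or to 0, so tails never grow.\<close>

lemma b_presentation: "presented_algebra \<B> (\<star>) (amb coh_one) b_class (b_rels gen)"
proof (rule presented_algebraI[OF unital_algebra_orient b_class_mem,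
      where nf = b_word and ?i0.0 = "((False, False), None)" and v = b_basis])
  note ev = ev_simps[OF unital_algebra_orient, of b_class, OF b_class_mem]
  let ?X = "\<lambda>k. gen (R0 (Ext k)) :: b_gen free_alg"
  let ?P = "gen (R0 PP) :: b_gen free_alg"
  let ?E = "\<lambda>\<epsilon>. gen (E \<epsilon>) :: b_gen free_alg"
  show "free_eval (\<star>) (amb coh_one) b_class s = 0" if "s \<in> b_rels gen" for s
  proof -
    consider (ext) a b where "s = (scalar a * ?X X1 + scalar b * ?X X2) * (scalar a * ?X X1 + scalar b * ?X X2)"
      | (P) "s = ?P * ?P" | (comm) k where "s = ?X k * ?P - ?P * ?X k"
      | (Ecomm) \<epsilon> k where "s = ?E \<epsilon> * ?X k - ?X k * ?E \<epsilon>"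
      | (PE) \<epsilon> where "s = ?P * ?E \<epsilon>" | (EP) \<epsilon> where "s = ?E \<epsilon> * ?P"
      | (EE) \<epsilon> \<delta> where "s = ?E \<epsilon> * ?E \<delta> - (if \<epsilon> = \<delta> then ?P else 0)"
      using \<open>s \<in> b_rels gen\<close> unfolding b_rels_def r0_rels_def exterior_rels_def by blast
    then show ?thesis
    proof cases
      case (ext a b)
      show ?thesis
        unfolding ext
        by (simp add: ev)
          (simp add: star_amb_amb star_bilinear(3) coh_one_eq_1 amb_lin[symmetric] x_square_zero)
    qed (simp_all add: ev star_amb_amb amb_lin[symmetric] P_P P_commute[of "ext_class k" for k] star_e_amb star_amb_e star_e_e
        res_P axis_zero)
  qed
  show "\<exists>l r. ideal_cong (b_rels gen) (gen g * word (b_word i)) (scalar r * word (b_word l))" for g i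
  proof -
    obtain s t where i: "i = (s, t)" by (cases i)
    have w: "word (b_word (s, t)) = ext_mono ?X s * word (tail_word t)" for s t
      by (simp add: b_word_def word_append word_ext_word)
    \<comment> \<open>The relation between P and \<open>x1\<close>, \<open>x2\<close> has the wrong
      orientation for moving P to the right.\<close>
    have sym: "ideal_cong (b_rels gen) y x" if "x - y \<in> b_rels gen" for x y :: "b_gen free_alg"
      using ideal_uminus[OF ideal_base[OF that]] by (simp add: ideal_cong_def)
    \<comment> \<open>A generator that commutes with the exterior letters moves through them, so
      only its effect on the tail has to be known.\<close>
    have pass: "\<exists>l r. ideal_cong (b_rels gen) (G * word (b_word i)) (scalar r * word (b_word l))"
      if c: "\<And>k. ideal_cong (b_rels gen) (G * ?X k) (?X k * G)"
        and t: "\<exists>t' r. ideal_cong (b_rels gen) (G * word (tail_word t)) (scalar r * word (tail_word t'))" for G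
    proof -
      obtain t' r where t': "ideal_cong (b_rels gen) (G * word (tail_word t)) (scalar r * word (tail_word t'))"
        using t by blast
      from ideal_cong_right[OF ext_mono_commute[of _ _ ?X, OF c], of s "word (tail_word t)"]
      have "ideal_cong (b_rels gen) (G * (ext_mono ?X s * word (tail_word t)))
          (ext_mono ?X s * (G * word (tail_word t)))"
        by (simp add: mult.assoc)
      also have "ideal_cong (b_rels gen) \<dots> (ext_mono ?X s * (scalar r * word (tail_word t')))"
        by (rule ideal_cong_left[OF t'])
      also have "\<dots> = scalar r * (ext_mono ?X s * word (tail_word t'))"
        by (simp only: scalar_commute[of "ext_mono ?X s" r] flip: mult.assoc)
      finally show ?thesis
        by (intro exI[of _ "(s, t')"] exI[of _ r]) (simp add: i w)
    qed
    have zero: "\<exists>t' r. ideal_cong (b_rels gen) y (scalar r * word (tail_word t'))"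
      if "y \<in> b_rels gen" for y
      using ideal_cong_0_base[OF that] by (intro exI[of _ None] exI[of _ 0]) (simp add: scalar_zero)
    have one: "\<exists>t' r. ideal_cong (b_rels gen) y (scalar r * word (tail_word t'))"
      if "ideal_cong (b_rels gen) y (word (tail_word t0))" for y t0
      using that by (intro exI[of _ t0] exI[of _ 1]) (simp add: scalar_one)
    show ?thesis
    proof (cases g)
      case (R0 h)
      show ?thesis
      proof (cases h)
        case (Ext k)
        have "exterior_rels ?X \<subseteq> b_rels gen" by (auto simp: b_rels_def r0_rels_def)
        then obtain t' r where "ideal_cong (b_rels gen) (?X k * ext_mono ?X s) (scalar r * ext_mono ?X t')"
          using ext_mono_step by blast
        from ideal_cong_right[OF this, of "word (tail_word t)"] show ?thesis
          by (intro exI[of _ "(t', t)"] exI[of _ r]) (simp add: i w R0 Ext mult.assoc)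
      next
        case PP
        have "\<exists>t' r. ideal_cong (b_rels gen) (?P * word (tail_word t)) (scalar r * word (tail_word t'))"
        proof (cases t)
          case None
          then show ?thesis
            by (intro one[of _ "Some None"]) (simp add: word_Cons word_Nil ideal_cong_refl)
        next
          case (Some t1)
          show ?thesis
          proof (cases t1)
            case None
            have "?P * ?P \<in> b_rels gen" by (simp add: b_rels_def r0_rels_def)
            from zero[OF this] show ?thesis by (simp add: Some None word_Cons word_Nil)
          next
            case (Some \<epsilon>)
            have "?P * ?E \<epsilon> \<in> b_rels gen" unfolding b_rels_def by blast
            from zero[OF this] show ?thesis by (simp add: \<open>t = Some t1\<close> Some word_Cons word_Nil)
          qed
        qed
        moreover have "ideal_cong (b_rels gen) (?P * ?X k) (?X k * ?P)" for k
          by (rule sym) (unfold b_rels_def r0_rels_def, blast)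
        ultimately show ?thesis
          unfolding R0 PP by (intro pass)
      qed
    next
      case (E \<epsilon>)
      have "\<exists>t' r. ideal_cong (b_rels gen) (?E \<epsilon> * word (tail_word t)) (scalar r * word (tail_word t'))"
      proof (cases t)
        case None
        then show ?thesis
          by (intro one[of _ "Some (Some \<epsilon>)"]) (simp add: word_Cons word_Nil ideal_cong_refl)
      next
        case (Some t1)
        show ?thesis
        proof (cases t1)
          case None
          have "?E \<epsilon> * ?P \<in> b_rels gen" unfolding b_rels_def by blast
          from zero[OF this] show ?thesis by (simp add: Some None word_Cons word_Nil)
        next
          case (Some \<delta>)
          have rel: "?E \<epsilon> * ?E \<delta> - (if \<epsilon> = \<delta> then ?P else 0) \<in> b_rels gen"
            unfolding b_rels_def by blast
          show ?thesis
          proof (cases "\<epsilon> = \<delta>")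
            case True
            with ideal_cong_base[OF rel[unfolded if_P[OF True]]] show ?thesis
              by (intro one[of _ "Some None"]) (simp add: \<open>t = Some t1\<close> Some word_Cons word_Nil)
          next
            case False
            with zero[of "?E \<epsilon> * ?E \<delta>"] rel show ?thesis
              by (simp add: \<open>t = Some t1\<close> Some word_Cons word_Nil)
          qed
        qed
      qed
      moreover have "ideal_cong (b_rels gen) (?E \<epsilon> * ?X k) (?X k * ?E \<epsilon>)" for k
        by (rule ideal_cong_base) (unfold b_rels_def, blast)
      ultimately show ?thesis
        unfolding E by (intro pass)
    qed
  qed
  show "free_eval (\<star>) (amb coh_one) b_class (word (b_word i)) = b_basis i" for i
  proof -
    obtain s t where i: "i = (s, t)" by (cases i)
    have "free_eval (\<star>) (amb coh_one) b_class (ext_mono ?X s) = amb (lift (u_mono s))"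
      by (simp add: lift_u_mono ext_mono_def ev star_amb_amb) (simp add: coh_one_eq_1)
    moreover have "free_eval (\<star>) (amb coh_one) b_class (word (tail_word t)) = tail_class t"
      by (cases t) (auto simp: ev word_Cons word_Nil split: option.split)
    ultimately show ?thesis
      by (simp add: i b_word_def b_basis_def word_append word_ext_word ev)
  qed
qed (simp_all add: b_word_def ext_word_def b_basis_independent b_basis_spans)

section \<open>Dimensions\<close>

definition b_degree :: "b_index \<Rightarrow> nat" where
  "b_degree i = of_bool (fst (fst i)) + of_bool (snd (fst i))
     + (case snd i of None \<Rightarrow> 0 | Some t \<Rightarrow> (case t of None \<Rightarrow> 2 | Some \<epsilon> \<Rightarrow> 1))"

lemma b_basis_deg: "b_basis i \<in> orient_deg (b_degree i)"
proof -
  obtain s t where i: "i = (s, t)" by (cases i)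
  have "lift (u_mono s) \<in> coh_deg (int (of_bool (fst s) + of_bool (snd s)))"
    using coh_deg_pull[OF torus_map_proj u_mono_deg, of s] by (simp add: lift_def)
  then have 1: "amb (lift (u_mono s)) \<in> orient_deg (of_bool (fst s) + of_bool (snd s))"
    by (simp add: mem_orient_deg amb_def lift_inv zero_coh_deg)
  have 2: "amb coh_one \<in> orient_deg 0" "amb P_cl \<in> orient_deg 2"
    by (simp_all add: mem_orient_deg amb_def coh_one_eq_1 one_inv coh_deg_one P_inv P_deg zero_coh_deg)
  have "tail_class t \<in> orient_deg (case t of None \<Rightarrow> 0 | Some t \<Rightarrow> (case t of None \<Rightarrow> 2 | Some \<epsilon> \<Rightarrow> 1))"
    using 2 e_deg by (cases t) (auto split: option.split)
  from star_deg[OF 1 this] show ?thesis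
    by (simp add: i b_basis_def b_degree_def)
qed

lemma dim_orient_deg: "dim (orient_deg k) = card {i. b_degree i = k}"
proof (rule dim_graded_piece[where v = b_basis and B = \<B> and \<pi> = orient_component])
  show "orient_deg k \<subseteq> \<B>" for k by (auto simp: mem_orient_deg mem_orient_alg)
qed (simp_all add: b_basis_independent b_basis_spans b_basis_deg subspace_orient_deg
    linear_orient_component orient_component_deg)

text \<open>The degrees of monomial and tail add, so the counts are the coefficients of
  \<open>(1 + t)^2 (1 + 4 t + t^2)\<close>.\<close>

lemma card_b_degree:
  "card {i. b_degree i = k} = of_bool (0 = k) + 6 * of_bool (1 = k) + 10 * of_bool (2 = k)
     + 6 * of_bool (3 = k) + of_bool (4 = k)"
proof -
  have "card {i. b_degree i = k} = (\<Sum>i\<in>UNIV. of_bool (b_degree i = k))"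
    by (simp add: of_bool_def sum.If_cases)
  also have "\<dots> = (\<Sum>t\<in>UNIV. \<Sum>s\<in>UNIV. of_bool (b_degree (s, t) = k))"
    by (rule sum_UNIV_prod)
  also have "\<dots> = of_bool (0 = k) + 6 * of_bool (1 = k) + 10 * of_bool (2 = k)
     + 6 * of_bool (3 = k) + of_bool (4 = k)"
    by (simp only: sum_UNIV_option) (simp add: b_degree_def UNIV_bool2 numeral_eq_Suc)
  finally show ?thesis .
qed

lemma dim_orient: "dim \<B> = 24"
proof -
  have "span (range b_basis) \<subseteq> \<B>"
    using b_basis_deg unital_algebra_orient
    by (intro span_minimal) (auto simp: mem_orient_deg mem_orient_alg unital_algebra_def)
  moreover have "b \<in> span (range b_basis)" if "b \<in> \<B>" for b
    using b_basis_spans[OF that] by (auto intro!: span_sum span_scale intro: span_base)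
  ultimately have "\<B> = span (range b_basis)" by blast
  then have "dim \<B> = CARD(b_index)"
    using dim_span_family[of b_basis UNIV] b_basis_independent by simp
  then show ?thesis by (simp add: card_UNIV_option)
qed

lemma poincare_orient: "poincare_series orient_deg = fps_of_poly [:1, 6, 10, 6, 1:]"
proof (rule fps_ext)
  fix k :: nat
  consider "k = 0" | "k = 1" | "k = 2" | "k = 3" | "k = 4" | "k > 4" by linarith
  then show "fps_nth (poincare_series orient_deg) k = fps_nth (fps_of_poly [:1, 6, 10, 6, 1:]) k"
  proof cases
    case 6
    have "coeff [:1, 6, 10, 6, 1 :: int:] k = 0"
      by (rule coeff_eq_0) (use 6 in simp)
    with 6 show ?thesis
      by (simp add: poincare_series_def dim_orient_deg card_b_degree)
  qed (simp_all add: poincare_series_def dim_orient_deg card_b_degree numeral_eq_Suc)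
qed

section \<open>Trace and pairing\<close>

lemma tau_coords: "coh_pull tau x1 = x1" "coh_pull tau x2 = x2" "coh_pull tau y1 = - y1" "coh_pull tau y2 = - y2"
proof -
  have t: "fst (tau z) = cnj (fst z)" "snd (tau z) = cnj (snd z)" for z
    by (simp_all add: tau_def case_prod_beta)
  have m: "covector (\<lambda>z::X. - l z) = (\<lambda>vs. - covector l vs)" for l
    by (auto simp: covector_def fun_eq_iff split: list.split)
  show "coh_pull tau x1 = x1" "coh_pull tau x2 = x2" "coh_pull tau y1 = - y1" "coh_pull tau y2 = - y2"
    by (simp_all add: harmonic_inject[symmetric] harmonic_coh_pull[OF torus_map_tau] harmonic_coords
        harmonic_minus covector_map t m)
qed

text \<open>\<open>tau\<close> negates both \<open>y1\<close> and \<open>y2\<close>, and the two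
  signs cancel.\<close>

lemma q_inv: "q_cl \<in> inv_coh"
  by (simp add: inv_coh_def q_cl_def cup_eq coh_pull_hom[OF torus_map_tau] tau_coords)

lemma integral_q: "integral_X q_cl = 1"
  by (simp add: q_cl_def cup_eq integral_X_eq harmonic_times harmonic_coords shuffle_eval)

lemma Tr_lin: "Tr (\<alpha> + \<beta>) = Tr \<alpha> + Tr \<beta>" "Tr (r *\<^sub>R \<alpha>) = r * Tr \<alpha>"
  by (simp_all add: Tr_def integral_X_hom)

lemma frobenius_orient: "frobenius_pairing \<B> (\<star>) pairing"
  by (simp add: frobenius_pairing_def bilinear_on_def pairing_def star_bilinear Tr_lin star_assoc)

text \<open>The trace sees only the coefficient of P. Testing with \<open>lift \<zeta>\<close>
  therefore detects \<xi>, testing with \<open>lift \<zeta> * P_cl\<close> detects \<eta>, and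
  nondegeneracy reduces to duality on L.\<close>

lemma pairing_amb_lift:
  assumes "fst \<alpha> = lift \<eta> + lift \<xi> * P_cl"
  shows "pairing \<alpha> (amb (lift \<zeta>)) = integral_L (\<xi> * \<zeta>)" "pairing (amb (lift \<zeta>)) \<alpha> = integral_L (\<zeta> * \<xi>)"
    "pairing \<alpha> (amb (lift \<zeta> * P_cl)) = integral_L (\<eta> * \<zeta>)"
    "pairing (amb (lift \<zeta> * P_cl)) \<alpha> = integral_L (\<zeta> * \<eta>)"
proof -
  note s = fst_star amb_def assms distrib_left distrib_right lift_P_times times_lift_P res_lift
    res_hom(1,3) res_P lift_hom(3,5)
  have 1: "fst (\<alpha> \<star> amb (lift \<zeta>)) = lift (\<eta> * \<zeta>) + lift (\<xi> * \<zeta>) * P_cl"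
    "fst (amb (lift \<zeta>) \<star> \<alpha>) = lift (\<zeta> * \<eta>) + lift (\<zeta> * \<xi>) * P_cl"
    "fst (\<alpha> \<star> amb (lift \<zeta> * P_cl)) = lift (\<eta> * \<zeta>) * P_cl"
    "fst (amb (lift \<zeta> * P_cl) \<star> \<alpha>) = lift (\<zeta> * \<eta>) * P_cl"
    by (simp_all add: s)
  show "pairing \<alpha> (amb (lift \<zeta>)) = integral_L (\<xi> * \<zeta>)" "pairing (amb (lift \<zeta>)) \<alpha> = integral_L (\<zeta> * \<xi>)"
    "pairing \<alpha> (amb (lift \<zeta> * P_cl)) = integral_L (\<eta> * \<zeta>)"
    "pairing (amb (lift \<zeta> * P_cl)) \<alpha> = integral_L (\<zeta> * \<eta>)"
    unfolding pairing_def Tr_def 1 by (simp_all only: integral_X_hom integral_X_lift integral_X_lift_P add_0)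
qed

text \<open>The trace is zero on the reflection summands, but the product of two reflection classes
  is ambient, and the Gysin map turns its integral into one over the torus. This detects the
  component at \<epsilon>.\<close>

lemma pairing_axis:
  "pairing \<alpha> (0, axis \<epsilon> \<zeta>) = integral_L (snd \<alpha> $ \<epsilon> * \<zeta>)"
  "pairing (0, axis \<epsilon> \<zeta>) \<alpha> = integral_L (\<zeta> * snd \<alpha> $ \<epsilon>)"
proof -
  have "(\<Sum>\<kappa>\<in>UNIV. lift (snd \<alpha> $ \<kappa> * axis \<epsilon> \<zeta> $ \<kappa>) * P_cl)
      = (\<Sum>\<kappa>\<in>UNIV. if \<kappa> = \<epsilon> then lift (snd \<alpha> $ \<epsilon> * \<zeta>) * P_cl else 0)"
    by (rule sum.cong) (auto simp: axis_def lift_hom(5))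
  then show "pairing \<alpha> (0, axis \<epsilon> \<zeta>) = integral_L (snd \<alpha> $ \<epsilon> * \<zeta>)"
    by (simp add: pairing_def Tr_def fst_star integral_X_lift_P)
  have "(\<Sum>\<kappa>\<in>UNIV. lift (axis \<epsilon> \<zeta> $ \<kappa> * snd \<alpha> $ \<kappa>) * P_cl)
      = (\<Sum>\<kappa>\<in>UNIV. if \<kappa> = \<epsilon> then lift (\<zeta> * snd \<alpha> $ \<epsilon>) * P_cl else 0)"
    by (rule sum.cong) (auto simp: axis_def lift_hom(5))
  then show "pairing (0, axis \<epsilon> \<zeta>) \<alpha> = integral_L (\<zeta> * snd \<alpha> $ \<epsilon>)"
    by (simp add: pairing_def Tr_def fst_star integral_X_lift_P)
qed

lemma nondegenerate_orient: "nondegenerate_on \<B> pairing"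
proof -
  have mem: "amb (lift \<zeta>) \<in> \<B>" "amb (lift \<zeta> * P_cl) \<in> \<B>" "(0, axis \<epsilon> \<zeta>) \<in> \<B>" for \<zeta> \<epsilon>
    using subspace_0[OF subspace_inv_coh]
    by (simp_all add: mem_orient_alg amb_def lift_inv inv_coh_times P_inv)
  have zero: "\<alpha> = 0" if "fst \<alpha> = lift 0 + lift 0 * P_cl" "\<And>\<epsilon>. snd \<alpha> $ \<epsilon> = 0" for \<alpha> :: orient
    using that by (intro orient_eqI) (simp_all add: lift_hom)
  show ?thesis
    unfolding nondegenerate_on_def
  proof (intro conjI ballI impI)
    fix \<alpha> assume \<alpha>: "\<alpha> \<in> \<B>" "\<forall>\<beta>\<in>\<B>. pairing \<alpha> \<beta> = 0"
    obtain \<eta> \<xi> where f: "fst \<alpha> = lift \<eta> + lift \<xi> * P_cl"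
      using \<alpha>(1) by (auto simp: mem_orient_alg inv_coh_eq)
    have z: "pairing \<alpha> (amb (lift \<zeta>)) = 0" "pairing \<alpha> (amb (lift \<zeta> * P_cl)) = 0"
      "pairing \<alpha> (0, axis \<epsilon> \<zeta>) = 0" for \<zeta> \<epsilon>
      using \<alpha>(2) mem by blast+
    have "\<xi> = 0" "\<eta> = 0" "snd \<alpha> $ \<epsilon> = 0" for \<epsilon>
      by (rule poincare_duality_L(1); use z in \<open>simp add: pairing_amb_lift[OF f] pairing_axis\<close>)+
    with f show "\<alpha> = 0" by (intro zero) simp_all
  next
    fix \<alpha> assume \<alpha>: "\<alpha> \<in> \<B>" "\<forall>\<beta>\<in>\<B>. pairing \<beta> \<alpha> = 0"
    obtain \<eta> \<xi> where f: "fst \<alpha> = lift \<eta> + lift \<xi> * P_cl"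
      using \<alpha>(1) by (auto simp: mem_orient_alg inv_coh_eq)
    have z: "pairing (amb (lift \<zeta>)) \<alpha> = 0" "pairing (amb (lift \<zeta> * P_cl)) \<alpha> = 0"
      "pairing (0, axis \<epsilon> \<zeta>) \<alpha> = 0" for \<zeta> \<epsilon>
      using \<alpha>(2) mem by blast+
    have "\<xi> = 0" "\<eta> = 0" "snd \<alpha> $ \<epsilon> = 0" for \<epsilon>
      by (rule poincare_duality_L(2); use z in \<open>simp add: pairing_amb_lift[OF f] pairing_axis\<close>)+
    with f show "\<alpha> = 0" by (intro zero) simp_all
  qed
qed

(* In order: the invariant ambient algebra R_0; the graded algebra B and its decomposition;
   the presentation of B; Poincare polynomial and dimension; trace and pairing. *)
theorem theorem5p3:
  shows
    "(graded_algebra inv_coh (\<lambda>k. inv_coh \<inter> coh_deg (int k)) (\<smile>) coh_one \<and>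
      presented_algebra inv_coh (\<smile>) coh_one r0_class (r0_rels gen) \<and>
      x1 \<in> coh_deg 1 \<and> x2 \<in> coh_deg 1 \<and> P_cl \<in> coh_deg 2) \<and>
     (graded_algebra \<B> orient_deg (\<star>) (amb coh_one) \<and>
      presented_algebra Lambda_x (\<star>) (amb coh_one) (\<lambda>k. amb (ext_class k)) (exterior_rels gen) \<and>
      (\<forall>b\<in>\<B>. \<exists>!d. case d of (r, l) \<Rightarrow> r \<in> amb ` inv_coh \<and> (\<forall>\<epsilon>. l \<epsilon> \<in> Lambda_x) \<and>
         b = r + (\<Sum>\<epsilon>\<in>UNIV. l \<epsilon> \<star> e_cl \<epsilon>)) \<and>
      (\<forall>\<epsilon>. e_cl \<epsilon> \<in> orient_deg 1)) \<and>
     presented_algebra \<B> (\<star>) (amb coh_one) b_class (b_rels gen) \<and>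
     (poincare_series orient_deg = fps_of_poly [:1, 6, 10, 6, 1:] \<and> dim \<B> = 24) \<and>
     (amb q_cl \<in> \<B> \<and> Tr (amb q_cl) = 1 \<and>
      frobenius_pairing \<B> (\<star>) pairing \<and> nondegenerate_on \<B> pairing)"
proof (intro conjI ballI allI)
  show "x1 \<in> coh_deg 1" "x2 \<in> coh_deg 1"
    by (auto simp: mem_coh_deg harmonic_coords covector_def split: list.split)
  show "presented_algebra Lambda_x (\<star>) (amb coh_one) (\<lambda>k. amb (ext_class k)) (exterior_rels gen)"
    unfolding Lambda_x_eq by (rule Lambda_x_presentation_range)
  show "amb q_cl \<in> \<B>" "Tr (amb q_cl) = 1"
    by (simp_all add: mem_orient_alg amb_def Tr_def q_inv integral_q)
qed (rule graded_algebra_inv r0_presentation P_deg graded_algebra_orient e_deg b_presentation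
    poincare_orient dim_orient frobenius_orient nondegenerate_orient orient_decomposition; assumption?)+

end
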